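(* If $A$ is an acyclic type and $B$ is a family of acyclic types over $A$, then the dependent sum $\sum_{a : A} B(a)$ is acyclic.
   Context: We work in homotopy type theory (HoTT) in the style of the HoTT Book: dependent type theory with univalent universes (hence function extensionality) and higher inductive types such as pushouts; no classical axioms are assumed. The suspension $\Sigma A$ of a type $A$ is the pushout of $\mathbf{1} \leftarrow A \to \mathbf{1}$. A type is acyclic if its suspension is contractible. *)

theory Defs
  imports Main
begin

text \<open>
  Homotopy type theory, presented as a formal system in the style of the second presentation in
  Appendix A of the HoTT Book: a cumulative hierarchy of univalent Russell universes, the basic
  type formers, and pushouts as higher inductive types.  The system has to be embedded deeply. If
  type families were represented by arbitrary HOL functions, a family could distinguish
  reflexivity from other identifications by a HOL case distinction; this would refute univalence.

  Terms use de Bruijn indices; types are terms that inhabit a universe.  The comments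
  in the datatype list the arguments under binders, written Book-style as \<open>x. t\<close>; when an
  argument binds several variables, the last one has index 0.
\<close>

datatype tm =
    Var nat
  | Univ nat
  | Pi tm tm                        (* A, x. B *)
  | Lam tm tm                       (* A, x. b *)
  | App tm tm
  | Sig tm tm                       (* A, x. B *)
  | Pr tm tm
  | IndSig tm tm tm                 (* z. C, x y. g, p *)
  | Plus tm tm
  | InL tm
  | InR tm
  | IndPlus tm tm tm tm             (* z. C, x. c, y. d, e *)
  | TEmpty
  | IndEmpty tm tm                  (* z. C, e *)
  | TUnit
  | Star
  | IndUnit tm tm tm                (* z. C, c, e *)
  | TNat
  | TZero
  | TSucc tm
  | IndNat tm tm tm tm              (* z. C, c0, x y. cs, n *)
  | TId tm tm tm
  | Refl tm
  | IndId tm tm tm tm tm            (* x y p. C, z. c, a, b, p *)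
  | Push tm tm tm tm tm             (* C, A, B, f : C -> A, g : C -> B *)
  | PInl tm
  | PInr tm
  | Glue tm
  | IndPush tm tm tm tm tm          (* z. P, x. l, y. r, c. q, e *)
  | GlueComp tm tm tm tm tm         (* z. P, x. l, y. r, c. q, c *)
  | UA nat tm tm


section \<open>Substitution\<close>

fun upr :: "(nat \<Rightarrow> nat) \<Rightarrow> nat \<Rightarrow> nat" where
  "upr \<rho> 0 = 0"
| "upr \<rho> (Suc n) = Suc (\<rho> n)"

primrec ren :: "(nat \<Rightarrow> nat) \<Rightarrow> tm \<Rightarrow> tm" where
  "ren \<rho> (Var n) = Var (\<rho> n)"
| "ren \<rho> (Univ i) = Univ i"
| "ren \<rho> (Pi A B) = Pi (ren \<rho> A) (ren (upr \<rho>) B)"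
| "ren \<rho> (Lam A b) = Lam (ren \<rho> A) (ren (upr \<rho>) b)"
| "ren \<rho> (App f a) = App (ren \<rho> f) (ren \<rho> a)"
| "ren \<rho> (Sig A B) = Sig (ren \<rho> A) (ren (upr \<rho>) B)"
| "ren \<rho> (Pr a b) = Pr (ren \<rho> a) (ren \<rho> b)"
| "ren \<rho> (IndSig C g p) = IndSig (ren (upr \<rho>) C) (ren (upr (upr \<rho>)) g) (ren \<rho> p)"
| "ren \<rho> (Plus A B) = Plus (ren \<rho> A) (ren \<rho> B)"
| "ren \<rho> (InL a) = InL (ren \<rho> a)"
| "ren \<rho> (InR b) = InR (ren \<rho> b)"
| "ren \<rho> (IndPlus C c d e) =
     IndPlus (ren (upr \<rho>) C) (ren (upr \<rho>) c) (ren (upr \<rho>) d) (ren \<rho> e)"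
| "ren \<rho> TEmpty = TEmpty"
| "ren \<rho> (IndEmpty C e) = IndEmpty (ren (upr \<rho>) C) (ren \<rho> e)"
| "ren \<rho> TUnit = TUnit"
| "ren \<rho> Star = Star"
| "ren \<rho> (IndUnit C c e) = IndUnit (ren (upr \<rho>) C) (ren \<rho> c) (ren \<rho> e)"
| "ren \<rho> TNat = TNat"
| "ren \<rho> TZero = TZero"
| "ren \<rho> (TSucc n) = TSucc (ren \<rho> n)"
| "ren \<rho> (IndNat C c d n) =
     IndNat (ren (upr \<rho>) C) (ren \<rho> c) (ren (upr (upr \<rho>)) d) (ren \<rho> n)"
| "ren \<rho> (TId A a b) = TId (ren \<rho> A) (ren \<rho> a) (ren \<rho> b)"
| "ren \<rho> (Refl a) = Refl (ren \<rho> a)"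
| "ren \<rho> (IndId C c a b p) =
     IndId (ren (upr (upr (upr \<rho>))) C) (ren (upr \<rho>) c) (ren \<rho> a) (ren \<rho> b) (ren \<rho> p)"
| "ren \<rho> (Push C A B f g) = Push (ren \<rho> C) (ren \<rho> A) (ren \<rho> B) (ren \<rho> f) (ren \<rho> g)"
| "ren \<rho> (PInl a) = PInl (ren \<rho> a)"
| "ren \<rho> (PInr b) = PInr (ren \<rho> b)"
| "ren \<rho> (Glue c) = Glue (ren \<rho> c)"
| "ren \<rho> (IndPush P l r q e) =
     IndPush (ren (upr \<rho>) P) (ren (upr \<rho>) l) (ren (upr \<rho>) r) (ren (upr \<rho>) q) (ren \<rho> e)"
| "ren \<rho> (GlueComp P l r q c) =
     GlueComp (ren (upr \<rho>) P) (ren (upr \<rho>) l) (ren (upr \<rho>) r) (ren (upr \<rho>) q) (ren \<rho> c)"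
| "ren \<rho> (UA i A B) = UA i (ren \<rho> A) (ren \<rho> B)"

definition shift :: "nat \<Rightarrow> tm \<Rightarrow> tm" where
  "shift k = ren (\<lambda>n. n + k)"

fun up :: "(nat \<Rightarrow> tm) \<Rightarrow> nat \<Rightarrow> tm" where
  "up \<sigma> 0 = Var 0"
| "up \<sigma> (Suc n) = shift 1 (\<sigma> n)"

primrec sub :: "(nat \<Rightarrow> tm) \<Rightarrow> tm \<Rightarrow> tm" where
  "sub \<sigma> (Var n) = \<sigma> n"
| "sub \<sigma> (Univ i) = Univ i"
| "sub \<sigma> (Pi A B) = Pi (sub \<sigma> A) (sub (up \<sigma>) B)"
| "sub \<sigma> (Lam A b) = Lam (sub \<sigma> A) (sub (up \<sigma>) b)"
| "sub \<sigma> (App f a) = App (sub \<sigma> f) (sub \<sigma> a)"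
| "sub \<sigma> (Sig A B) = Sig (sub \<sigma> A) (sub (up \<sigma>) B)"
| "sub \<sigma> (Pr a b) = Pr (sub \<sigma> a) (sub \<sigma> b)"
| "sub \<sigma> (IndSig C g p) = IndSig (sub (up \<sigma>) C) (sub (up (up \<sigma>)) g) (sub \<sigma> p)"
| "sub \<sigma> (Plus A B) = Plus (sub \<sigma> A) (sub \<sigma> B)"
| "sub \<sigma> (InL a) = InL (sub \<sigma> a)"
| "sub \<sigma> (InR b) = InR (sub \<sigma> b)"
| "sub \<sigma> (IndPlus C c d e) =
     IndPlus (sub (up \<sigma>) C) (sub (up \<sigma>) c) (sub (up \<sigma>) d) (sub \<sigma> e)"
| "sub \<sigma> TEmpty = TEmpty"
| "sub \<sigma> (IndEmpty C e) = IndEmpty (sub (up \<sigma>) C) (sub \<sigma> e)"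
| "sub \<sigma> TUnit = TUnit"
| "sub \<sigma> Star = Star"
| "sub \<sigma> (IndUnit C c e) = IndUnit (sub (up \<sigma>) C) (sub \<sigma> c) (sub \<sigma> e)"
| "sub \<sigma> TNat = TNat"
| "sub \<sigma> TZero = TZero"
| "sub \<sigma> (TSucc n) = TSucc (sub \<sigma> n)"
| "sub \<sigma> (IndNat C c d n) =
     IndNat (sub (up \<sigma>) C) (sub \<sigma> c) (sub (up (up \<sigma>)) d) (sub \<sigma> n)"
| "sub \<sigma> (TId A a b) = TId (sub \<sigma> A) (sub \<sigma> a) (sub \<sigma> b)"
| "sub \<sigma> (Refl a) = Refl (sub \<sigma> a)"
| "sub \<sigma> (IndId C c a b p) =
     IndId (sub (up (up (up \<sigma>))) C) (sub (up \<sigma>) c) (sub \<sigma> a) (sub \<sigma> b) (sub \<sigma> p)"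
| "sub \<sigma> (Push C A B f g) = Push (sub \<sigma> C) (sub \<sigma> A) (sub \<sigma> B) (sub \<sigma> f) (sub \<sigma> g)"
| "sub \<sigma> (PInl a) = PInl (sub \<sigma> a)"
| "sub \<sigma> (PInr b) = PInr (sub \<sigma> b)"
| "sub \<sigma> (Glue c) = Glue (sub \<sigma> c)"
| "sub \<sigma> (IndPush P l r q e) =
     IndPush (sub (up \<sigma>) P) (sub (up \<sigma>) l) (sub (up \<sigma>) r) (sub (up \<sigma>) q) (sub \<sigma> e)"
| "sub \<sigma> (GlueComp P l r q c) =
     GlueComp (sub (up \<sigma>) P) (sub (up \<sigma>) l) (sub (up \<sigma>) r) (sub (up \<sigma>) q) (sub \<sigma> c)"
| "sub \<sigma> (UA i A B) = UA i (sub \<sigma> A) (sub \<sigma> B)"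

fun scons :: "tm \<Rightarrow> (nat \<Rightarrow> tm) \<Rightarrow> nat \<Rightarrow> tm" (infixr "\<cdot>" 60) where
  "(a \<cdot> \<sigma>) 0 = a"
| "(a \<cdot> \<sigma>) (Suc n) = \<sigma> n"

text \<open>
  \<open>instw k t a\<close> replaces the variable bound in \<open>t\<close> by \<open>a\<close>, where \<open>a\<close> lives in an extension
  by \<open>k\<close> variables of the context in which \<open>x. t\<close> lives; \<open>instw2\<close> does this for the two variables
  \<open>x y\<close> of \<open>x y. t\<close>, and \<open>instw3\<close> for three. In \<open>shift_under t\<close> the context is extended by one
  variable below the bound variable of \<open>t\<close>.
\<close>

definition instw :: "nat \<Rightarrow> tm \<Rightarrow> tm \<Rightarrow> tm" where
  "instw k t a = sub (a \<cdot> (\<lambda>n. Var (n + k))) t"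

definition instw2 :: "nat \<Rightarrow> tm \<Rightarrow> tm \<Rightarrow> tm \<Rightarrow> tm" where
  "instw2 k t a b = sub (b \<cdot> a \<cdot> (\<lambda>n. Var (n + k))) t"

definition instw3 :: "nat \<Rightarrow> tm \<Rightarrow> tm \<Rightarrow> tm \<Rightarrow> tm \<Rightarrow> tm" where
  "instw3 k t a b c = sub (c \<cdot> b \<cdot> a \<cdot> (\<lambda>n. Var (n + k))) t"

abbreviation inst :: "tm \<Rightarrow> tm \<Rightarrow> tm" where
  "inst \<equiv> instw 0"

abbreviation inst2 :: "tm \<Rightarrow> tm \<Rightarrow> tm \<Rightarrow> tm" where
  "inst2 \<equiv> instw2 0"

abbreviation inst3 :: "tm \<Rightarrow> tm \<Rightarrow> tm \<Rightarrow> tm \<Rightarrow> tm" where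
  "inst3 \<equiv> instw3 0"

definition shift_under :: "nat \<Rightarrow> tm \<Rightarrow> tm" where
  "shift_under k = ren (upr (\<lambda>n. n + k))"


section \<open>Terms needed to state the rules for pushouts and univalence\<close>

definition arr :: "tm \<Rightarrow> tm \<Rightarrow> tm" where
  "arr A B = Pi A (shift 1 B)"

definition times :: "tm \<Rightarrow> tm \<Rightarrow> tm" where
  "times A B = Sig A (shift 1 B)"

text \<open>
  For a family \<open>x. P\<close>, a path \<open>p : a = b\<close> and \<open>u : P[a]\<close>, the transport of \<open>u\<close> along \<open>p\<close>; for a
  section \<open>x. s\<close> of \<open>x. P\<close>, the dependent action \<open>transp P a b p s[a] = s[b]\<close> on \<open>p\<close>.
\<close>

definition transp :: "tm \<Rightarrow> tm \<Rightarrow> tm \<Rightarrow> tm \<Rightarrow> tm \<Rightarrow> tm" where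
  "transp P a b p u =
     App (IndId (arr (instw 3 P (Var 2)) (instw 3 P (Var 1))) (Lam P (Var 0)) a b p) u"

definition apd :: "tm \<Rightarrow> tm \<Rightarrow> tm \<Rightarrow> tm \<Rightarrow> tm \<Rightarrow> tm" where
  "apd P s a b p =
     IndId
       (TId (instw 3 P (Var 1))
         (transp (shift_under 3 P) (Var 2) (Var 1) (Var 0) (instw 3 s (Var 2)))
         (instw 3 s (Var 1)))
       (Refl s) a b p"

text \<open>
  The type of the datum over \<open>glue c\<close> in pushout induction, and the left-hand side of the
  corresponding propositional computation rule.
\<close>

definition glue_over :: "tm \<Rightarrow> tm \<Rightarrow> tm \<Rightarrow> tm \<Rightarrow> tm \<Rightarrow> tm \<Rightarrow> tm" where
  "glue_over P l r f g c =
     TId (inst P (PInr (App g c)))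
       (transp P (PInl (App f c)) (PInr (App g c)) (Glue c) (inst l (App f c)))
       (inst r (App g c))"

definition apd_glue :: "tm \<Rightarrow> tm \<Rightarrow> tm \<Rightarrow> tm \<Rightarrow> tm \<Rightarrow> tm \<Rightarrow> tm \<Rightarrow> tm" where
  "apd_glue P l r q f g c =
     apd P
       (IndPush (shift_under 1 P) (shift_under 1 l) (shift_under 1 r) (shift_under 1 q) (Var 0))
       (PInl (App f c)) (PInr (App g c)) (Glue c)"

text \<open>
  An equivalence is a map with a right inverse and a left inverse.  The canonical map from
  \<open>A = B\<close> to equivalences sends reflexivity to the identity equivalence; it is defined by path
  induction.
\<close>

definition homotopy_id :: "tm \<Rightarrow> tm \<Rightarrow> tm \<Rightarrow> tm" where
  "homotopy_id A f g = Pi A (TId (shift 1 A) (App (shift 1 f) (App (shift 1 g) (Var 0))) (Var 0))"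

definition is_equiv :: "tm \<Rightarrow> tm \<Rightarrow> tm \<Rightarrow> tm" where
  "is_equiv A B f =
     times
       (Sig (arr B A) (homotopy_id (shift 1 B) (shift 1 f) (Var 0)))
       (Sig (arr B A) (homotopy_id (shift 1 A) (Var 0) (shift 1 f)))"

definition equivs :: "tm \<Rightarrow> tm \<Rightarrow> tm" where
  "equivs A B = Sig (arr A B) (is_equiv (shift 1 A) (shift 1 B) (Var 0))"

definition id_equiv :: "tm \<Rightarrow> tm" where
  "id_equiv A =
     Pr (Lam A (Var 0))
       (Pr (Pr (Lam A (Var 0)) (Lam A (Refl (Var 0)))) (Pr (Lam A (Var 0)) (Lam A (Refl (Var 0)))))"

definition id_to_equiv :: "nat \<Rightarrow> tm \<Rightarrow> tm \<Rightarrow> tm" where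
  "id_to_equiv i A B =
     Lam (TId (Univ i) A B)
       (IndId (equivs (Var 2) (Var 1)) (id_equiv (Var 0)) (shift 1 A) (shift 1 B) (Var 0))"


section \<open>Judgements\<close>

text \<open>
  A context lists the types of its variables, the most recent one first.  Substitution and
  weakening are admissible and hence not primitive.  As in the HoTT Book, the pushout eliminator
  computes judgementally on points and only propositionally (\<open>GlueComp\<close>) on \<open>Glue\<close>.
\<close>

inductive
  ctx :: "tm list \<Rightarrow> bool" ("\<turnstile> _ ctx" [50] 50) and
  typing :: "tm list \<Rightarrow> tm \<Rightarrow> tm \<Rightarrow> bool" ("_ \<turnstile> _ \<Colon> _" [50, 51, 51] 50) and
  judg_eq :: "tm list \<Rightarrow> tm \<Rightarrow> tm \<Rightarrow> tm \<Rightarrow> bool" ("_ \<turnstile> _ \<doteq> _ \<Colon> _" [50, 51, 51, 51] 50)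
where
  ctx_emp: "\<turnstile> [] ctx"
| ctx_ext: "\<Gamma> \<turnstile> A \<Colon> Univ i \<Longrightarrow> \<turnstile> A # \<Gamma> ctx"

| var: "\<turnstile> \<Gamma> ctx \<Longrightarrow> n < length \<Gamma> \<Longrightarrow> \<Gamma> \<turnstile> Var n \<Colon> shift (Suc n) (\<Gamma> ! n)"
| conv: "\<Gamma> \<turnstile> a \<Colon> A \<Longrightarrow> \<Gamma> \<turnstile> A \<doteq> B \<Colon> Univ i \<Longrightarrow> \<Gamma> \<turnstile> a \<Colon> B"
| eq_refl: "\<Gamma> \<turnstile> a \<Colon> A \<Longrightarrow> \<Gamma> \<turnstile> a \<doteq> a \<Colon> A"
| eq_sym: "\<Gamma> \<turnstile> a \<doteq> b \<Colon> A \<Longrightarrow> \<Gamma> \<turnstile> b \<doteq> a \<Colon> A"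
| eq_trans: "\<Gamma> \<turnstile> a \<doteq> b \<Colon> A \<Longrightarrow> \<Gamma> \<turnstile> b \<doteq> c \<Colon> A \<Longrightarrow> \<Gamma> \<turnstile> a \<doteq> c \<Colon> A"
| eq_conv: "\<Gamma> \<turnstile> a \<doteq> b \<Colon> A \<Longrightarrow> \<Gamma> \<turnstile> A \<doteq> B \<Colon> Univ i \<Longrightarrow> \<Gamma> \<turnstile> a \<doteq> b \<Colon> B"

| univ_intro: "\<turnstile> \<Gamma> ctx \<Longrightarrow> \<Gamma> \<turnstile> Univ i \<Colon> Univ (Suc i)"
| univ_cumul: "\<Gamma> \<turnstile> A \<Colon> Univ i \<Longrightarrow> \<Gamma> \<turnstile> A \<Colon> Univ (Suc i)"
| univ_cumul_eq: "\<Gamma> \<turnstile> A \<doteq> B \<Colon> Univ i \<Longrightarrow> \<Gamma> \<turnstile> A \<doteq> B \<Colon> Univ (Suc i)"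

| pi_form: "\<Gamma> \<turnstile> A \<Colon> Univ i \<Longrightarrow> A # \<Gamma> \<turnstile> B \<Colon> Univ i \<Longrightarrow> \<Gamma> \<turnstile> Pi A B \<Colon> Univ i"
| pi_form_eq: "\<Gamma> \<turnstile> A \<doteq> A' \<Colon> Univ i \<Longrightarrow> A # \<Gamma> \<turnstile> B \<doteq> B' \<Colon> Univ i \<Longrightarrow>
    \<Gamma> \<turnstile> Pi A B \<doteq> Pi A' B' \<Colon> Univ i"
| pi_intro: "A # \<Gamma> \<turnstile> b \<Colon> B \<Longrightarrow> \<Gamma> \<turnstile> Lam A b \<Colon> Pi A B"
| pi_intro_eq: "\<Gamma> \<turnstile> A \<doteq> A' \<Colon> Univ i \<Longrightarrow> A # \<Gamma> \<turnstile> b \<doteq> b' \<Colon> B \<Longrightarrow>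
    \<Gamma> \<turnstile> Lam A b \<doteq> Lam A' b' \<Colon> Pi A B"
| pi_elim: "\<Gamma> \<turnstile> f \<Colon> Pi A B \<Longrightarrow> \<Gamma> \<turnstile> a \<Colon> A \<Longrightarrow> \<Gamma> \<turnstile> App f a \<Colon> inst B a"
| pi_elim_eq: "\<Gamma> \<turnstile> f \<doteq> f' \<Colon> Pi A B \<Longrightarrow> \<Gamma> \<turnstile> a \<doteq> a' \<Colon> A \<Longrightarrow>
    \<Gamma> \<turnstile> App f a \<doteq> App f' a' \<Colon> inst B a"
| pi_comp: "A # \<Gamma> \<turnstile> b \<Colon> B \<Longrightarrow> \<Gamma> \<turnstile> a \<Colon> A \<Longrightarrow> \<Gamma> \<turnstile> App (Lam A b) a \<doteq> inst b a \<Colon> inst B a"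
| pi_uniq: "\<Gamma> \<turnstile> f \<Colon> Pi A B \<Longrightarrow> \<Gamma> \<turnstile> f \<doteq> Lam A (App (shift 1 f) (Var 0)) \<Colon> Pi A B"

| sig_form: "\<Gamma> \<turnstile> A \<Colon> Univ i \<Longrightarrow> A # \<Gamma> \<turnstile> B \<Colon> Univ i \<Longrightarrow> \<Gamma> \<turnstile> Sig A B \<Colon> Univ i"
| sig_form_eq: "\<Gamma> \<turnstile> A \<doteq> A' \<Colon> Univ i \<Longrightarrow> A # \<Gamma> \<turnstile> B \<doteq> B' \<Colon> Univ i \<Longrightarrow>
    \<Gamma> \<turnstile> Sig A B \<doteq> Sig A' B' \<Colon> Univ i"
| sig_intro: "A # \<Gamma> \<turnstile> B \<Colon> Univ i \<Longrightarrow> \<Gamma> \<turnstile> a \<Colon> A \<Longrightarrow> \<Gamma> \<turnstile> b \<Colon> inst B a \<Longrightarrow>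
    \<Gamma> \<turnstile> Pr a b \<Colon> Sig A B"
| sig_intro_eq: "A # \<Gamma> \<turnstile> B \<Colon> Univ i \<Longrightarrow> \<Gamma> \<turnstile> a \<doteq> a' \<Colon> A \<Longrightarrow> \<Gamma> \<turnstile> b \<doteq> b' \<Colon> inst B a \<Longrightarrow>
    \<Gamma> \<turnstile> Pr a b \<doteq> Pr a' b' \<Colon> Sig A B"
| sig_elim: "Sig A B # \<Gamma> \<turnstile> C \<Colon> Univ i \<Longrightarrow> B # A # \<Gamma> \<turnstile> g \<Colon> instw 2 C (Pr (Var 1) (Var 0)) \<Longrightarrow>
    \<Gamma> \<turnstile> p \<Colon> Sig A B \<Longrightarrow> \<Gamma> \<turnstile> IndSig C g p \<Colon> inst C p"
| sig_elim_eq: "Sig A B # \<Gamma> \<turnstile> C \<doteq> C' \<Colon> Univ i \<Longrightarrow>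
    B # A # \<Gamma> \<turnstile> g \<doteq> g' \<Colon> instw 2 C (Pr (Var 1) (Var 0)) \<Longrightarrow>
    \<Gamma> \<turnstile> p \<doteq> p' \<Colon> Sig A B \<Longrightarrow> \<Gamma> \<turnstile> IndSig C g p \<doteq> IndSig C' g' p' \<Colon> inst C p"
| sig_comp: "Sig A B # \<Gamma> \<turnstile> C \<Colon> Univ i \<Longrightarrow> B # A # \<Gamma> \<turnstile> g \<Colon> instw 2 C (Pr (Var 1) (Var 0)) \<Longrightarrow>
    \<Gamma> \<turnstile> a \<Colon> A \<Longrightarrow> \<Gamma> \<turnstile> b \<Colon> inst B a \<Longrightarrow>
    \<Gamma> \<turnstile> IndSig C g (Pr a b) \<doteq> inst2 g a b \<Colon> inst C (Pr a b)"

| plus_form: "\<Gamma> \<turnstile> A \<Colon> Univ i \<Longrightarrow> \<Gamma> \<turnstile> B \<Colon> Univ i \<Longrightarrow> \<Gamma> \<turnstile> Plus A B \<Colon> Univ i"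
| plus_form_eq: "\<Gamma> \<turnstile> A \<doteq> A' \<Colon> Univ i \<Longrightarrow> \<Gamma> \<turnstile> B \<doteq> B' \<Colon> Univ i \<Longrightarrow>
    \<Gamma> \<turnstile> Plus A B \<doteq> Plus A' B' \<Colon> Univ i"
| plus_intro1: "\<Gamma> \<turnstile> A \<Colon> Univ i \<Longrightarrow> \<Gamma> \<turnstile> B \<Colon> Univ i \<Longrightarrow> \<Gamma> \<turnstile> a \<Colon> A \<Longrightarrow> \<Gamma> \<turnstile> InL a \<Colon> Plus A B"
| plus_intro1_eq: "\<Gamma> \<turnstile> A \<Colon> Univ i \<Longrightarrow> \<Gamma> \<turnstile> B \<Colon> Univ i \<Longrightarrow> \<Gamma> \<turnstile> a \<doteq> a' \<Colon> A \<Longrightarrow>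
    \<Gamma> \<turnstile> InL a \<doteq> InL a' \<Colon> Plus A B"
| plus_intro2: "\<Gamma> \<turnstile> A \<Colon> Univ i \<Longrightarrow> \<Gamma> \<turnstile> B \<Colon> Univ i \<Longrightarrow> \<Gamma> \<turnstile> b \<Colon> B \<Longrightarrow> \<Gamma> \<turnstile> InR b \<Colon> Plus A B"
| plus_intro2_eq: "\<Gamma> \<turnstile> A \<Colon> Univ i \<Longrightarrow> \<Gamma> \<turnstile> B \<Colon> Univ i \<Longrightarrow> \<Gamma> \<turnstile> b \<doteq> b' \<Colon> B \<Longrightarrow>
    \<Gamma> \<turnstile> InR b \<doteq> InR b' \<Colon> Plus A B"
| plus_elim: "Plus A B # \<Gamma> \<turnstile> C \<Colon> Univ i \<Longrightarrow>
    A # \<Gamma> \<turnstile> c \<Colon> instw 1 C (InL (Var 0)) \<Longrightarrow> B # \<Gamma> \<turnstile> d \<Colon> instw 1 C (InR (Var 0)) \<Longrightarrow>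
    \<Gamma> \<turnstile> e \<Colon> Plus A B \<Longrightarrow> \<Gamma> \<turnstile> IndPlus C c d e \<Colon> inst C e"
| plus_elim_eq: "Plus A B # \<Gamma> \<turnstile> C \<doteq> C' \<Colon> Univ i \<Longrightarrow>
    A # \<Gamma> \<turnstile> c \<doteq> c' \<Colon> instw 1 C (InL (Var 0)) \<Longrightarrow> B # \<Gamma> \<turnstile> d \<doteq> d' \<Colon> instw 1 C (InR (Var 0)) \<Longrightarrow>
    \<Gamma> \<turnstile> e \<doteq> e' \<Colon> Plus A B \<Longrightarrow> \<Gamma> \<turnstile> IndPlus C c d e \<doteq> IndPlus C' c' d' e' \<Colon> inst C e"
| plus_comp1: "Plus A B # \<Gamma> \<turnstile> C \<Colon> Univ i \<Longrightarrow>
    A # \<Gamma> \<turnstile> c \<Colon> instw 1 C (InL (Var 0)) \<Longrightarrow> B # \<Gamma> \<turnstile> d \<Colon> instw 1 C (InR (Var 0)) \<Longrightarrow>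
    \<Gamma> \<turnstile> a \<Colon> A \<Longrightarrow> \<Gamma> \<turnstile> IndPlus C c d (InL a) \<doteq> inst c a \<Colon> inst C (InL a)"
| plus_comp2: "Plus A B # \<Gamma> \<turnstile> C \<Colon> Univ i \<Longrightarrow>
    A # \<Gamma> \<turnstile> c \<Colon> instw 1 C (InL (Var 0)) \<Longrightarrow> B # \<Gamma> \<turnstile> d \<Colon> instw 1 C (InR (Var 0)) \<Longrightarrow>
    \<Gamma> \<turnstile> b \<Colon> B \<Longrightarrow> \<Gamma> \<turnstile> IndPlus C c d (InR b) \<doteq> inst d b \<Colon> inst C (InR b)"

| empty_form: "\<turnstile> \<Gamma> ctx \<Longrightarrow> \<Gamma> \<turnstile> TEmpty \<Colon> Univ i"
| empty_elim: "TEmpty # \<Gamma> \<turnstile> C \<Colon> Univ i \<Longrightarrow> \<Gamma> \<turnstile> e \<Colon> TEmpty \<Longrightarrow> \<Gamma> \<turnstile> IndEmpty C e \<Colon> inst C e"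
| empty_elim_eq: "TEmpty # \<Gamma> \<turnstile> C \<doteq> C' \<Colon> Univ i \<Longrightarrow> \<Gamma> \<turnstile> e \<doteq> e' \<Colon> TEmpty \<Longrightarrow>
    \<Gamma> \<turnstile> IndEmpty C e \<doteq> IndEmpty C' e' \<Colon> inst C e"

| unit_form: "\<turnstile> \<Gamma> ctx \<Longrightarrow> \<Gamma> \<turnstile> TUnit \<Colon> Univ i"
| unit_intro: "\<turnstile> \<Gamma> ctx \<Longrightarrow> \<Gamma> \<turnstile> Star \<Colon> TUnit"
| unit_elim: "TUnit # \<Gamma> \<turnstile> C \<Colon> Univ i \<Longrightarrow> \<Gamma> \<turnstile> c \<Colon> inst C Star \<Longrightarrow> \<Gamma> \<turnstile> e \<Colon> TUnit \<Longrightarrow>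
    \<Gamma> \<turnstile> IndUnit C c e \<Colon> inst C e"
| unit_elim_eq: "TUnit # \<Gamma> \<turnstile> C \<doteq> C' \<Colon> Univ i \<Longrightarrow> \<Gamma> \<turnstile> c \<doteq> c' \<Colon> inst C Star \<Longrightarrow>
    \<Gamma> \<turnstile> e \<doteq> e' \<Colon> TUnit \<Longrightarrow> \<Gamma> \<turnstile> IndUnit C c e \<doteq> IndUnit C' c' e' \<Colon> inst C e"
| unit_comp: "TUnit # \<Gamma> \<turnstile> C \<Colon> Univ i \<Longrightarrow> \<Gamma> \<turnstile> c \<Colon> inst C Star \<Longrightarrow>
    \<Gamma> \<turnstile> IndUnit C c Star \<doteq> c \<Colon> inst C Star"

| nat_form: "\<turnstile> \<Gamma> ctx \<Longrightarrow> \<Gamma> \<turnstile> TNat \<Colon> Univ i"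
| nat_intro1: "\<turnstile> \<Gamma> ctx \<Longrightarrow> \<Gamma> \<turnstile> TZero \<Colon> TNat"
| nat_intro2: "\<Gamma> \<turnstile> n \<Colon> TNat \<Longrightarrow> \<Gamma> \<turnstile> TSucc n \<Colon> TNat"
| nat_intro2_eq: "\<Gamma> \<turnstile> n \<doteq> n' \<Colon> TNat \<Longrightarrow> \<Gamma> \<turnstile> TSucc n \<doteq> TSucc n' \<Colon> TNat"
| nat_elim: "TNat # \<Gamma> \<turnstile> C \<Colon> Univ i \<Longrightarrow> \<Gamma> \<turnstile> c \<Colon> inst C TZero \<Longrightarrow>
    C # TNat # \<Gamma> \<turnstile> d \<Colon> instw 2 C (TSucc (Var 1)) \<Longrightarrow> \<Gamma> \<turnstile> n \<Colon> TNat \<Longrightarrow>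
    \<Gamma> \<turnstile> IndNat C c d n \<Colon> inst C n"
| nat_elim_eq: "TNat # \<Gamma> \<turnstile> C \<doteq> C' \<Colon> Univ i \<Longrightarrow> \<Gamma> \<turnstile> c \<doteq> c' \<Colon> inst C TZero \<Longrightarrow>
    C # TNat # \<Gamma> \<turnstile> d \<doteq> d' \<Colon> instw 2 C (TSucc (Var 1)) \<Longrightarrow> \<Gamma> \<turnstile> n \<doteq> n' \<Colon> TNat \<Longrightarrow>
    \<Gamma> \<turnstile> IndNat C c d n \<doteq> IndNat C' c' d' n' \<Colon> inst C n"
| nat_comp1: "TNat # \<Gamma> \<turnstile> C \<Colon> Univ i \<Longrightarrow> \<Gamma> \<turnstile> c \<Colon> inst C TZero \<Longrightarrow>
    C # TNat # \<Gamma> \<turnstile> d \<Colon> instw 2 C (TSucc (Var 1)) \<Longrightarrow>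
    \<Gamma> \<turnstile> IndNat C c d TZero \<doteq> c \<Colon> inst C TZero"
| nat_comp2: "TNat # \<Gamma> \<turnstile> C \<Colon> Univ i \<Longrightarrow> \<Gamma> \<turnstile> c \<Colon> inst C TZero \<Longrightarrow>
    C # TNat # \<Gamma> \<turnstile> d \<Colon> instw 2 C (TSucc (Var 1)) \<Longrightarrow> \<Gamma> \<turnstile> n \<Colon> TNat \<Longrightarrow>
    \<Gamma> \<turnstile> IndNat C c d (TSucc n) \<doteq> inst2 d n (IndNat C c d n) \<Colon> inst C (TSucc n)"

| id_form: "\<Gamma> \<turnstile> A \<Colon> Univ i \<Longrightarrow> \<Gamma> \<turnstile> a \<Colon> A \<Longrightarrow> \<Gamma> \<turnstile> b \<Colon> A \<Longrightarrow> \<Gamma> \<turnstile> TId A a b \<Colon> Univ i"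
| id_form_eq: "\<Gamma> \<turnstile> A \<doteq> A' \<Colon> Univ i \<Longrightarrow> \<Gamma> \<turnstile> a \<doteq> a' \<Colon> A \<Longrightarrow> \<Gamma> \<turnstile> b \<doteq> b' \<Colon> A \<Longrightarrow>
    \<Gamma> \<turnstile> TId A a b \<doteq> TId A' a' b' \<Colon> Univ i"
| id_intro: "\<Gamma> \<turnstile> A \<Colon> Univ i \<Longrightarrow> \<Gamma> \<turnstile> a \<Colon> A \<Longrightarrow> \<Gamma> \<turnstile> Refl a \<Colon> TId A a a"
| id_intro_eq: "\<Gamma> \<turnstile> A \<Colon> Univ i \<Longrightarrow> \<Gamma> \<turnstile> a \<doteq> a' \<Colon> A \<Longrightarrow> \<Gamma> \<turnstile> Refl a \<doteq> Refl a' \<Colon> TId A a a"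
| id_elim: "TId (shift 2 A) (Var 1) (Var 0) # shift 1 A # A # \<Gamma> \<turnstile> C \<Colon> Univ i \<Longrightarrow>
    A # \<Gamma> \<turnstile> c \<Colon> instw3 1 C (Var 0) (Var 0) (Refl (Var 0)) \<Longrightarrow>
    \<Gamma> \<turnstile> a \<Colon> A \<Longrightarrow> \<Gamma> \<turnstile> b \<Colon> A \<Longrightarrow> \<Gamma> \<turnstile> p \<Colon> TId A a b \<Longrightarrow>
    \<Gamma> \<turnstile> IndId C c a b p \<Colon> inst3 C a b p"
| id_elim_eq: "TId (shift 2 A) (Var 1) (Var 0) # shift 1 A # A # \<Gamma> \<turnstile> C \<doteq> C' \<Colon> Univ i \<Longrightarrow>
    A # \<Gamma> \<turnstile> c \<doteq> c' \<Colon> instw3 1 C (Var 0) (Var 0) (Refl (Var 0)) \<Longrightarrow>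
    \<Gamma> \<turnstile> a \<doteq> a' \<Colon> A \<Longrightarrow> \<Gamma> \<turnstile> b \<doteq> b' \<Colon> A \<Longrightarrow> \<Gamma> \<turnstile> p \<doteq> p' \<Colon> TId A a b \<Longrightarrow>
    \<Gamma> \<turnstile> IndId C c a b p \<doteq> IndId C' c' a' b' p' \<Colon> inst3 C a b p"
| id_comp: "TId (shift 2 A) (Var 1) (Var 0) # shift 1 A # A # \<Gamma> \<turnstile> C \<Colon> Univ i \<Longrightarrow>
    A # \<Gamma> \<turnstile> c \<Colon> instw3 1 C (Var 0) (Var 0) (Refl (Var 0)) \<Longrightarrow> \<Gamma> \<turnstile> a \<Colon> A \<Longrightarrow>
    \<Gamma> \<turnstile> IndId C c a a (Refl a) \<doteq> inst c a \<Colon> inst3 C a a (Refl a)"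

| push_form: "\<Gamma> \<turnstile> C \<Colon> Univ i \<Longrightarrow> \<Gamma> \<turnstile> A \<Colon> Univ i \<Longrightarrow> \<Gamma> \<turnstile> B \<Colon> Univ i \<Longrightarrow>
    \<Gamma> \<turnstile> f \<Colon> arr C A \<Longrightarrow> \<Gamma> \<turnstile> g \<Colon> arr C B \<Longrightarrow> \<Gamma> \<turnstile> Push C A B f g \<Colon> Univ i"
| push_form_eq: "\<Gamma> \<turnstile> C \<doteq> C' \<Colon> Univ i \<Longrightarrow> \<Gamma> \<turnstile> A \<doteq> A' \<Colon> Univ i \<Longrightarrow> \<Gamma> \<turnstile> B \<doteq> B' \<Colon> Univ i \<Longrightarrow>
    \<Gamma> \<turnstile> f \<doteq> f' \<Colon> arr C A \<Longrightarrow> \<Gamma> \<turnstile> g \<doteq> g' \<Colon> arr C B \<Longrightarrow>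
    \<Gamma> \<turnstile> Push C A B f g \<doteq> Push C' A' B' f' g' \<Colon> Univ i"
| push_intro1: "\<Gamma> \<turnstile> Push C A B f g \<Colon> Univ i \<Longrightarrow> \<Gamma> \<turnstile> a \<Colon> A \<Longrightarrow> \<Gamma> \<turnstile> PInl a \<Colon> Push C A B f g"
| push_intro1_eq: "\<Gamma> \<turnstile> Push C A B f g \<Colon> Univ i \<Longrightarrow> \<Gamma> \<turnstile> a \<doteq> a' \<Colon> A \<Longrightarrow>
    \<Gamma> \<turnstile> PInl a \<doteq> PInl a' \<Colon> Push C A B f g"
| push_intro2: "\<Gamma> \<turnstile> Push C A B f g \<Colon> Univ i \<Longrightarrow> \<Gamma> \<turnstile> b \<Colon> B \<Longrightarrow> \<Gamma> \<turnstile> PInr b \<Colon> Push C A B f g"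
| push_intro2_eq: "\<Gamma> \<turnstile> Push C A B f g \<Colon> Univ i \<Longrightarrow> \<Gamma> \<turnstile> b \<doteq> b' \<Colon> B \<Longrightarrow>
    \<Gamma> \<turnstile> PInr b \<doteq> PInr b' \<Colon> Push C A B f g"
| push_glue: "\<Gamma> \<turnstile> Push C A B f g \<Colon> Univ i \<Longrightarrow> \<Gamma> \<turnstile> c \<Colon> C \<Longrightarrow>
    \<Gamma> \<turnstile> Glue c \<Colon> TId (Push C A B f g) (PInl (App f c)) (PInr (App g c))"
| push_glue_eq: "\<Gamma> \<turnstile> Push C A B f g \<Colon> Univ i \<Longrightarrow> \<Gamma> \<turnstile> c \<doteq> c' \<Colon> C \<Longrightarrow>
    \<Gamma> \<turnstile> Glue c \<doteq> Glue c' \<Colon> TId (Push C A B f g) (PInl (App f c)) (PInr (App g c))"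
| push_elim: "Push C A B f g # \<Gamma> \<turnstile> P \<Colon> Univ i \<Longrightarrow>
    A # \<Gamma> \<turnstile> l \<Colon> instw 1 P (PInl (Var 0)) \<Longrightarrow> B # \<Gamma> \<turnstile> r \<Colon> instw 1 P (PInr (Var 0)) \<Longrightarrow>
    C # \<Gamma> \<turnstile> q \<Colon> glue_over (shift_under 1 P) (shift_under 1 l) (shift_under 1 r)
                 (shift 1 f) (shift 1 g) (Var 0) \<Longrightarrow>
    \<Gamma> \<turnstile> e \<Colon> Push C A B f g \<Longrightarrow> \<Gamma> \<turnstile> IndPush P l r q e \<Colon> inst P e"
| push_elim_eq: "Push C A B f g # \<Gamma> \<turnstile> P \<doteq> P' \<Colon> Univ i \<Longrightarrow>
    A # \<Gamma> \<turnstile> l \<doteq> l' \<Colon> instw 1 P (PInl (Var 0)) \<Longrightarrow> B # \<Gamma> \<turnstile> r \<doteq> r' \<Colon> instw 1 P (PInr (Var 0)) \<Longrightarrow>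
    C # \<Gamma> \<turnstile> q \<doteq> q' \<Colon> glue_over (shift_under 1 P) (shift_under 1 l) (shift_under 1 r)
                      (shift 1 f) (shift 1 g) (Var 0) \<Longrightarrow>
    \<Gamma> \<turnstile> e \<doteq> e' \<Colon> Push C A B f g \<Longrightarrow> \<Gamma> \<turnstile> IndPush P l r q e \<doteq> IndPush P' l' r' q' e' \<Colon> inst P e"
| push_comp1: "Push C A B f g # \<Gamma> \<turnstile> P \<Colon> Univ i \<Longrightarrow>
    A # \<Gamma> \<turnstile> l \<Colon> instw 1 P (PInl (Var 0)) \<Longrightarrow> B # \<Gamma> \<turnstile> r \<Colon> instw 1 P (PInr (Var 0)) \<Longrightarrow>
    C # \<Gamma> \<turnstile> q \<Colon> glue_over (shift_under 1 P) (shift_under 1 l) (shift_under 1 r)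
                 (shift 1 f) (shift 1 g) (Var 0) \<Longrightarrow>
    \<Gamma> \<turnstile> a \<Colon> A \<Longrightarrow> \<Gamma> \<turnstile> IndPush P l r q (PInl a) \<doteq> inst l a \<Colon> inst P (PInl a)"
| push_comp2: "Push C A B f g # \<Gamma> \<turnstile> P \<Colon> Univ i \<Longrightarrow>
    A # \<Gamma> \<turnstile> l \<Colon> instw 1 P (PInl (Var 0)) \<Longrightarrow> B # \<Gamma> \<turnstile> r \<Colon> instw 1 P (PInr (Var 0)) \<Longrightarrow>
    C # \<Gamma> \<turnstile> q \<Colon> glue_over (shift_under 1 P) (shift_under 1 l) (shift_under 1 r)
                 (shift 1 f) (shift 1 g) (Var 0) \<Longrightarrow>
    \<Gamma> \<turnstile> b \<Colon> B \<Longrightarrow> \<Gamma> \<turnstile> IndPush P l r q (PInr b) \<doteq> inst r b \<Colon> inst P (PInr b)"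
| push_comp_glue: "Push C A B f g # \<Gamma> \<turnstile> P \<Colon> Univ i \<Longrightarrow>
    A # \<Gamma> \<turnstile> l \<Colon> instw 1 P (PInl (Var 0)) \<Longrightarrow> B # \<Gamma> \<turnstile> r \<Colon> instw 1 P (PInr (Var 0)) \<Longrightarrow>
    C # \<Gamma> \<turnstile> q \<Colon> glue_over (shift_under 1 P) (shift_under 1 l) (shift_under 1 r)
                 (shift 1 f) (shift 1 g) (Var 0) \<Longrightarrow>
    \<Gamma> \<turnstile> c \<Colon> C \<Longrightarrow>
    \<Gamma> \<turnstile> GlueComp P l r q c \<Colon> TId (glue_over P l r f g c) (apd_glue P l r q f g c) (inst q c)"
| push_comp_glue_eq: "Push C A B f g # \<Gamma> \<turnstile> P \<doteq> P' \<Colon> Univ i \<Longrightarrow>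
    A # \<Gamma> \<turnstile> l \<doteq> l' \<Colon> instw 1 P (PInl (Var 0)) \<Longrightarrow> B # \<Gamma> \<turnstile> r \<doteq> r' \<Colon> instw 1 P (PInr (Var 0)) \<Longrightarrow>
    C # \<Gamma> \<turnstile> q \<doteq> q' \<Colon> glue_over (shift_under 1 P) (shift_under 1 l) (shift_under 1 r)
                      (shift 1 f) (shift 1 g) (Var 0) \<Longrightarrow>
    \<Gamma> \<turnstile> c \<doteq> c' \<Colon> C \<Longrightarrow>
    \<Gamma> \<turnstile> GlueComp P l r q c \<doteq> GlueComp P' l' r' q' c'
        \<Colon> TId (glue_over P l r f g c) (apd_glue P l r q f g c) (inst q c)"

| univalence: "\<Gamma> \<turnstile> A \<Colon> Univ i \<Longrightarrow> \<Gamma> \<turnstile> B \<Colon> Univ i \<Longrightarrow>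
    \<Gamma> \<turnstile> UA i A B \<Colon> is_equiv (TId (Univ i) A B) (equivs A B) (id_to_equiv i A B)"
| univalence_eq: "\<Gamma> \<turnstile> A \<doteq> A' \<Colon> Univ i \<Longrightarrow> \<Gamma> \<turnstile> B \<doteq> B' \<Colon> Univ i \<Longrightarrow>
    \<Gamma> \<turnstile> UA i A B \<doteq> UA i A' B' \<Colon> is_equiv (TId (Univ i) A B) (equivs A B) (id_to_equiv i A B)"


section \<open>Acyclic types\<close>

definition is_contr :: "tm \<Rightarrow> tm" where
  "is_contr A = Sig A (Pi (shift 1 A) (TId (shift 2 A) (Var 1) (Var 0)))"

definition susp :: "tm \<Rightarrow> tm" where
  "susp A = Push A TUnit TUnit (Lam A Star) (Lam A Star)"

definition is_acyclic :: "tm \<Rightarrow> tm" where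
  "is_acyclic A = is_contr (susp A)"

end

theory Submission
  imports Defs
begin

text \<open>
  If \<open>A\<close> is acyclic, every family of paths \<open>q a : x = y\<close> in a type \<open>X\<close>, indexed by \<open>a : A\<close>, is
      constant:
  it is the action on the paths \<open>glue a\<close> of a map from the suspension of \<open>A\<close> to \<open>X\<close>, and in a
  contractible type all parallel paths agree.  So there is \<open>p : x = y\<close> with \<open>p = q a\<close> for all \<open>a\<close>.
  Conversely, \<open>A\<close> is acyclic as soon as there is a path \<open>p\<close> between the poles of its suspension
  with \<open>p = glue a\<close> for all \<open>a\<close>.  For the dependent sum, the first fact applied to \<open>B a\<close>
      and the paths
  \<open>glue (a, b)\<close> gives \<open>p a = glue (a, b)\<close>, and applied to \<open>A\<close>
      and \<open>p\<close> it gives one path for all pairs.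
  Neither univalence nor function extensionality is needed.

  Most steps only assert that a type is inhabited; explicit terms are named only where later types
  mention them.
\<close>

section \<open>Substitution calculus\<close>

text \<open>Constancy is never stated as an equality of functions: that \<open>p\<close> equals
  \<open>q\<close> at every point of \<open>A\<close> is an inhabited type over
  \<open>A # \<Gamma>\<close> in which \<open>p\<close> occurs as \<open>shift 1 p\<close>. The path
  must therefore be definable over \<Gamma> alone. The recursor's action on \<open>Glue a\<close> is
  not, but its action on the canonical path through the center of contraction is, and in a
  contractible type the two are identified. Two features of the pushout rules shape the work. The
  computation rule on \<open>Glue\<close> is propositional and speaks of \<open>apd\<close>, whose
  type contains a transport in a constant family; \<open>theta\<close> and
  \<open>ap_criterion\<close> turn it into a statement about \<open>ap\<close>. The ends of
  \<open>Glue a\<close> are images of \<open>App (Lam A Star) a\<close>, equal to the poles at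
  \<open>Star\<close> only judgementally, so several constructions need congruence in their
  endpoints before the dependence on \<open>a\<close> disappears. Path inductions are set up so that
  both sides of the base case agree judgementally and reflexivity or an identity function, converted
  to the right type, closes it.\<close>

definition wk :: "nat \<Rightarrow> nat \<Rightarrow> tm" where
  "wk k = (\<lambda>n. Var (n + k))"

definition sub_compose :: "(nat \<Rightarrow> tm) \<Rightarrow> (nat \<Rightarrow> tm) \<Rightarrow> nat \<Rightarrow> tm" (infixr "\<odot>" 65) where
  "\<sigma> \<odot> \<tau> = (\<lambda>n. sub \<tau> (\<sigma> n))"

lemma up_Var_ren: "up (\<lambda>n. Var (\<rho> n)) = (\<lambda>n. Var (upr \<rho> n))"
  by (rule ext, rename_tac n, case_tac n) (simp_all add: shift_def)

lemma ren_sub: "ren \<rho> t = sub (\<lambda>n. Var (\<rho> n)) t"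
  by (induction t arbitrary: \<rho>) (simp_all add: up_Var_ren)

lemma up_upr: "(\<lambda>n. up \<sigma> (upr \<rho> n)) = up (\<lambda>n. \<sigma> (\<rho> n))"
  by (rule ext, rename_tac n, case_tac n) simp_all

lemma sub_ren: "sub \<sigma> (ren \<rho> t) = sub (\<lambda>n. \<sigma> (\<rho> n)) t"
  by (induction t arbitrary: \<sigma> \<rho>) (simp_all add: up_upr)

lemma ren_ren: "ren \<rho> (ren \<rho>' t) = ren (\<lambda>n. \<rho> (\<rho>' n)) t"
  unfolding ren_sub[of \<rho>] sub_ren by (simp add: ren_sub)

lemma ren_up: "(\<lambda>n. ren (upr \<rho>) (up \<sigma> n)) = up (\<lambda>n. ren \<rho> (\<sigma> n))"
  by (rule ext, rename_tac n, case_tac n) (simp_all add: shift_def ren_ren)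

lemma ren_of_sub: "ren \<rho> (sub \<sigma> t) = sub (\<lambda>n. ren \<rho> (\<sigma> n)) t"
  by (induction t arbitrary: \<sigma> \<rho>) (simp_all add: ren_up)

lemma sub_up: "(\<lambda>n. sub (up \<tau>) (up \<sigma> n)) = up (\<lambda>n. sub \<tau> (\<sigma> n))"
  by (rule ext, rename_tac n, case_tac n) (simp_all add: shift_def sub_ren ren_of_sub)

text \<open>Under a binder this needs \<open>sub_up\<close>, which moves a shift through a
  substitution. Shifts are renamings, so both mixed laws, \<open>sub_ren\<close> and
  \<open>ren_of_sub\<close>, come first.\<close>

lemma sub_sub: "sub \<tau> (sub \<sigma> t) = sub (\<sigma> \<odot> \<tau>) t"
  unfolding sub_compose_def by (induction t arbitrary: \<sigma> \<tau>) (simp_all add: sub_up)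

lemma up_Var: "up Var = Var"
  by (rule ext, rename_tac n, case_tac n) (simp_all add: shift_def)

lemma sub_Var: "sub Var t = t"
  by (induction t) (simp_all add: up_Var)

lemma wk_0: "wk 0 = Var"
  by (simp add: wk_def)

lemma up_scons: "up \<sigma> = Var 0 \<cdot> (\<sigma> \<odot> wk (Suc 0))"
  by (rule ext, rename_tac n, case_tac n) (simp_all add: shift_def sub_compose_def wk_def ren_sub)

lemma shift_wk: "shift k t = sub (wk k) t"
  by (simp add: shift_def ren_sub wk_def)

lemma shift_under_wk: "shift_under k t = sub (Var 0 \<cdot> wk (Suc k)) t"
proof -
  have "(\<lambda>n. Var (upr (\<lambda>n. n + k) n)) = Var 0 \<cdot> wk (Suc k)"
    by (rule ext, rename_tac n, case_tac n) (simp_all add: wk_def)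
  then show ?thesis by (simp add: shift_under_def ren_sub)
qed

lemma instw_wk: "instw k t a = sub (a \<cdot> wk k) t"
  by (simp add: instw_def wk_def)

lemma instw2_wk: "instw2 k t a b = sub (b \<cdot> a \<cdot> wk k) t"
  by (simp add: instw2_def wk_def)

lemma instw3_wk: "instw3 k t a b c = sub (c \<cdot> b \<cdot> a \<cdot> wk k) t"
  by (simp add: instw3_def wk_def)

lemma comp_scons: "(a \<cdot> \<sigma>) \<odot> \<tau> = sub \<tau> a \<cdot> (\<sigma> \<odot> \<tau>)"
  by (rule ext, rename_tac n, case_tac n) (simp_all add: sub_compose_def)

lemma comp_assoc: "(\<sigma> \<odot> \<tau>) \<odot> \<rho> = \<sigma> \<odot> (\<tau> \<odot> \<rho>)"
  by (rule ext) (simp add: sub_compose_def sub_sub)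

lemma wk_scons: "wk (Suc k) \<odot> (a \<cdot> \<sigma>) = wk k \<odot> \<sigma>"
  by (rule ext) (simp add: sub_compose_def wk_def)

lemma wk_wk: "wk k \<odot> wk m = wk (k + m)"
  by (rule ext) (simp add: sub_compose_def wk_def add.assoc)

lemma wk_wk_comp: "wk k \<odot> (wk m \<odot> \<sigma>) = wk (k + m) \<odot> \<sigma>"
  by (metis comp_assoc wk_wk)

lemma Var_comp: "Var \<odot> \<sigma> = \<sigma>"
  by (rule ext) (simp add: sub_compose_def)

lemma comp_Var: "\<sigma> \<odot> Var = \<sigma>"
  by (rule ext) (simp add: sub_compose_def sub_Var)

lemma comp_app: "(\<sigma> \<odot> \<tau>) n = sub \<tau> (\<sigma> n)"
  by (simp add: sub_compose_def)

lemma wk_app: "wk k n = Var (n + k)"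
  by (simp add: wk_def)

lemma scons_eta: "Var k \<cdot> wk (Suc k) = wk k"
  by (rule ext, rename_tac n, case_tac n) (simp_all add: wk_def)

lemma scons_eta0: "Var 0 \<cdot> wk (Suc 0) = Var"
  using scons_eta[of 0] by (simp add: wk_0)

lemmas sigma_basic = sub_sub sub_Var comp_scons comp_assoc wk_scons wk_wk wk_wk_comp Var_comp
    comp_Var
  comp_app wk_app scons_eta scons_eta0 wk_0

text \<open>The rewrite system of the sigma-calculus: shifts, instantiations and lifted
  substitutions all become \<open>sub\<close> with terms consed onto some \<open>wk k\<close>,
  composites associate to the right, and equal de Bruijn expressions meet in one normal form. The
  numerals are unfolded so that \<open>wk_scons\<close> can cancel \<open>Suc\<close> against a
  consed term.\<close>

lemmas sigma = sigma_basic up_scons shift_wk shift_under_wk instw_wk instw2_wk instw3_wk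
  numeral_2_eq_2 numeral_3_eq_3

section \<open>Substitution commutes with the notions in the typing rules\<close>

lemma up_one: "up \<sigma> 1 = shift 1 (\<sigma> 0)"
  by simp

lemma shift_Var: "shift k (Var n) = Var (n + k)"
  by (simp add: shift_def)

lemma sub_shift1: "sub (up \<sigma>) (shift 1 t) = shift 1 (sub \<sigma> t)"
  by (simp add: sigma)

lemma sub_shift2: "sub (up (up \<sigma>)) (shift 2 t) = shift 2 (sub \<sigma> t)"
  by (simp add: sigma)

lemma sub_shift_under: "sub (up (up \<sigma>)) (shift_under 1 t) = shift_under 1 (sub (up \<sigma>) t)"
  by (simp add: sigma)

lemma sub_inst: "sub \<sigma> (inst t a) = inst (sub (up \<sigma>) t) (sub \<sigma> a)"
  by (simp add: sigma)

lemma sub_instw1: "sub (up \<sigma>) (instw 1 t a) = instw 1 (sub (up \<sigma>) t) (sub (up \<sigma>) a)"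
  by (simp add: sigma)

lemma sub_instw2: "sub (up (up \<sigma>)) (instw 2 t a) = instw 2 (sub (up \<sigma>) t) (sub (up (up \<sigma>)) a)"
  by (simp add: sigma)

lemma sub_inst2: "sub \<sigma> (inst2 t a b) = inst2 (sub (up (up \<sigma>)) t) (sub \<sigma> a) (sub \<sigma> b)"
  by (simp add: sigma)

lemma sub_inst3: "sub \<sigma> (inst3 t a b c) = inst3 (sub (up (up (up \<sigma>))) t) (sub \<sigma> a) (sub \<sigma> b) (sub
    \<sigma> c)"
  by (simp add: sigma)

lemma sub_instw3_1: "sub (up \<sigma>) (instw3 1 t a b c) =
   instw3 1 (sub (up (up (up \<sigma>))) t) (sub (up \<sigma>) a) (sub (up \<sigma>) b) (sub (up \<sigma>) c)"
  by (simp add: sigma)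

lemma sub_arr: "sub \<sigma> (arr A B) = arr (sub \<sigma> A) (sub \<sigma> B)"
  by (simp add: arr_def sigma)

lemma sub_times: "sub \<sigma> (times A B) = times (sub \<sigma> A) (sub \<sigma> B)"
  by (simp add: times_def sigma)

lemma sub_transp: "sub \<sigma> (transp P a b p u) =
   transp (sub (up \<sigma>) P) (sub \<sigma> a) (sub \<sigma> b) (sub \<sigma> p) (sub \<sigma> u)"
  by (simp add: transp_def arr_def sigma)

lemma sub_apd: "sub \<sigma> (apd P s a b p) =
   apd (sub (up \<sigma>) P) (sub (up \<sigma>) s) (sub \<sigma> a) (sub \<sigma> b) (sub \<sigma> p)"
  by (simp add: apd_def sub_transp sigma)

lemma sub_glue_over: "sub \<sigma> (glue_over P l r f g c) =
   glue_over (sub (up \<sigma>) P) (sub (up \<sigma>) l) (sub (up \<sigma>) r) (sub \<sigma> f) (sub \<sigma> g) (sub \<sigma> c)"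
  by (simp add: glue_over_def sub_transp sigma)

lemma sub_apd_glue: "sub \<sigma> (apd_glue P l r q f g c) =
   apd_glue (sub (up \<sigma>) P) (sub (up \<sigma>) l) (sub (up \<sigma>) r) (sub (up \<sigma>) q) (sub \<sigma> f) (sub \<sigma> g) (sub \<sigma>
       c)"
  by (simp add: apd_glue_def sub_apd sigma)

lemma sub_homotopy_id: "sub \<sigma> (homotopy_id A f g) = homotopy_id (sub \<sigma> A) (sub \<sigma> f) (sub \<sigma> g)"
  by (simp add: homotopy_id_def sigma)

lemma sub_is_equiv: "sub \<sigma> (is_equiv A B f) = is_equiv (sub \<sigma> A) (sub \<sigma> B) (sub \<sigma> f)"
  by (simp add: is_equiv_def sub_times sub_arr sub_homotopy_id sigma)

lemma sub_equivs: "sub \<sigma> (equivs A B) = equivs (sub \<sigma> A) (sub \<sigma> B)"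
  by (simp add: equivs_def sub_is_equiv sub_arr sigma)

lemma sub_id_equiv: "sub \<sigma> (id_equiv A) = id_equiv (sub \<sigma> A)"
  by (simp add: id_equiv_def sigma)

lemma sub_id_to_equiv: "sub \<sigma> (id_to_equiv i A B) = id_to_equiv i (sub \<sigma> A) (sub \<sigma> B)"
  by (simp add: id_to_equiv_def sub_equivs sub_id_equiv sigma)

text \<open>These push a substitution into the notions used by the rules while keeping those notions
  folded, so that the substituted premises again have the literal shape of a rule.
  \<open>up_one\<close> serves the index 1, which does not match \<open>Suc\<close> when
  \<open>One_nat_def\<close> is switched off.\<close>

lemmas sub_commute = sub_shift1 sub_shift2 sub_shift_under sub_inst sub_instw1 sub_instw2
    sub_inst2 sub_inst3
  sub_instw3_1 sub_arr sub_times sub_transp sub_apd sub_glue_over sub_apd_glue sub_is_equiv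
      sub_equivs
  sub_id_to_equiv up_one shift_Var

section \<open>Admissibility of substitution\<close>

text \<open>
  The rules with a binder, such as \<open>pi_intro\<close>, have no premise saying that the type of the bound
  variable is a type.  The induction therefore carries along that every type in the context stays a
  type under the substitutions considered.
\<close>

primrec ctx_stable :: "((nat \<Rightarrow> tm) \<Rightarrow> tm list \<Rightarrow> tm list \<Rightarrow> bool) \<Rightarrow> tm list \<Rightarrow> bool" where
  "ctx_stable W [] = True"
| "ctx_stable W (A # \<Gamma>) = (ctx_stable W \<Gamma> \<and> (\<exists>i. \<forall>\<sigma> \<Delta>. W \<sigma> \<Gamma> \<Delta> \<longrightarrow> \<Delta> \<turnstile> sub \<sigma> A \<Colon> Univ i))"

text \<open>
  Renamings must be treated first, because lifting a substitution under a binder weakens its values.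
  Abstracting over the class \<open>W\<close> of substitutions makes one induction serve both.
\<close>

locale substitution_class =
  fixes W :: "(nat \<Rightarrow> tm) \<Rightarrow> tm list \<Rightarrow> tm list \<Rightarrow> bool"
  assumes W_ctx: "\<And>\<sigma> \<Gamma> \<Delta>. W \<sigma> \<Gamma> \<Delta> \<Longrightarrow> \<turnstile> \<Delta> ctx"
    and W_var: "\<And>\<sigma> \<Gamma> \<Delta> n. W \<sigma> \<Gamma> \<Delta> \<Longrightarrow> n < length \<Gamma> \<Longrightarrow> \<Delta> \<turnstile> \<sigma> n \<Colon> sub \<sigma> (shift (Suc n) (\<Gamma> ! n))"
    and W_up: "\<And>\<sigma> \<Gamma> \<Delta> A i. W \<sigma> \<Gamma> \<Delta> \<Longrightarrow> \<Delta> \<turnstile> sub \<sigma> A \<Colon> Univ i \<Longrightarrow> W (up \<sigma>) (A # \<Gamma>) (sub \<sigma> A # \<Delta>)"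
begin

text \<open>Adapts the induction hypothesis of a premise with one more variable: stability of the
  context provides the universe that \<open>W_up\<close> asks for, so the hypothesis can be used at
  the lifted substitution.\<close>

lemma W_lift:
  assumes "ctx_stable W (A # \<Gamma>) \<and> (\<forall>\<sigma> \<Delta>. W \<sigma> (A # \<Gamma>) \<Delta> \<longrightarrow> Q \<sigma> \<Delta>)"
  shows "ctx_stable W \<Gamma> \<and> (\<forall>\<sigma> \<Delta>. W \<sigma> \<Gamma> \<Delta> \<longrightarrow> Q (up \<sigma>) (sub \<sigma> A # \<Delta>))"
  using assms W_up by fastforce

text \<open>Apart from the context rules and \<open>var\<close>, every case has the same proof: lift
  the hypotheses of premises under binders, as often as there are bound variables, move the
  substitution inwards, and apply the same rule again. Premises about well-formed contexts are met
  by \<open>W_ctx\<close>.\<close>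

lemma sub_admissible_aux:
  shows "\<turnstile> \<Gamma> ctx \<Longrightarrow> ctx_stable W \<Gamma>"
    and "\<Gamma> \<turnstile> t \<Colon> T \<Longrightarrow> ctx_stable W \<Gamma> \<and> (\<forall>\<sigma> \<Delta>. W \<sigma> \<Gamma> \<Delta> \<longrightarrow> \<Delta> \<turnstile> sub \<sigma> t \<Colon> sub \<sigma> T)"
    and "\<Gamma> \<turnstile> t \<doteq> u \<Colon> T \<Longrightarrow> ctx_stable W \<Gamma> \<and> (\<forall>\<sigma> \<Delta>. W \<sigma> \<Gamma> \<Delta> \<longrightarrow> \<Delta> \<turnstile> sub \<sigma> t \<doteq> sub \<sigma> u \<Colon> sub \<sigma> T)"
proof (induction rule: ctx_typing_judg_eq.inducts)
  case ctx_emp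
  then show ?case by simp
next
  case ctx_ext
  then show ?case by auto
next
  case var
  then show ?case by (simp add: W_var)
next
  case conv
  then show ?case
    by - (((drule W_lift)+)?, simp add: sub_commute del: One_nat_def,
      blast intro: ctx_typing_judg_eq.conv W_ctx)
next
  case eq_refl
  then show ?case
    by - (((drule W_lift)+)?, simp add: sub_commute del: One_nat_def,
      blast intro: ctx_typing_judg_eq.eq_refl W_ctx)
next
  case eq_sym
  then show ?case
    by - (((drule W_lift)+)?, simp add: sub_commute del: One_nat_def,
      blast intro: ctx_typing_judg_eq.eq_sym W_ctx)
next
  case eq_trans
  then show ?case
    by - (((drule W_lift)+)?, simp add: sub_commute del: One_nat_def,
      blast intro: ctx_typing_judg_eq.eq_trans W_ctx)
next
  case eq_conv
  then show ?case
    by - (((drule W_lift)+)?, simp add: sub_commute del: One_nat_def,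
      blast intro: ctx_typing_judg_eq.eq_conv W_ctx)
next
  case univ_intro
  then show ?case
    by - (((drule W_lift)+)?, simp add: sub_commute del: One_nat_def,
      blast intro: ctx_typing_judg_eq.univ_intro W_ctx)
next
  case univ_cumul
  then show ?case
    by - (((drule W_lift)+)?, simp add: sub_commute del: One_nat_def,
      blast intro: ctx_typing_judg_eq.univ_cumul W_ctx)
next
  case univ_cumul_eq
  then show ?case
    by - (((drule W_lift)+)?, simp add: sub_commute del: One_nat_def,
      blast intro: ctx_typing_judg_eq.univ_cumul_eq W_ctx)
next
  case pi_form
  then show ?case
    by - (((drule W_lift)+)?, simp add: sub_commute del: One_nat_def,
      blast intro: ctx_typing_judg_eq.pi_form W_ctx)
next
  case pi_form_eq
  then show ?case
    by - (((drule W_lift)+)?, simp add: sub_commute del: One_nat_def,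
      blast intro: ctx_typing_judg_eq.pi_form_eq W_ctx)
next
  case pi_intro
  then show ?case
    by - (((drule W_lift)+)?, simp add: sub_commute del: One_nat_def,
      blast intro: ctx_typing_judg_eq.pi_intro W_ctx)
next
  case pi_intro_eq
  then show ?case
    by - (((drule W_lift)+)?, simp add: sub_commute del: One_nat_def,
      blast intro: ctx_typing_judg_eq.pi_intro_eq W_ctx)
next
  case pi_elim
  then show ?case
    by - (((drule W_lift)+)?, simp add: sub_commute del: One_nat_def,
      blast intro: ctx_typing_judg_eq.pi_elim W_ctx)
next
  case pi_elim_eq
  then show ?case
    by - (((drule W_lift)+)?, simp add: sub_commute del: One_nat_def,
      blast intro: ctx_typing_judg_eq.pi_elim_eq W_ctx)
next
  case pi_comp
  then show ?case
    by - (((drule W_lift)+)?, simp add: sub_commute del: One_nat_def,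
      blast intro: ctx_typing_judg_eq.pi_comp W_ctx)
next
  case pi_uniq
  then show ?case
    by - (((drule W_lift)+)?, simp add: sub_commute del: One_nat_def,
      blast intro: ctx_typing_judg_eq.pi_uniq W_ctx)
next
  case sig_form
  then show ?case
    by - (((drule W_lift)+)?, simp add: sub_commute del: One_nat_def,
      blast intro: ctx_typing_judg_eq.sig_form W_ctx)
next
  case sig_form_eq
  then show ?case
    by - (((drule W_lift)+)?, simp add: sub_commute del: One_nat_def,
      blast intro: ctx_typing_judg_eq.sig_form_eq W_ctx)
next
  case sig_intro
  then show ?case
    by - (((drule W_lift)+)?, simp add: sub_commute del: One_nat_def,
      blast intro: ctx_typing_judg_eq.sig_intro W_ctx)
next
  case sig_intro_eq
  then show ?case
    by - (((drule W_lift)+)?, simp add: sub_commute del: One_nat_def,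
      blast intro: ctx_typing_judg_eq.sig_intro_eq W_ctx)
next
  case sig_elim
  then show ?case
    by - (((drule W_lift)+)?, simp add: sub_commute del: One_nat_def,
      blast intro: ctx_typing_judg_eq.sig_elim W_ctx)
next
  case sig_elim_eq
  then show ?case
    by - (((drule W_lift)+)?, simp add: sub_commute del: One_nat_def,
      blast intro: ctx_typing_judg_eq.sig_elim_eq W_ctx)
next
  case sig_comp
  then show ?case
    by - (((drule W_lift)+)?, simp add: sub_commute del: One_nat_def,
      blast intro: ctx_typing_judg_eq.sig_comp W_ctx)
next
  case plus_form
  then show ?case
    by - (((drule W_lift)+)?, simp add: sub_commute del: One_nat_def,
      blast intro: ctx_typing_judg_eq.plus_form W_ctx)
next
  case plus_form_eq
  then show ?case
    by - (((drule W_lift)+)?, simp add: sub_commute del: One_nat_def,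
      blast intro: ctx_typing_judg_eq.plus_form_eq W_ctx)
next
  case plus_intro1
  then show ?case
    by - (((drule W_lift)+)?, simp add: sub_commute del: One_nat_def,
      blast intro: ctx_typing_judg_eq.plus_intro1 W_ctx)
next
  case plus_intro1_eq
  then show ?case
    by - (((drule W_lift)+)?, simp add: sub_commute del: One_nat_def,
      blast intro: ctx_typing_judg_eq.plus_intro1_eq W_ctx)
next
  case plus_intro2
  then show ?case
    by - (((drule W_lift)+)?, simp add: sub_commute del: One_nat_def,
      blast intro: ctx_typing_judg_eq.plus_intro2 W_ctx)
next
  case plus_intro2_eq
  then show ?case
    by - (((drule W_lift)+)?, simp add: sub_commute del: One_nat_def,
      blast intro: ctx_typing_judg_eq.plus_intro2_eq W_ctx)
next
  case plus_elim
  then show ?case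
    by - (((drule W_lift)+)?, simp add: sub_commute del: One_nat_def,
      blast intro: ctx_typing_judg_eq.plus_elim W_ctx)
next
  case plus_elim_eq
  then show ?case
    by - (((drule W_lift)+)?, simp add: sub_commute del: One_nat_def,
      blast intro: ctx_typing_judg_eq.plus_elim_eq W_ctx)
next
  case plus_comp1
  then show ?case
    by - (((drule W_lift)+)?, simp add: sub_commute del: One_nat_def,
      blast intro: ctx_typing_judg_eq.plus_comp1 W_ctx)
next
  case plus_comp2
  then show ?case
    by - (((drule W_lift)+)?, simp add: sub_commute del: One_nat_def,
      blast intro: ctx_typing_judg_eq.plus_comp2 W_ctx)
next
  case empty_form
  then show ?case
    by - (((drule W_lift)+)?, simp add: sub_commute del: One_nat_def,
      blast intro: ctx_typing_judg_eq.empty_form W_ctx)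
next
  case empty_elim
  then show ?case
    by - (((drule W_lift)+)?, simp add: sub_commute del: One_nat_def,
      blast intro: ctx_typing_judg_eq.empty_elim W_ctx)
next
  case empty_elim_eq
  then show ?case
    by - (((drule W_lift)+)?, simp add: sub_commute del: One_nat_def,
      blast intro: ctx_typing_judg_eq.empty_elim_eq W_ctx)
next
  case unit_form
  then show ?case
    by - (((drule W_lift)+)?, simp add: sub_commute del: One_nat_def,
      blast intro: ctx_typing_judg_eq.unit_form W_ctx)
next
  case unit_intro
  then show ?case
    by - (((drule W_lift)+)?, simp add: sub_commute del: One_nat_def,
      blast intro: ctx_typing_judg_eq.unit_intro W_ctx)
next
  case unit_elim
  then show ?case
    by - (((drule W_lift)+)?, simp add: sub_commute del: One_nat_def,
      blast intro: ctx_typing_judg_eq.unit_elim W_ctx)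
next
  case unit_elim_eq
  then show ?case
    by - (((drule W_lift)+)?, simp add: sub_commute del: One_nat_def,
      blast intro: ctx_typing_judg_eq.unit_elim_eq W_ctx)
next
  case unit_comp
  then show ?case
    by - (((drule W_lift)+)?, simp add: sub_commute del: One_nat_def,
      blast intro: ctx_typing_judg_eq.unit_comp W_ctx)
next
  case nat_form
  then show ?case
    by - (((drule W_lift)+)?, simp add: sub_commute del: One_nat_def,
      blast intro: ctx_typing_judg_eq.nat_form W_ctx)
next
  case nat_intro1
  then show ?case
    by - (((drule W_lift)+)?, simp add: sub_commute del: One_nat_def,
      blast intro: ctx_typing_judg_eq.nat_intro1 W_ctx)
next
  case nat_intro2
  then show ?case
    by - (((drule W_lift)+)?, simp add: sub_commute del: One_nat_def,
      blast intro: ctx_typing_judg_eq.nat_intro2 W_ctx)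
next
  case nat_intro2_eq
  then show ?case
    by - (((drule W_lift)+)?, simp add: sub_commute del: One_nat_def,
      blast intro: ctx_typing_judg_eq.nat_intro2_eq W_ctx)
next
  case nat_elim
  then show ?case
    by - (((drule W_lift)+)?, simp add: sub_commute del: One_nat_def,
      blast intro: ctx_typing_judg_eq.nat_elim W_ctx)
next
  case nat_elim_eq
  then show ?case
    by - (((drule W_lift)+)?, simp add: sub_commute del: One_nat_def,
      blast intro: ctx_typing_judg_eq.nat_elim_eq W_ctx)
next
  case nat_comp1
  then show ?case
    by - (((drule W_lift)+)?, simp add: sub_commute del: One_nat_def,
      blast intro: ctx_typing_judg_eq.nat_comp1 W_ctx)
next
  case nat_comp2
  then show ?case
    by - (((drule W_lift)+)?, simp add: sub_commute del: One_nat_def,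
      blast intro: ctx_typing_judg_eq.nat_comp2 W_ctx)
next
  case id_form
  then show ?case
    by - (((drule W_lift)+)?, simp add: sub_commute del: One_nat_def,
      blast intro: ctx_typing_judg_eq.id_form W_ctx)
next
  case id_form_eq
  then show ?case
    by - (((drule W_lift)+)?, simp add: sub_commute del: One_nat_def,
      blast intro: ctx_typing_judg_eq.id_form_eq W_ctx)
next
  case id_intro
  then show ?case
    by - (((drule W_lift)+)?, simp add: sub_commute del: One_nat_def,
      blast intro: ctx_typing_judg_eq.id_intro W_ctx)
next
  case id_intro_eq
  then show ?case
    by - (((drule W_lift)+)?, simp add: sub_commute del: One_nat_def,
      blast intro: ctx_typing_judg_eq.id_intro_eq W_ctx)
next
  case id_elim
  then show ?case
    by - (((drule W_lift)+)?, simp add: sub_commute del: One_nat_def,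
      blast intro: ctx_typing_judg_eq.id_elim W_ctx)
next
  case id_elim_eq
  then show ?case
    by - (((drule W_lift)+)?, simp add: sub_commute del: One_nat_def,
      blast intro: ctx_typing_judg_eq.id_elim_eq W_ctx)
next
  case id_comp
  then show ?case
    by - (((drule W_lift)+)?, simp add: sub_commute del: One_nat_def,
      blast intro: ctx_typing_judg_eq.id_comp W_ctx)
next
  case push_form
  then show ?case
    by - (((drule W_lift)+)?, simp add: sub_commute del: One_nat_def,
      blast intro: ctx_typing_judg_eq.push_form W_ctx)
next
  case push_form_eq
  then show ?case
    by - (((drule W_lift)+)?, simp add: sub_commute del: One_nat_def,
      blast intro: ctx_typing_judg_eq.push_form_eq W_ctx)
next
  case push_intro1
  then show ?case
    by - (((drule W_lift)+)?, simp add: sub_commute del: One_nat_def,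
      blast intro: ctx_typing_judg_eq.push_intro1 W_ctx)
next
  case push_intro1_eq
  then show ?case
    by - (((drule W_lift)+)?, simp add: sub_commute del: One_nat_def,
      blast intro: ctx_typing_judg_eq.push_intro1_eq W_ctx)
next
  case push_intro2
  then show ?case
    by - (((drule W_lift)+)?, simp add: sub_commute del: One_nat_def,
      blast intro: ctx_typing_judg_eq.push_intro2 W_ctx)
next
  case push_intro2_eq
  then show ?case
    by - (((drule W_lift)+)?, simp add: sub_commute del: One_nat_def,
      blast intro: ctx_typing_judg_eq.push_intro2_eq W_ctx)
next
  case push_glue
  then show ?case
    by - (((drule W_lift)+)?, simp add: sub_commute del: One_nat_def,
      blast intro: ctx_typing_judg_eq.push_glue W_ctx)
next
  case push_glue_eq
  then show ?case
    by - (((drule W_lift)+)?, simp add: sub_commute del: One_nat_def,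
      blast intro: ctx_typing_judg_eq.push_glue_eq W_ctx)
next
  case push_elim
  then show ?case
    by - (((drule W_lift)+)?, simp add: sub_commute del: One_nat_def,
      blast intro: ctx_typing_judg_eq.push_elim W_ctx)
next
  case push_elim_eq
  then show ?case
    by - (((drule W_lift)+)?, simp add: sub_commute del: One_nat_def,
      blast intro: ctx_typing_judg_eq.push_elim_eq W_ctx)
next
  case push_comp1
  then show ?case
    by - (((drule W_lift)+)?, simp add: sub_commute del: One_nat_def,
      blast intro: ctx_typing_judg_eq.push_comp1 W_ctx)
next
  case push_comp2
  then show ?case
    by - (((drule W_lift)+)?, simp add: sub_commute del: One_nat_def,
      blast intro: ctx_typing_judg_eq.push_comp2 W_ctx)
next
  case push_comp_glue
  then show ?case
    by - (((drule W_lift)+)?, simp add: sub_commute del: One_nat_def,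
      blast intro: ctx_typing_judg_eq.push_comp_glue W_ctx)
next
  case push_comp_glue_eq
  then show ?case
    by - (((drule W_lift)+)?, simp add: sub_commute del: One_nat_def,
      blast intro: ctx_typing_judg_eq.push_comp_glue_eq W_ctx)
next
  case univalence
  then show ?case
    by - (((drule W_lift)+)?, simp add: sub_commute del: One_nat_def,
      blast intro: ctx_typing_judg_eq.univalence W_ctx)
next
  case univalence_eq
  then show ?case
    by - (((drule W_lift)+)?, simp add: sub_commute del: One_nat_def,
      blast intro: ctx_typing_judg_eq.univalence_eq W_ctx)
qed

end

section \<open>Well-formed contexts and typed substitutions\<close>

primrec ctx_entries_typed :: "tm list \<Rightarrow> bool" where
  "ctx_entries_typed [] = True"
| "ctx_entries_typed (A # \<Gamma>) = (ctx_entries_typed \<Gamma> \<and> (\<exists>i. \<Gamma> \<turnstile> A \<Colon> Univ i))"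

text \<open>Rules with a binder may mention \<Gamma> only through an extended context. Because
  \<open>ctx_entries_typed\<close> is recursive, forgetting the bound variable is mere
  simplification, so a plain rule induction recovers the presupposition that the context of a
  judgement is well formed.\<close>

lemma ctx_entries:
  shows "\<turnstile> \<Gamma> ctx \<Longrightarrow> ctx_entries_typed \<Gamma>"
    and "\<Gamma> \<turnstile> t \<Colon> T \<Longrightarrow> ctx_entries_typed \<Gamma>"
    and "\<Gamma> \<turnstile> t \<doteq> u \<Colon> T \<Longrightarrow> ctx_entries_typed \<Gamma>"
  by (induction rule: ctx_typing_judg_eq.inducts) auto

lemma ctx_entries_ctx: "ctx_entries_typed \<Gamma> \<Longrightarrow> \<turnstile> \<Gamma> ctx"
  by (cases \<Gamma>) (auto intro: ctx_emp ctx_ext)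

lemma typing_ctx: "\<Gamma> \<turnstile> t \<Colon> T \<Longrightarrow> \<turnstile> \<Gamma> ctx"
  by (simp add: ctx_entries(2) ctx_entries_ctx)

lemma ctx_ConsD: "\<turnstile> A # \<Gamma> ctx \<Longrightarrow> \<turnstile> \<Gamma> ctx \<and> (\<exists>i. \<Gamma> \<turnstile> A \<Colon> Univ i)"
  using ctx_entries(1) ctx_entries_ctx by fastforce

text \<open>Types are compared here as terms and not through a derivation. Lifting such a renaming
  is then an index computation, available before weakening is known; \<open>sub_wf\<close> requires
  typed values and must wait for weakening.\<close>

definition renaming_wf :: "(nat \<Rightarrow> tm) \<Rightarrow> tm list \<Rightarrow> tm list \<Rightarrow> bool" where
  "renaming_wf \<sigma> \<Gamma> \<Delta> \<longleftrightarrow> \<turnstile> \<Delta> ctx \<and> (\<forall>n < length \<Gamma>. \<exists>m < length \<Delta>. \<sigma> n = Var m \<and>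
     sub \<sigma> (shift (Suc n) (\<Gamma> ! n)) = shift (Suc m) (\<Delta> ! m))"

definition sub_wf :: "(nat \<Rightarrow> tm) \<Rightarrow> tm list \<Rightarrow> tm list \<Rightarrow> bool" where
  "sub_wf \<sigma> \<Gamma> \<Delta> \<longleftrightarrow> \<turnstile> \<Delta> ctx \<and> (\<forall>n < length \<Gamma>. \<Delta> \<turnstile> \<sigma> n \<Colon> sub \<sigma> (shift (Suc n) (\<Gamma> ! n)))"

lemma sub_up_shift: "sub (up \<sigma>) (shift (Suc n) t) = shift 1 (sub \<sigma> (shift n t))"
  by (simp add: sigma)

lemma shift_shift: "shift k (shift m t) = shift (m + k) t"
  by (simp add: sigma)

interpretation renaming_wf: substitution_class renaming_wf
proof
  fix \<sigma> \<Gamma> \<Delta> A i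
  assume 1: "renaming_wf \<sigma> \<Gamma> \<Delta>" and 2: "\<Delta> \<turnstile> sub \<sigma> A \<Colon> Univ i"
  show "renaming_wf (up \<sigma>) (A # \<Gamma>) (sub \<sigma> A # \<Delta>)"
    unfolding renaming_wf_def
  proof (intro conjI allI impI)
    show "\<turnstile> sub \<sigma> A # \<Delta> ctx" using 2 by (rule ctx_ext)
    fix n assume n: "n < length (A # \<Gamma>)"
    show "\<exists>m<length (sub \<sigma> A # \<Delta>). up \<sigma> n = Var m \<and>
        sub (up \<sigma>) (shift (Suc n) ((A # \<Gamma>) ! n)) = shift (Suc m) ((sub \<sigma> A # \<Delta>) ! m)"
    proof (cases n)
      case 0
      then show ?thesis by (auto simp: sub_shift1[simplified])
    next
      case (Suc k)
      with n 1 obtain m where "m < length \<Delta>" "\<sigma> k = Var m"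
        "sub \<sigma> (shift (Suc k) (\<Gamma> ! k)) = shift (Suc m) (\<Delta> ! m)"
        unfolding renaming_wf_def by auto
      then show ?thesis
        using Suc by (intro exI[of _ "Suc m"]) (auto simp: sub_up_shift[of \<sigma> "Suc k"] shift_Var
            shift_shift)
    qed
  qed
qed (simp_all add: renaming_wf_def, metis var)

lemma renaming_wf_wk: "\<turnstile> \<Theta> @ \<Gamma> ctx \<Longrightarrow> renaming_wf (wk (length \<Theta>)) \<Gamma> (\<Theta> @ \<Gamma>)"
  unfolding renaming_wf_def
  by (intro conjI allI impI exI, assumption) (auto simp: wk_app nth_append shift_wk sigma_basic
      add_ac)

lemma weakening:
  assumes "\<turnstile> \<Theta> @ \<Gamma> ctx" "k = length \<Theta>"
  shows "\<Gamma> \<turnstile> t \<Colon> T \<Longrightarrow> \<Theta> @ \<Gamma> \<turnstile> sub (wk k) t \<Colon> sub (wk k) T"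
    and "\<Gamma> \<turnstile> t \<doteq> u \<Colon> T \<Longrightarrow> \<Theta> @ \<Gamma> \<turnstile> sub (wk k) t \<doteq> sub (wk k) u \<Colon> sub (wk k) T"
  using renaming_wf.sub_admissible_aux renaming_wf_wk[OF assms(1)] unfolding assms(2) by blast+

interpretation sub_wf: substitution_class sub_wf
proof
  fix \<sigma> \<Gamma> \<Delta> A i
  assume 1: "sub_wf \<sigma> \<Gamma> \<Delta>" and 2: "\<Delta> \<turnstile> sub \<sigma> A \<Colon> Univ i"
  show "sub_wf (up \<sigma>) (A # \<Gamma>) (sub \<sigma> A # \<Delta>)"
    unfolding sub_wf_def
  proof (intro conjI allI impI)
    show ctx: "\<turnstile> sub \<sigma> A # \<Delta> ctx" using 2 by (rule ctx_ext)
    fix n assume n: "n < length (A # \<Gamma>)"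
    show "sub \<sigma> A # \<Delta> \<turnstile> up \<sigma> n \<Colon> sub (up \<sigma>) (shift (Suc n) ((A # \<Gamma>) ! n))"
    proof (cases n)
      case 0
      then show ?thesis using var[OF ctx, of 0] by (simp add: sub_shift1[simplified])
    next
      case (Suc k)
      with n 1 have "\<Delta> \<turnstile> \<sigma> k \<Colon> sub \<sigma> (shift (Suc k) (\<Gamma> ! k))"
        unfolding sub_wf_def by auto
      then show ?thesis
        using weakening(1)[of "[sub \<sigma> A]" \<Delta> 1, folded shift_wk] ctx Suc
        by (simp add: sub_up_shift[of \<sigma> "Suc k", simplified])
    qed
  qed
qed (auto simp: sub_wf_def)

lemma substitution:
  assumes "sub_wf \<sigma> \<Gamma> \<Delta>"
  shows "\<Gamma> \<turnstile> t \<Colon> T \<Longrightarrow> \<Delta> \<turnstile> sub \<sigma> t \<Colon> sub \<sigma> T"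
    and "\<Gamma> \<turnstile> t \<doteq> u \<Colon> T \<Longrightarrow> \<Delta> \<turnstile> sub \<sigma> t \<doteq> sub \<sigma> u \<Colon> sub \<sigma> T"
  using sub_wf.sub_admissible_aux assms by blast+

lemma sub_wf_wk: "\<turnstile> \<Theta> @ \<Gamma> ctx \<Longrightarrow> k = length \<Theta> \<Longrightarrow> sub_wf (wk k) \<Gamma> (\<Theta> @ \<Gamma>)"
  using renaming_wf_wk unfolding sub_wf_def renaming_wf_def by (metis var)

lemma sub_wf_scons: "sub_wf \<sigma> \<Gamma> \<Delta> \<Longrightarrow> \<Delta> \<turnstile> a \<Colon> sub \<sigma> A \<Longrightarrow> sub_wf (a \<cdot> \<sigma>) (A # \<Gamma>) \<Delta>"
  unfolding sub_wf_def by (auto simp: less_Suc_eq_0_disj sigma)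

lemma sub_wf_Var: "\<turnstile> \<Gamma> ctx \<Longrightarrow> sub_wf Var \<Gamma> \<Gamma>"
  using sub_wf_wk[of "[]" \<Gamma> 0] by (simp add: wk_0)

section \<open>Derived rules\<close>

lemma var_typing: "\<turnstile> \<Gamma> ctx \<Longrightarrow> n < length \<Gamma> \<Longrightarrow> T = sub (wk (Suc n)) (\<Gamma> ! n) \<Longrightarrow> \<Gamma> \<turnstile> Var n \<Colon> T"
  using var by (simp add: shift_wk)

lemma weakening1:
  assumes "\<Gamma> \<turnstile> A \<Colon> Univ i"
  shows "\<Gamma> \<turnstile> t \<Colon> T \<Longrightarrow> A # \<Gamma> \<turnstile> shift 1 t \<Colon> shift 1 T"
    and "\<Gamma> \<turnstile> t \<doteq> u \<Colon> T \<Longrightarrow> A # \<Gamma> \<turnstile> shift 1 t \<doteq> shift 1 u \<Colon> shift 1 T"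
  using weakening[of "[A]" \<Gamma> 1] ctx_ext[OF assms] by (simp_all add: shift_wk)

lemma subst1:
  assumes "\<Gamma> \<turnstile> a \<Colon> A"
  shows "A # \<Gamma> \<turnstile> t \<Colon> T \<Longrightarrow> \<Gamma> \<turnstile> inst t a \<Colon> inst T a"
    and "A # \<Gamma> \<turnstile> t \<doteq> u \<Colon> T \<Longrightarrow> \<Gamma> \<turnstile> inst t a \<doteq> inst u a \<Colon> inst T a"
  using substitution[OF sub_wf_scons[OF sub_wf_Var[OF typing_ctx[OF assms]]]] assms
  by (simp_all add: instw_wk sub_Var wk_0)

lemma subst_wk:
  assumes "\<turnstile> \<Theta> @ \<Gamma> ctx" "k = length \<Theta>" "\<Theta> @ \<Gamma> \<turnstile> a \<Colon> shift k A"
  shows "A # \<Gamma> \<turnstile> t \<Colon> T \<Longrightarrow> \<Theta> @ \<Gamma> \<turnstile> instw k t a \<Colon> instw k T a"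
  using substitution[OF sub_wf_scons[OF sub_wf_wk[OF assms(1,2)]]] assms(3)
  by (simp_all add: instw_wk shift_wk)

lemma weakening_under:
  assumes "\<turnstile> \<Theta> @ \<Gamma> ctx" "k = length \<Theta>" "A # \<Gamma> \<turnstile> t \<Colon> T"
  shows "shift k A # \<Theta> @ \<Gamma> \<turnstile> shift_under k t \<Colon> shift_under k T"
proof -
  obtain i where "\<Gamma> \<turnstile> A \<Colon> Univ i"
    using assms(3) typing_ctx ctx_ConsD by blast
  then have "\<Theta> @ \<Gamma> \<turnstile> sub (wk k) A \<Colon> Univ i"
    using weakening(1)[OF assms(1,2)] by fastforce
  then have "sub_wf (up (wk k)) (A # \<Gamma>) (sub (wk k) A # \<Theta> @ \<Gamma>)"
    using sub_wf.W_up[OF sub_wf_wk[OF assms(1,2)]] by blast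
  from substitution(1)[OF this assms(3)] show ?thesis
    by (simp add: sigma)
qed

lemma arr_form: "\<Gamma> \<turnstile> A \<Colon> Univ i \<Longrightarrow> \<Gamma> \<turnstile> B \<Colon> Univ i \<Longrightarrow> \<Gamma> \<turnstile> arr A B \<Colon> Univ i"
  unfolding arr_def using weakening1(1)[of \<Gamma> A i B "Univ i"]
  by (auto intro: pi_form simp: sigma)

lemma arr_form_eq: "\<Gamma> \<turnstile> A \<Colon> Univ i \<Longrightarrow> \<Gamma> \<turnstile> A \<doteq> A' \<Colon> Univ i \<Longrightarrow> \<Gamma> \<turnstile> B \<doteq> B' \<Colon> Univ i \<Longrightarrow>
    \<Gamma> \<turnstile> arr A B \<doteq> arr A' B' \<Colon> Univ i"
  unfolding arr_def using weakening1(2)[of \<Gamma> A i B B' "Univ i"]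
  by (auto intro: pi_form_eq simp: sigma)

lemma lam_arr: "A # \<Gamma> \<turnstile> b \<Colon> shift 1 B \<Longrightarrow> \<Gamma> \<turnstile> Lam A b \<Colon> arr A B"
  unfolding arr_def by (rule pi_intro)

lemma app_arr: "\<Gamma> \<turnstile> f \<Colon> arr A B \<Longrightarrow> \<Gamma> \<turnstile> a \<Colon> A \<Longrightarrow> \<Gamma> \<turnstile> App f a \<Colon> B"
  unfolding arr_def by (drule (1) pi_elim) (simp add: sigma)

lemma app_arr_eq: "\<Gamma> \<turnstile> f \<doteq> f' \<Colon> arr A B \<Longrightarrow> \<Gamma> \<turnstile> a \<doteq> a' \<Colon> A \<Longrightarrow> \<Gamma> \<turnstile> App f a \<doteq> App f' a' \<Colon> B"
  unfolding arr_def by (drule (1) pi_elim_eq) (simp add: sigma)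

lemma beta_arr: "A # \<Gamma> \<turnstile> b \<Colon> shift 1 B \<Longrightarrow> \<Gamma> \<turnstile> a \<Colon> A \<Longrightarrow> \<Gamma> \<turnstile> App (Lam A b) a \<doteq> inst b a \<Colon> B"
  by (drule (1) pi_comp) (simp add: sigma)

lemma id_arr: "\<Gamma> \<turnstile> A \<Colon> Univ i \<Longrightarrow> \<Gamma> \<turnstile> Lam A (Var 0) \<Colon> arr A A"
  by (rule lam_arr, rule var_typing) (auto intro: ctx_ext simp: sigma)

lemma id_beta: "\<Gamma> \<turnstile> a \<Colon> A \<Longrightarrow> \<Gamma> \<turnstile> A \<Colon> Univ i \<Longrightarrow> \<Gamma> \<turnstile> App (Lam A (Var 0)) a \<doteq> a \<Colon> A"
  using beta_arr[of A \<Gamma> "Var 0" A a] var_typing[of "A # \<Gamma>" 0 "shift 1 A"]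
  by (auto intro: ctx_ext simp: sigma)

text \<open>
  Functionality of terms in their variables comes from congruence of application and the
  \<open>\<beta>\<close>-rule, without another induction on derivations.
\<close>

lemma inst_cong:
  assumes t: "A # \<Gamma> \<turnstile> t \<Colon> T" and T: "A # \<Gamma> \<turnstile> T \<Colon> Univ k"
    and a: "\<Gamma> \<turnstile> a \<Colon> A" and b: "\<Gamma> \<turnstile> b \<Colon> A" and ab: "\<Gamma> \<turnstile> a \<doteq> b \<Colon> A"
  shows "\<Gamma> \<turnstile> inst t a \<doteq> inst t b \<Colon> inst T a"
proof -
  \<comment> \<open>Used twice: for \<open>T\<close>, whose own type \<open>Univ k\<close> does not
    depend on the variable, and then for \<open>t\<close>, with the equality of types gained from
    the first use.\<close>
  have *: "\<Gamma> \<turnstile> inst u a \<doteq> inst u b \<Colon> inst U a"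
    if u: "A # \<Gamma> \<turnstile> u \<Colon> U" and U: "\<Gamma> \<turnstile> inst U b \<doteq> inst U a \<Colon> Univ m" for u U m
  proof -
    have "\<Gamma> \<turnstile> App (Lam A u) a \<doteq> App (Lam A u) b \<Colon> inst U a"
      using pi_elim_eq[OF eq_refl[OF pi_intro[OF u]] ab] .
    moreover have "\<Gamma> \<turnstile> App (Lam A u) b \<doteq> inst u b \<Colon> inst U a"
      using eq_conv[OF pi_comp[OF u b] U] .
    ultimately show ?thesis
      using pi_comp[OF u a] by (meson eq_sym eq_trans)
  qed
  have "\<turnstile> \<Gamma> ctx" using a by (rule typing_ctx)
  then have "\<Gamma> \<turnstile> inst T a \<doteq> inst T b \<Colon> Univ k"
    using *[OF T, of "Suc k"] eq_refl[OF univ_intro, of \<Gamma> k] by (simp add: sigma)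
  then show ?thesis using *[OF t] eq_sym by blast
qed

lemma lift_level: "\<Gamma> \<turnstile> A \<Colon> Univ i \<Longrightarrow> i \<le> k \<Longrightarrow> \<Gamma> \<turnstile> A \<Colon> Univ k"
  by (induction k) (auto simp: le_Suc_eq intro: univ_cumul)

section \<open>Contexts for path induction, inhabitation, and transport\<close>

abbreviation path_ctx :: "tm \<Rightarrow> tm list \<Rightarrow> tm list" where
  "path_ctx S \<Gamma> \<equiv> TId (shift 2 S) (Var 1) (Var 0) # shift 1 S # S # \<Gamma>"

lemma path_ctx_wf:
  assumes "\<Gamma> \<turnstile> S \<Colon> Univ i"
  shows "\<turnstile> path_ctx S \<Gamma> ctx"
proof -
  have 1: "\<turnstile> S # \<Gamma> ctx" using assms by (rule ctx_ext)
  have 2: "\<turnstile> shift 1 S # S # \<Gamma> ctx"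
    using weakening1(1)[OF assms assms] ctx_ext by (auto simp: sigma)
  have "shift 1 S # S # \<Gamma> \<turnstile> shift 2 S \<Colon> Univ i"
    using weakening(1)[of "[shift 1 S, S]" \<Gamma> 2 S "Univ i"] 2 assms by (simp add: sigma)
  then have "shift 1 S # S # \<Gamma> \<turnstile> TId (shift 2 S) (Var 1) (Var 0) \<Colon> Univ i"
    by (rule id_form) (rule var_typing[OF 2]; simp add: sigma)+
  then show ?thesis by (rule ctx_ext)
qed

lemma path_ctx_vars:
  assumes "\<Gamma> \<turnstile> S \<Colon> Univ i"
  shows "path_ctx S \<Gamma> \<turnstile> Var 2 \<Colon> shift 3 S" "path_ctx S \<Gamma> \<turnstile> Var 1 \<Colon>
      shift 3 S" "path_ctx S \<Gamma> \<turnstile> Var 0 \<Colon> TId (shift 3 S) (Var 2) (Var 1)"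
  by (rule var_typing[OF path_ctx_wf[OF assms]]; simp add: sigma)+

lemma path_ctx_weakening:
  assumes "\<Gamma> \<turnstile> S \<Colon> Univ i"
  shows "\<Gamma> \<turnstile> t \<Colon> T \<Longrightarrow> path_ctx S \<Gamma> \<turnstile> shift 3 t \<Colon> shift 3 T"
    and "A # \<Gamma> \<turnstile> u \<Colon> U \<Longrightarrow> shift 3 A # path_ctx S \<Gamma> \<turnstile> shift_under 3 u \<Colon> shift_under 3 U"
    and "S # \<Gamma> \<turnstile> u \<Colon> U \<Longrightarrow> path_ctx S \<Gamma> \<turnstile> instw 3 u (Var 2) \<Colon> instw 3 U (Var 2)"
    and "S # \<Gamma> \<turnstile> u \<Colon> U \<Longrightarrow> path_ctx S \<Gamma> \<turnstile> instw 3 u (Var 1) \<Colon> instw 3 U (Var 1)"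
  using weakening(1)[of "[TId (shift 2 S) (Var 1) (Var 0), shift 1 S, S]" \<Gamma> 3 t T]
    weakening_under[of "[TId (shift 2 S) (Var 1) (Var 0), shift 1 S, S]" \<Gamma> 3 A u U]
    subst_wk[of "[TId (shift 2 S) (Var 1) (Var 0), shift 1 S, S]" \<Gamma> 3 _ S u U]
    path_ctx_wf[OF assms] path_ctx_vars[OF assms]
  by (simp_all add: shift_wk[of 3])

lemma var_zero: "\<Gamma> \<turnstile> S \<Colon> Univ i \<Longrightarrow> S # \<Gamma> \<turnstile> Var 0 \<Colon> shift 1 S"
  by (rule var_typing) (auto intro: ctx_ext simp: sigma)

lemma weakening1_under:
  assumes "\<Gamma> \<turnstile> S \<Colon> Univ i"
  shows "A # \<Gamma> \<turnstile> u \<Colon> U \<Longrightarrow> shift 1 A # S # \<Gamma> \<turnstile> shift_under 1 u \<Colon> shift_under 1 U"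
  using weakening_under[of "[S]" \<Gamma> 1 A u U] ctx_ext[OF assms] by simp

definition inhabited :: "tm list \<Rightarrow> tm \<Rightarrow> bool" where
  "inhabited \<Gamma> T \<longleftrightarrow> (\<exists>t. \<Gamma> \<turnstile> t \<Colon> T)"

lemma inhabited_J:
  assumes "path_ctx S \<Gamma> \<turnstile> C \<Colon> Univ k" "inhabited (S #
      \<Gamma>) (instw3 1 C (Var 0) (Var 0) (Refl (Var 0)))"
    "\<Gamma> \<turnstile> a \<Colon> S" "\<Gamma> \<turnstile> b \<Colon> S" "\<Gamma> \<turnstile> p \<Colon> TId S a b"
  shows "inhabited \<Gamma> (inst3 C a b p)"
  using assms unfolding inhabited_def by (blast intro: id_elim)

lemma inhabited_conv: "inhabited \<Gamma> A \<Longrightarrow> \<Gamma> \<turnstile> A \<doteq> B \<Colon> Univ i \<Longrightarrow> inhabited \<Gamma> B"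
  unfolding inhabited_def by (blast intro: conv)

context
  fixes \<Gamma> S i P k
  assumes S: "\<Gamma> \<turnstile> S \<Colon> Univ i" and P: "S # \<Gamma> \<turnstile> P \<Colon> Univ k"
begin

lemma transp_motive:
  "path_ctx S \<Gamma> \<turnstile> arr (instw 3 P (Var 2)) (instw 3 P (Var 1)) \<Colon> Univ k"
  "S # \<Gamma> \<turnstile> Lam P (Var 0) \<Colon>
      instw3 1 (arr (instw 3 P (Var 2)) (instw 3 P (Var 1))) (Var 0) (Var 0) (Refl (Var 0))"
  using path_ctx_weakening(3,4)[OF S P] id_arr[OF P]
  by (auto intro!: arr_form simp: sigma sub_arr)

lemma transp_type:
  assumes "\<Gamma> \<turnstile> a \<Colon> S" "\<Gamma> \<turnstile> b \<Colon> S" "\<Gamma> \<turnstile> p \<Colon> TId S a b" "\<Gamma> \<turnstile> u \<Colon> inst P a"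
  shows "\<Gamma> \<turnstile> transp P a b p u \<Colon> inst P b"
  unfolding transp_def
  using id_elim[OF transp_motive assms(1-3)] assms(4)
  by (auto intro!: app_arr simp: sigma sub_arr)

lemma transp_cong:
  assumes "\<Gamma> \<turnstile> a \<Colon> S" "\<Gamma> \<turnstile> b \<Colon> S" "\<Gamma> \<turnstile> p \<Colon> TId S a b" "\<Gamma> \<turnstile> u \<doteq> u' \<Colon> inst P a"
  shows "\<Gamma> \<turnstile> transp P a b p u \<doteq> transp P a b p u' \<Colon> inst P b"
  unfolding transp_def
  using eq_refl[OF id_elim[OF transp_motive assms(1-3)]] assms(4)
  by (auto intro!: app_arr_eq simp: sigma sub_arr)

lemma transp_comp:
  assumes "\<Gamma> \<turnstile> a \<Colon> S" "\<Gamma> \<turnstile> u \<Colon> inst P a"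
  shows "\<Gamma> \<turnstile> transp P a a (Refl a) u \<doteq> u \<Colon> inst P a"
proof -
  have "\<Gamma> \<turnstile> transp P a a (Refl a) u \<doteq> App (Lam (inst P a) (Var 0)) u \<Colon> inst P a"
    unfolding transp_def
    using id_comp[OF transp_motive assms(1)] eq_refl[OF assms(2)]
    by (auto intro!: app_arr_eq simp: sigma sub_arr)
  moreover have "\<Gamma> \<turnstile> inst P a \<Colon> Univ k"
    using subst1(1)[OF assms(1) P] by (simp add: sigma)
  ultimately show ?thesis
    using id_beta[OF assms(2)] eq_trans by blast
qed

end

section \<open>Action of functions on paths\<close>

text \<open>A direct induction instead of \<open>apd\<close> at a constant family, whose type would
  carry a transport.\<close>

definition ap :: "tm \<Rightarrow> tm \<Rightarrow> tm \<Rightarrow> tm \<Rightarrow> tm \<Rightarrow> tm" where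
  "ap X s a b p = IndId (TId (shift 3 X) (instw 3 s (Var 2)) (instw 3 s (Var 1))) (Refl s) a b p"

lemma sub_ap: "sub \<sigma> (ap X s a b p) = ap (sub \<sigma> X) (sub (up \<sigma>) s) (sub \<sigma> a) (sub \<sigma> b) (sub \<sigma> p)"
  by (simp add: ap_def sigma)

text \<open>
  \<open>theta X u v a b p\<close> is the map from \<open>u = v\<close> to \<open>transp X a b p u = v\<close> for the constant family \<open>X\<close>,
  by induction on \<open>p\<close>, so that it computes to the identity on reflexivity.
\<close>

definition theta_motive :: "tm \<Rightarrow> tm \<Rightarrow> tm \<Rightarrow> tm" where
  "theta_motive X u v = arr (shift 3 (TId X u v))
     (TId (shift 3 X) (transp (shift 4 X) (Var 2) (Var 1) (Var 0) (shift 3 u)) (shift 3 v))"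

definition theta :: "tm \<Rightarrow> tm \<Rightarrow> tm \<Rightarrow> tm \<Rightarrow> tm \<Rightarrow> tm \<Rightarrow> tm" where
  "theta X u v a b p = IndId (theta_motive X u v) (Lam (shift 1 (TId X u v)) (Var 0)) a b p"

lemma sub_theta: "sub \<sigma> (theta X u v a b p) =
   theta (sub \<sigma> X) (sub \<sigma> u) (sub \<sigma> v) (sub \<sigma> a) (sub \<sigma> b) (sub \<sigma> p)"
  by (simp add: theta_def theta_motive_def sub_arr sub_transp sigma eval_nat_numeral)

lemma weakening1_type: "\<Gamma> \<turnstile> S \<Colon> Univ i \<Longrightarrow> \<Gamma> \<turnstile> X \<Colon> Univ k \<Longrightarrow> S # \<Gamma> \<turnstile> shift 1 X \<Colon> Univ k"
  using weakening1(1)[of \<Gamma> S i X "Univ k"] by (simp add: sigma)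

context
  fixes \<Gamma> S i P k s
  assumes S: "\<Gamma> \<turnstile> S \<Colon> Univ i" and P: "S # \<Gamma> \<turnstile> P \<Colon> Univ k" and s: "S # \<Gamma> \<turnstile> s \<Colon> P"
begin

lemma apd_motive:
  defines "C \<equiv> TId (instw 3 P (Var 1))
         (transp (shift_under 3 P) (Var 2) (Var 1) (Var 0) (instw 3 s (Var 2)))
         (instw 3 s (Var 1))"
  shows "path_ctx S \<Gamma> \<turnstile> C \<Colon> Univ k"
    and "S # \<Gamma> \<turnstile> Refl s \<Colon> instw3 1 C (Var 0) (Var 0) (Refl (Var 0))"
proof -
  have S3: "path_ctx S \<Gamma> \<turnstile> shift 3 S \<Colon> Univ i"
      using path_ctx_weakening(1)[OF S S] by (simp add: sigma)
  have P3: "shift 3 S # path_ctx S \<Gamma> \<turnstile> shift_under 3 P \<Colon> Univ k"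
    using path_ctx_weakening(2)[OF S P] by (simp add: sigma)
  have "path_ctx S \<Gamma> \<turnstile> transp (shift_under 3 P) (Var 2) (Var 1) (Var 0) (instw 3 s (Var 2)) \<Colon>
      inst (shift_under 3 P) (Var 1)"
    by (rule transp_type[OF S3 P3 path_ctx_vars[OF S]]) (use path_ctx_weakening(3)[OF S s] in
        \<open>simp add: sigma\<close>)
  then show "path_ctx S \<Gamma> \<turnstile> C \<Colon> Univ k"
    using path_ctx_weakening(4)[OF S s] path_ctx_weakening(4)[OF S P]
        by (auto intro!: id_form simp: C_def sigma)
  have S1: "S # \<Gamma> \<turnstile> shift 1 S \<Colon> Univ i" using weakening1_type[OF S S] .
  have P1: "shift 1 S # S # \<Gamma> \<turnstile> shift_under 1 P \<Colon> Univ k"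
    using weakening1_under[OF S P] by (simp add: sigma)
  have "S # \<Gamma> \<turnstile> transp (shift_under 1 P) (Var 0) (Var 0) (Refl (Var 0)) s \<doteq>
      s \<Colon> inst (shift_under 1 P) (Var 0)"
    by (rule transp_comp[OF S1 P1 var_zero[OF S]]) (use s in \<open>simp add: sigma\<close>)
  \<comment> \<open>The motive at reflexivity has a transport on its left side. It computes
    judgementally, so \<open>Refl s\<close> needs only a conversion.\<close>
  then have "S # \<Gamma> \<turnstile> TId P s s \<doteq>
      TId P (transp (shift_under 1 P) (Var 0) (Var 0) (Refl (Var 0)) s) s \<Colon> Univ k"
    using P s by (auto intro!: id_form_eq eq_refl simp: sigma eq_sym)
  then have "S # \<Gamma> \<turnstile> Refl s \<Colon> TId P (transp (shift_under 1 P) (Var 0) (Var 0) (Refl (Var 0)) s) s"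
    using conv[OF id_intro[OF P s]] by blast
  then show "S # \<Gamma> \<turnstile> Refl s \<Colon> instw3 1 C (Var 0) (Var 0) (Refl (Var 0))"
    by (simp add: C_def sigma sub_transp)
qed

lemma apd_type:
  assumes "\<Gamma> \<turnstile> a \<Colon> S" "\<Gamma> \<turnstile> b \<Colon> S" "\<Gamma> \<turnstile> p \<Colon> TId S a b"
  shows "\<Gamma> \<turnstile> apd P s a b p \<Colon> TId (inst P b) (transp P a b p (inst s a)) (inst s b)"
  unfolding apd_def using id_elim[OF apd_motive assms]
  by (simp add: sub_transp sigma)

lemma apd_comp:
  assumes "\<Gamma> \<turnstile> a \<Colon> S"
  shows "\<Gamma> \<turnstile> apd P s a a (Refl a) \<doteq>
      Refl (inst s a) \<Colon> TId (inst P a) (transp P a a (Refl a) (inst s a)) (inst s a)"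
  unfolding apd_def using id_comp[OF apd_motive assms]
  by (simp add: sub_transp sigma)

end

context
  fixes \<Gamma> S i X k s
  assumes S: "\<Gamma> \<turnstile> S \<Colon> Univ i" and X: "\<Gamma> \<turnstile> X \<Colon> Univ k" and s: "S # \<Gamma> \<turnstile> s \<Colon> shift 1 X"
begin

lemma ap_motive:
  defines "C \<equiv> TId (shift 3 X) (instw 3 s (Var 2)) (instw 3 s (Var 1))"
  shows "path_ctx S \<Gamma> \<turnstile> C \<Colon> Univ k"
    and "S # \<Gamma> \<turnstile> Refl s \<Colon> instw3 1 C (Var 0) (Var 0) (Refl (Var 0))"
  unfolding C_def using path_ctx_weakening(3,4)[OF S s] path_ctx_weakening(1)[OF S X] id_intro[OF
      weakening1_type[OF S X] s]
  by (auto intro!: id_form simp: sigma)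

lemma ap_type:
  assumes "\<Gamma> \<turnstile> a \<Colon> S" "\<Gamma> \<turnstile> b \<Colon> S" "\<Gamma> \<turnstile> p \<Colon> TId S a b"
  shows "\<Gamma> \<turnstile> ap X s a b p \<Colon> TId X (inst s a) (inst s b)"
  unfolding ap_def using id_elim[OF ap_motive assms] by (simp add: sigma)

lemma ap_comp:
  assumes "\<Gamma> \<turnstile> a \<Colon> S"
  shows "\<Gamma> \<turnstile> ap X s a a (Refl a) \<doteq> Refl (inst s a) \<Colon> TId X (inst s a) (inst s a)"
  unfolding ap_def using id_comp[OF ap_motive assms] by (simp add: sigma)

end

context
  fixes \<Gamma> S i X k u
  assumes S: "\<Gamma> \<turnstile> S \<Colon> Univ i" and X: "\<Gamma> \<turnstile> X \<Colon> Univ k" and u: "\<Gamma> \<turnstile> u \<Colon> X"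
begin

lemma transp_const_type:
  assumes "\<Gamma> \<turnstile> a \<Colon> S" "\<Gamma> \<turnstile> b \<Colon> S" "\<Gamma> \<turnstile> p \<Colon> TId S a b"
  shows "\<Gamma> \<turnstile> transp (shift 1 X) a b p u \<Colon> X"
  using transp_type[OF S weakening1_type[OF S X] assms] u by (simp add: sigma)

lemma transp_const_comp:
  assumes "\<Gamma> \<turnstile> a \<Colon> S"
  shows "\<Gamma> \<turnstile> transp (shift 1 X) a a (Refl a) u \<doteq> u \<Colon> X"
  using transp_comp[OF S weakening1_type[OF S X] assms] u by (simp add: sigma)

end

context
  fixes \<Gamma> S i X k u v
  assumes S: "\<Gamma> \<turnstile> S \<Colon> Univ i" and X: "\<Gamma> \<turnstile> X \<Colon> Univ k" and u: "\<Gamma> \<turnstile> u \<Colon> X" and v: "\<Gamma> \<turnstile> v \<Colon> X"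
begin

lemma theta_motive_type:
  "path_ctx S \<Gamma> \<turnstile> theta_motive X u v \<Colon> Univ k"
  "S # \<Gamma> \<turnstile> Lam (shift 1 (TId X u v)) (Var 0) \<Colon>
      instw3 1 (theta_motive X u v) (Var 0) (Var 0) (Refl (Var 0))"
proof -
  have S3: "path_ctx S \<Gamma> \<turnstile> shift 3 S \<Colon> Univ i"
      using path_ctx_weakening(1)[OF S S] by (simp add: sigma)
  have X3: "path_ctx S \<Gamma> \<turnstile> shift 3 X \<Colon> Univ k"
      using path_ctx_weakening(1)[OF S X] by (simp add: sigma)
  note u3 = path_ctx_weakening(1)[OF S u] note v3 = path_ctx_weakening(1)[OF S v]
  have "path_ctx S \<Gamma> \<turnstile> transp (shift 4 X) (Var 2) (Var 1) (Var 0) (shift 3 u) \<Colon> shift 3 X"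
    using transp_const_type[OF S3 X3 u3 path_ctx_vars[OF S]] by (simp add: shift_shift)
  then show "path_ctx S \<Gamma> \<turnstile> theta_motive X u v \<Colon> Univ k"
    unfolding theta_motive_def using X3 u3 v3
    by (auto intro!: arr_form id_form simp: sigma)
  have S1: "S # \<Gamma> \<turnstile> shift 1 S \<Colon> Univ i" using weakening1_type[OF S S] .
  have X1: "S # \<Gamma> \<turnstile> shift 1 X \<Colon> Univ k" using weakening1_type[OF S X] .
  have u1: "S # \<Gamma> \<turnstile> shift 1 u \<Colon> shift 1 X" using weakening1(1)[OF S u] .
  have v1: "S # \<Gamma> \<turnstile> shift 1 v \<Colon> shift 1 X" using weakening1(1)[OF S v] .
  have I: "S # \<Gamma> \<turnstile> TId (shift 1 X) (shift 1 u) (shift 1 v) \<Colon> Univ k"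
    using id_form[OF X1 u1 v1] .
  have "S # \<Gamma> \<turnstile> transp (shift 2 X) (Var 0) (Var 0) (Refl (Var 0)) (shift 1 u) \<doteq>
      shift 1 u \<Colon> shift 1 X"
    using transp_const_comp[OF S1 X1 u1 var_zero[OF S]] by (simp add: shift_shift numeral_2_eq_2)
  then have "S # \<Gamma> \<turnstile> TId (shift 1 X) (shift 1 u) (shift 1 v) \<doteq>
     TId (shift 1 X) (transp (shift 2 X) (Var 0) (Var 0) (Refl (Var 0)) (shift 1 u)) (shift 1 v) \<Colon>
         Univ k"
    using X1 v1 by (auto intro!: id_form_eq eq_refl intro: eq_sym)
  from conv[OF id_arr[OF I] arr_form_eq[OF I eq_refl[OF I] this]]
  show "S # \<Gamma> \<turnstile> Lam (shift 1 (TId X u v)) (Var 0) \<Colon>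
      instw3 1 (theta_motive X u v) (Var 0) (Var 0) (Refl (Var 0))"
    by (simp add: theta_motive_def sigma sub_arr sub_transp eval_nat_numeral)
qed

lemma theta_type:
  assumes "\<Gamma> \<turnstile> a \<Colon> S" "\<Gamma> \<turnstile> b \<Colon> S" "\<Gamma> \<turnstile> p \<Colon> TId S a b"
  shows "\<Gamma> \<turnstile> theta X u v a b p \<Colon> arr (TId X u v) (TId X (transp (shift 1 X) a b p u) v)"
  unfolding theta_def using id_elim[OF theta_motive_type assms]
  by (simp add: theta_motive_def sub_arr sub_transp sigma eval_nat_numeral)

lemma theta_comp:
  assumes a: "\<Gamma> \<turnstile> a \<Colon> S" and r: "\<Gamma> \<turnstile> r \<Colon> TId X u v"
  shows "\<Gamma> \<turnstile> App (theta X u v a a (Refl a)) r \<doteq> r \<Colon> TId X u v"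
proof -
  have I: "\<Gamma> \<turnstile> TId X u v \<Colon> Univ k" using id_form[OF X u v] .
  have "\<Gamma> \<turnstile> theta X u v a a (Refl a) \<doteq>
      Lam (TId X u v) (Var 0) \<Colon> arr (TId X u v) (TId X (transp (shift 1 X) a a (Refl a) u) v)"
    unfolding theta_def using id_comp[OF theta_motive_type a]
    by (simp add: theta_motive_def sub_arr sub_transp sigma eval_nat_numeral)
  from app_arr_eq[OF this eq_refl[OF r]]
  have "\<Gamma> \<turnstile> App (theta X u v a a (Refl a)) r \<doteq>
      App (Lam (TId X u v) (Var 0)) r \<Colon> TId X (transp (shift 1 X) a a (Refl a) u) v" .
  moreover have "\<Gamma> \<turnstile> TId X (transp (shift 1 X) a a (Refl a) u) v \<doteq> TId X u v \<Colon> Univ k"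
    using transp_const_comp[OF S X u a] X v by (auto intro!: id_form_eq eq_refl)
  ultimately show ?thesis
    using id_beta[OF r I] by (meson eq_conv eq_trans)
qed

end

section \<open>Inverses, concatenation and schematic path induction\<close>

lemma inhabited_transp:
  assumes "\<Gamma> \<turnstile> S \<Colon> Univ i" "S # \<Gamma> \<turnstile> P \<Colon> Univ k" "\<Gamma> \<turnstile> a \<Colon> S" "\<Gamma> \<turnstile> b \<Colon> S"
    and "inhabited \<Gamma> (TId S a b)" "inhabited \<Gamma> (inst P a)"
  shows "inhabited \<Gamma> (inst P b)"
  using transp_type[OF assms(1-4)] assms(5,6) unfolding inhabited_def by blast

lemma path_to_form:
  assumes S: "\<Gamma> \<turnstile> S \<Colon> Univ i" and a: "\<Gamma> \<turnstile> a \<Colon> S"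
  shows "S # \<Gamma> \<turnstile> TId (shift 1 S) (Var 0) (shift 1 a) \<Colon> Univ i"
    and "S # \<Gamma> \<turnstile> TId (shift 1 S) (shift 1 a) (Var 0) \<Colon> Univ i"
  using weakening1_type[OF S S] var_zero[OF S] weakening1(1)[OF S a] by (auto intro: id_form)

text \<open>Transport of \<open>Refl a\<close> in the family of paths into \<open>a\<close>. In
  \<open>inhabited_trans\<close> the family of paths out of \<open>a\<close> plays the same
  part.\<close>

lemma inhabited_sym:
  assumes S: "\<Gamma> \<turnstile> S \<Colon> Univ i" and a: "\<Gamma> \<turnstile> a \<Colon> S" and b: "\<Gamma> \<turnstile> b \<Colon> S" and "inhabited \<Gamma> (TId S a b)"
  shows "inhabited \<Gamma> (TId S b a)"
  using inhabited_transp[OF S path_to_form(1)[OF S a] a b] assms(4) id_intro[OF S a]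
  by (auto simp: sigma inhabited_def)

lemma inhabited_trans:
  assumes S: "\<Gamma> \<turnstile> S \<Colon> Univ i" and a: "\<Gamma> \<turnstile> a \<Colon> S" and b: "\<Gamma> \<turnstile> b \<Colon> S" and c: "\<Gamma> \<turnstile> c \<Colon> S"
    and "inhabited \<Gamma> (TId S a b)" "inhabited \<Gamma> (TId S b c)"
  shows "inhabited \<Gamma> (TId S a c)"
  using inhabited_transp[OF S path_to_form(2)[OF S a] b c] assms(5,6)
  by (simp add: sigma)

lemma inhabited_ap:
  assumes S: "\<Gamma> \<turnstile> S \<Colon> Univ i" and X: "\<Gamma> \<turnstile> X \<Colon> Univ k" and s: "S # \<Gamma> \<turnstile> s \<Colon> shift 1 X"
    and a: "\<Gamma> \<turnstile> a \<Colon> S" and b: "\<Gamma> \<turnstile> b \<Colon> S" and "inhabited \<Gamma> (TId S a b)"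
  shows "inhabited \<Gamma> (TId X (inst s a) (inst s b))"
  using assms(6) ap_type[OF S X s a b] unfolding inhabited_def by blast

text \<open>A schematic J rule for statements uniform in the type and its endpoints. Since
  \<open>T\<close> commutes with substitution, \<open>T\<close> at the three variables of
  \<open>path_ctx\<close> is a legal motive and its instances are again of the form
  \<open>T\<close>, so motives need not be written with de Bruijn indices.\<close>

lemma path_induction:
  assumes sub: "\<And>\<sigma> S a b p. sub \<sigma> (T S a b p) = T (sub \<sigma> S) (sub \<sigma> a) (sub \<sigma> b) (sub \<sigma> p)"
    and form: "\<And>\<Gamma> S a b p. \<Gamma> \<turnstile> S \<Colon> Univ i \<Longrightarrow> \<Gamma> \<turnstile> a \<Colon> S \<Longrightarrow> \<Gamma> \<turnstile> b \<Colon> S \<Longrightarrow> \<Gamma> \<turnstile> p \<Colon> TId S a b \<Longrightarrow>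
      \<Gamma> \<turnstile> T S a b p \<Colon> Univ i"
    and base: "\<And>\<Gamma> S a. \<Gamma> \<turnstile> S \<Colon> Univ i \<Longrightarrow> \<Gamma> \<turnstile> a \<Colon> S \<Longrightarrow> inhabited \<Gamma> (T S a a (Refl a))"
    and S: "\<Gamma> \<turnstile> S \<Colon> Univ i" and a: "\<Gamma> \<turnstile> a \<Colon> S" and b: "\<Gamma> \<turnstile> b \<Colon> S" and p: "\<Gamma> \<turnstile> p \<Colon> TId S a b"
  shows "inhabited \<Gamma> (T S a b p)"
proof -
  have S3: "path_ctx S \<Gamma> \<turnstile> shift 3 S \<Colon> Univ i"
      using path_ctx_weakening(1)[OF S S] by (simp add: sigma)
  have "inhabited \<Gamma> (inst3 (T (shift 3 S) (Var 2) (Var 1) (Var 0)) a b p)"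
    by (rule inhabited_J[OF form[OF S3 path_ctx_vars[OF S]] _ a b p])
      (use base[OF weakening1_type[OF S S] var_zero[OF S]] in \<open>simp add: sub sigma\<close>)
  then show ?thesis by (simp add: sub sigma)
qed

text \<open>Transport in the family of paths out of \<open>a\<close> is concatenation with
  \<open>p\<close> on the right. This evaluates the datum over \<open>Glue\<close> when a suspension
  is contracted to its north pole.\<close>

lemma transp_path_refl:
  assumes S: "\<Gamma> \<turnstile> S \<Colon> Univ i" and a: "\<Gamma> \<turnstile> a \<Colon> S" and b: "\<Gamma> \<turnstile> b \<Colon> S" and p: "\<Gamma> \<turnstile> p \<Colon> TId S a b"
  shows "inhabited \<Gamma> (TId (TId S a b) (transp (TId (shift 1 S) (shift 1 a) (Var 0)) a b p (Refl
      a)) p)"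
proof (rule path_induction[OF _ _ _ S a b p, where T = "\<lambda>S a b p. TId (TId S a b) (transp (TId
    (shift 1 S) (shift 1 a) (Var 0)) a b p (Refl a)) p"])
  fix \<Gamma> S a b p
  assume S: "\<Gamma> \<turnstile> S \<Colon> Univ i" and a: "\<Gamma> \<turnstile> a \<Colon> S"
  note r = id_intro[OF S a]
  show "\<Gamma> \<turnstile> TId (TId S a b) (transp (TId (shift 1 S) (shift 1 a) (Var 0)) a b p (Refl a)) p \<Colon>
      Univ i"
    if b: "\<Gamma> \<turnstile> b \<Colon> S" and p: "\<Gamma> \<turnstile> p \<Colon> TId S a b"
    using transp_type[OF S path_to_form(2)[OF S a] a b p, of "Refl a"] r p id_form[OF S a b]
    by (auto intro!: id_form simp: sigma)
  have "\<Gamma> \<turnstile> transp (TId (shift 1 S) (shift 1 a) (Var 0)) a a (Refl a) (Refl a) \<doteq> Refl a \<Colon> TId S a a"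
    using transp_comp[OF S path_to_form(2)[OF S a] a, of "Refl a"] r by (simp add: sigma)
  from id_form_eq[OF eq_refl[OF id_form[OF S a a]] eq_sym[OF this] eq_refl[OF r]]
  show "inhabited \<Gamma> (TId (TId S a a) (transp (TId (shift 1 S) (shift 1 a) (Var 0)) a a (Refl a)
      (Refl a)) (Refl a))"
    using conv[OF id_intro[OF id_form[OF S a a] r]] unfolding inhabited_def by blast
qed (simp add: sigma sub_transp)

section \<open>Canonical paths in contractible types\<close>

text \<open>
  The path from \<open>a\<close> to \<open>b\<close> through the center \<open>c\<close>, written as a single transport.
\<close>

definition cpath :: "tm \<Rightarrow> tm \<Rightarrow> tm \<Rightarrow> tm \<Rightarrow> tm \<Rightarrow> tm" where
  "cpath S c k a b = transp (TId (shift 1 S) (Var 0) (shift 1 b)) c a (App k a) (App k b)"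

definition contraction :: "tm \<Rightarrow> tm \<Rightarrow> tm" where
  "contraction S c = Pi S (TId (shift 1 S) (shift 1 c) (Var 0))"

lemma sub_cpath: "sub \<sigma> (cpath S c k a b) = cpath (sub \<sigma> S) (sub \<sigma> c) (sub \<sigma> k) (sub \<sigma> a) (sub \<sigma> b)"
  by (simp add: cpath_def sub_transp sigma)

lemma sub_contraction: "sub \<sigma> (contraction S c) = contraction (sub \<sigma> S) (sub \<sigma> c)"
  by (simp add: contraction_def sigma)

lemma contraction_app:
  "\<Gamma> \<turnstile> k \<Colon> contraction S c \<Longrightarrow> \<Gamma> \<turnstile> a \<Colon> S \<Longrightarrow> \<Gamma> \<turnstile> App k a \<Colon> TId S c a"
  unfolding contraction_def by (drule (1) pi_elim) (simp add: sigma)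

lemma cpath_type:
  assumes S: "\<Gamma> \<turnstile> S \<Colon> Univ i" and c: "\<Gamma> \<turnstile> c \<Colon> S" and k: "\<Gamma> \<turnstile> k \<Colon> contraction S c"
    and a: "\<Gamma> \<turnstile> a \<Colon> S" and b: "\<Gamma> \<turnstile> b \<Colon> S"
  shows "\<Gamma> \<turnstile> cpath S c k a b \<Colon> TId S a b"
  unfolding cpath_def
  using transp_type[OF S path_to_form(1)[OF S b] c a contraction_app[OF k a], of "App k b"]
      contraction_app[OF k b]
  by (simp add: sigma)

text \<open>The transport is the inverse of \<open>p\<close> followed by \<open>p\<close>. This is
  the base case of \<open>cpath_unique\<close>, with \<open>p\<close> the contraction path to the
  given point.\<close>

lemma transp_path_self:
  assumes S: "\<Gamma> \<turnstile> S \<Colon> Univ i" and a: "\<Gamma> \<turnstile> a \<Colon> S" and b: "\<Gamma> \<turnstile> b \<Colon> S" and p: "\<Gamma> \<turnstile> p \<Colon> TId S a b"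
  shows "inhabited \<Gamma> (TId (TId S b b) (transp (TId (shift 1 S) (Var 0) (shift 1 b)) a b p p) (Refl
      b))"
proof (rule path_induction[OF _ _ _ S a b p, where T = "\<lambda>S a b p. TId (TId S b b) (transp (TId
    (shift 1 S) (Var 0) (shift 1 b)) a b p p) (Refl b)"])
  fix \<Gamma> S a b p
  assume S: "\<Gamma> \<turnstile> S \<Colon> Univ i" and a: "\<Gamma> \<turnstile> a \<Colon> S"
  note r = id_intro[OF S a]
  show "\<Gamma> \<turnstile> TId (TId S b b) (transp (TId (shift 1 S) (Var 0) (shift 1 b)) a b p p) (Refl b) \<Colon>
      Univ i"
    if b: "\<Gamma> \<turnstile> b \<Colon> S" and p: "\<Gamma> \<turnstile> p \<Colon> TId S a b"
    using transp_type[OF S path_to_form(1)[OF S b] a b p, of p] id_intro[OF S b] p id_form[OF S b b]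
    by (auto intro!: id_form simp: sigma)
  have "\<Gamma> \<turnstile> transp (TId (shift 1 S) (Var 0) (shift 1 a)) a a (Refl a) (Refl a) \<doteq> Refl a \<Colon> TId S a a"
    using transp_comp[OF S path_to_form(1)[OF S a] a, of "Refl a"] r by (simp add: sigma)
  from id_form_eq[OF eq_refl[OF id_form[OF S a a]] eq_sym[OF this] eq_refl[OF r]]
  show "inhabited \<Gamma> (TId (TId S a a) (transp (TId (shift 1 S) (Var 0) (shift 1 a)) a a (Refl a)
      (Refl a)) (Refl a))"
    using conv[OF id_intro[OF id_form[OF S a a] r]] unfolding inhabited_def by blast
qed (simp add: sigma sub_transp)

text \<open>Induction on \<open>p\<close> with both ends free: at reflexivity the canonical path is
  the contraction path transported along itself, which \<open>transp_path_self\<close> identifies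
  with reflexivity.\<close>

lemma cpath_unique:
  assumes S: "\<Gamma> \<turnstile> S \<Colon> Univ i" and c: "\<Gamma> \<turnstile> c \<Colon> S" and k: "\<Gamma> \<turnstile> k \<Colon> contraction S c"
    and a: "\<Gamma> \<turnstile> a \<Colon> S" and b: "\<Gamma> \<turnstile> b \<Colon> S" and p: "\<Gamma> \<turnstile> p \<Colon> TId S a b"
  shows "inhabited \<Gamma> (TId (TId S a b) (cpath S c k a b) p)"
proof -
  have S3: "path_ctx S \<Gamma> \<turnstile> shift 3 S \<Colon> Univ i"
      using path_ctx_weakening(1)[OF S S] by (simp add: sigma)
  have k3: "path_ctx S \<Gamma> \<turnstile> shift 3 k \<Colon> contraction (shift 3 S) (shift 3 c)"
    using path_ctx_weakening(1)[OF S k] by (simp add: sigma sub_contraction)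
  have k1: "S # \<Gamma> \<turnstile> shift 1 k \<Colon> contraction (shift 1 S) (shift 1 c)"
    using weakening1(1)[OF S k] by (simp add: sigma sub_contraction)
  note S1 = weakening1_type[OF S S] and c1 = weakening1(1)[OF S c] and v = var_zero[OF S]
  have "path_ctx S \<Gamma> \<turnstile> TId (TId (shift 3 S) (Var 2) (Var 1)) (cpath (shift 3 S) (shift 3 c) (shift
      3 k) (Var 2) (Var 1)) (Var 0) \<Colon> Univ i"
    using cpath_type[OF S3 path_ctx_weakening(1)[OF S c] k3 path_ctx_vars(1,2)[OF S]]
        path_ctx_vars[OF S] id_form[OF S3 path_ctx_vars(1,2)[OF S]]
    by (auto intro: id_form)
  from inhabited_J[OF this _ a b p]
  show ?thesis
    using transp_path_self[OF S1 c1 v contraction_app[OF k1 v]]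
    by (simp add: sub_cpath sigma) (simp add: cpath_def sigma)
qed

section \<open>From \<open>apd\<close> in a constant family to \<open>ap\<close>\<close>

text \<open>
  The computation rule of suspension recursion identifies \<open>apd\<close> of the recursor with \<open>theta\<close> of the
  given path.  Phrased for all paths \<open>p\<close> and \<open>r\<close>, the step from there to \<open>ap p = r\<close> is a path
  induction whose base case is an identity function.
\<close>

definition apd_theta :: "tm \<Rightarrow> tm \<Rightarrow> tm \<Rightarrow> tm \<Rightarrow> tm \<Rightarrow> tm \<Rightarrow> tm" where
  "apd_theta X s a b p r = TId (TId X (transp (shift 1 X) a b p (inst s a)) (inst s b))
     (apd (shift 1 X) s a b p) (App (theta X (inst s a) (inst s b) a b p) r)"

definition ap_criterion :: "tm \<Rightarrow> tm \<Rightarrow> tm \<Rightarrow> tm \<Rightarrow> tm \<Rightarrow> tm" where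
  "ap_criterion X s a b p = Pi (TId X (inst s a) (inst s b))
     (arr (apd_theta (shift 1 X) (shift_under 1 s) (shift 1 a) (shift 1 b) (shift 1 p) (Var 0))
          (TId (shift 1 (TId X (inst s a) (inst s b))) (shift 1 (ap X s a b p)) (Var 0)))"

lemma sub_apd_theta: "sub \<sigma> (apd_theta X s a b p r) =
   apd_theta (sub \<sigma> X) (sub (up \<sigma>) s) (sub \<sigma> a) (sub \<sigma> b) (sub \<sigma> p) (sub \<sigma> r)"
  by (simp add: apd_theta_def sub_apd sub_theta sub_transp sigma)

lemma sub_ap_criterion: "sub \<sigma> (ap_criterion X s a b p) =
   ap_criterion (sub \<sigma> X) (sub (up \<sigma>) s) (sub \<sigma> a) (sub \<sigma> b) (sub \<sigma> p)"
  by (simp add: ap_criterion_def sub_apd_theta sub_ap sub_arr sigma)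

lemma apd_theta_form:
  assumes S: "\<Gamma> \<turnstile> S \<Colon> Univ i" and X: "\<Gamma> \<turnstile> X \<Colon> Univ k" and s: "S # \<Gamma> \<turnstile> s \<Colon> shift 1 X"
    and a: "\<Gamma> \<turnstile> a \<Colon> S" and b: "\<Gamma> \<turnstile> b \<Colon> S" and p: "\<Gamma> \<turnstile> p \<Colon> TId S a b"
    and r: "\<Gamma> \<turnstile> r \<Colon> TId X (inst s a) (inst s b)"
  shows "\<Gamma> \<turnstile> apd_theta X s a b p r \<Colon> Univ k"
proof -
  have sa: "\<Gamma> \<turnstile> inst s a \<Colon> X" and sb: "\<Gamma> \<turnstile> inst s b \<Colon> X"
    using subst1(1)[OF a s] subst1(1)[OF b s] by (simp_all add: sigma)
  show ?thesis unfolding apd_theta_def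
  proof (intro id_form X sb)
    show "\<Gamma> \<turnstile> transp (shift 1 X) a b p (inst s a) \<Colon> X"
      using transp_const_type[OF S X sa a b p] .
    show "\<Gamma> \<turnstile> apd (shift 1 X) s a b p \<Colon> TId X (transp (shift 1 X) a b p (inst s a)) (inst s b)"
      using apd_type[OF S weakening1_type[OF S X] s a b p] by (simp add: sigma)
    show "\<Gamma> \<turnstile> App (theta X (inst s a) (inst s b) a b p) r \<Colon>
        TId X (transp (shift 1 X) a b p (inst s a)) (inst s b)"
      by (rule app_arr[OF theta_type[OF S X sa sb a b p] r])
  qed
qed

lemma ap_criterion_form:
  assumes S: "\<Gamma> \<turnstile> S \<Colon> Univ i" and X: "\<Gamma> \<turnstile> X \<Colon> Univ k" and s: "S # \<Gamma> \<turnstile> s \<Colon> shift 1 X"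
    and a: "\<Gamma> \<turnstile> a \<Colon> S" and b: "\<Gamma> \<turnstile> b \<Colon> S" and p: "\<Gamma> \<turnstile> p \<Colon> TId S a b"
  shows "\<Gamma> \<turnstile> ap_criterion X s a b p \<Colon> Univ k"
proof -
  have sa: "\<Gamma> \<turnstile> inst s a \<Colon> X" and sb: "\<Gamma> \<turnstile> inst s b \<Colon> X"
    using subst1(1)[OF a s] subst1(1)[OF b s] by (simp_all add: sigma)
  let ?I = "TId X (inst s a) (inst s b)"
  have I: "\<Gamma> \<turnstile> ?I \<Colon> Univ k" using id_form[OF X sa sb] .
  note w = weakening1(1)[OF I]
  have S1: "?I # \<Gamma> \<turnstile> shift 1 S \<Colon> Univ i" and X1: "?I # \<Gamma> \<turnstile> shift 1 X \<Colon> Univ k"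
    using weakening1_type[OF I] S X by blast+
  have s1: "shift 1 S # ?I # \<Gamma> \<turnstile> shift_under 1 s \<Colon> shift 1 (shift 1 X)"
    using weakening1_under[OF I s] by (simp add: sigma)
  have p1: "?I # \<Gamma> \<turnstile> shift 1 p \<Colon> TId (shift 1 S) (shift 1 a) (shift 1 b)"
    using w[OF p] by (simp add: sigma)
  have "?I # \<Gamma> \<turnstile> apd_theta (shift 1 X) (shift_under 1 s) (shift 1 a) (shift 1 b) (shift 1 p) (Var
      0) \<Colon> Univ k"
    by (rule apd_theta_form[OF S1 X1 s1 w[OF a] w[OF b] p1]) (use var_zero[OF I] in \<open>simp add:
        sigma\<close>)
  moreover have "?I # \<Gamma> \<turnstile> TId (shift 1 ?I) (shift 1 (ap X s a b p)) (Var 0) \<Colon> Univ k"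
    using id_form[OF weakening1_type[OF I I] w[OF ap_type[OF S X s a b p]] var_zero[OF I]] .
  ultimately show ?thesis
    unfolding ap_criterion_def using I by (intro pi_form arr_form)
qed

text \<open>At reflexivity \<open>apd\<close> and \<open>ap\<close> become reflexivity and
  \<open>theta\<close> becomes the identity, all judgementally. Hypothesis and conclusion of the
  implication are then the same type up to conversion.\<close>

lemma ap_criterion_refl:
  assumes S: "\<Gamma> \<turnstile> S \<Colon> Univ i" and X: "\<Gamma> \<turnstile> X \<Colon> Univ k" and s: "S # \<Gamma> \<turnstile> s \<Colon> shift 1 X"
    and a: "\<Gamma> \<turnstile> a \<Colon> S"
  shows "inhabited \<Gamma> (ap_criterion X s a a (Refl a))"
proof -
  have sa: "\<Gamma> \<turnstile> inst s a \<Colon> X"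
    using subst1(1)[OF a s] by (simp add: sigma)
  let ?I = "TId X (inst s a) (inst s a)"
  have I: "\<Gamma> \<turnstile> ?I \<Colon> Univ k" using id_form[OF X sa sa] .
  note w = weakening1(1)[OF I]
  have S1: "?I # \<Gamma> \<turnstile> shift 1 S \<Colon> Univ i" and X1: "?I # \<Gamma> \<turnstile> shift 1 X \<Colon> Univ k"
      and I1: "?I # \<Gamma> \<turnstile> shift 1 ?I \<Colon> Univ k"
    using weakening1_type[OF I] S X I by blast+
  have s1: "shift 1 S # ?I # \<Gamma> \<turnstile> shift_under 1 s \<Colon> shift 1 (shift 1 X)"
    using weakening1_under[OF I s] by (simp add: sigma)
  note a1 = w[OF a]
  have sa1: "?I # \<Gamma> \<turnstile> inst (shift_under 1 s) (shift 1 a) \<Colon> shift 1 X"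
    using w[OF sa] by (simp add: sigma)
  have I1_eq: "shift 1 ?I = TId (shift 1 X) (inst (shift_under 1 s) (shift 1 a)) (inst
      (shift_under 1 s) (shift 1 a))"
    by (simp add: sigma)
  note v = var_zero[OF I]
  \<comment> \<open>The common form to which both sides of the implication reduce: reflexivity
    equals the quantified path, which is \<open>Var 0\<close>.\<close>
  let ?D = "TId (shift 1 ?I) (Refl (inst (shift_under 1 s) (shift 1 a))) (Var 0)"
  have r: "?I # \<Gamma> \<turnstile> Refl (inst (shift_under 1 s) (shift 1 a)) \<Colon> shift 1 ?I"
    unfolding I1_eq using id_intro[OF X1 sa1] .
  have D: "?I # \<Gamma> \<turnstile> ?D \<Colon> Univ k"
    using id_form[OF I1 r v] .
  have "?I # \<Gamma> \<turnstile> apd_theta (shift 1 X) (shift_under 1 s) (shift 1 a) (shift 1 a) (Refl (shift 1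
      a)) (Var 0) \<doteq> ?D \<Colon> Univ k"
    unfolding apd_theta_def
  proof (rule id_form_eq)
    show t: "?I # \<Gamma> \<turnstile> TId (shift 1 X) (transp (shift 1 (shift 1 X)) (shift 1 a) (shift 1 a) (Refl
        (shift 1 a)) (inst (shift_under 1 s) (shift 1 a))) (inst (shift_under 1 s) (shift 1 a)) \<doteq>
            shift 1 ?I \<Colon> Univ k"
      unfolding I1_eq using transp_const_comp[OF S1 X1 sa1 a1] X1 sa1
      by (intro id_form_eq eq_refl)
    show "?I # \<Gamma> \<turnstile> apd (shift 1 (shift 1 X)) (shift_under 1 s) (shift 1 a) (shift 1 a) (Refl
        (shift 1 a)) \<doteq> Refl (inst (shift_under 1 s) (shift 1 a)) \<Colon>
       TId (shift 1 X) (transp (shift 1 (shift 1 X)) (shift 1 a) (shift 1 a) (Refl (shift 1 a))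
           (inst (shift_under 1 s) (shift 1 a))) (inst (shift_under 1 s) (shift 1 a))"
      using apd_comp[OF S1 weakening1_type[OF S1 X1] s1 a1] by (simp add: sigma)
    show "?I # \<Gamma> \<turnstile> App (theta (shift 1 X) (inst (shift_under 1 s) (shift 1 a)) (inst (shift_under
        1 s) (shift 1 a)) (shift 1 a) (shift 1 a) (Refl (shift 1 a))) (Var 0) \<doteq> Var 0 \<Colon>
       TId (shift 1 X) (transp (shift 1 (shift 1 X)) (shift 1 a) (shift 1 a) (Refl (shift 1 a))
           (inst (shift_under 1 s) (shift 1 a))) (inst (shift_under 1 s) (shift 1 a))"
      using eq_conv[OF theta_comp[OF S1 X1 sa1 sa1 a1 v[unfolded I1_eq]] eq_sym[OF t[unfolded
          I1_eq]]] .
  qed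
  moreover have "?I # \<Gamma> \<turnstile> TId (shift 1 ?I) (shift 1 (ap X s a a (Refl a))) (Var 0) \<doteq> ?D \<Colon> Univ k"
    using id_form_eq[OF eq_refl[OF I1] weakening1(2)[OF I ap_comp[OF S X s a]] eq_refl[OF v]]
    by (simp add: sigma)
  ultimately have "?I # \<Gamma> \<turnstile> arr ?D ?D \<doteq>
      arr (apd_theta (shift 1 X) (shift_under 1 s) (shift 1 a) (shift 1 a) (Refl (shift 1 a)) (Var
          0))
     (TId (shift 1 ?I) (shift 1 (ap X s a a (Refl a))) (Var 0)) \<Colon> Univ k"
    using arr_form_eq[OF D] eq_sym by blast
  from pi_intro[OF conv[OF id_arr[OF D] this]]
  show ?thesis unfolding ap_criterion_def inhabited_def by (auto simp: shift_def)
qed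

lemma ap_criterion_inhabited:
  assumes S: "\<Gamma> \<turnstile> S \<Colon> Univ i" and X: "\<Gamma> \<turnstile> X \<Colon> Univ k" and s: "S # \<Gamma> \<turnstile> s \<Colon> shift 1 X"
    and a: "\<Gamma> \<turnstile> a \<Colon> S" and b: "\<Gamma> \<turnstile> b \<Colon> S" and p: "\<Gamma> \<turnstile> p \<Colon> TId S a b"
  shows "inhabited \<Gamma> (ap_criterion X s a b p)"
proof -
  have S3: "path_ctx S \<Gamma> \<turnstile> shift 3 S \<Colon> Univ i"
      using path_ctx_weakening(1)[OF S S] by (simp add: sigma)
  have X3: "path_ctx S \<Gamma> \<turnstile> shift 3 X \<Colon> Univ k"
      using path_ctx_weakening(1)[OF S X] by (simp add: sigma)
  have s3: "shift 3 S # path_ctx S \<Gamma> \<turnstile> shift_under 3 s \<Colon> shift 1 (shift 3 X)"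
    using path_ctx_weakening(2)[OF S s] by (simp add: sigma)
  have s1: "shift 1 S # S # \<Gamma> \<turnstile> shift_under 1 s \<Colon> shift 1 (shift 1 X)"
    using weakening1_under[OF S s] by (simp add: sigma)
  have "inhabited \<Gamma> (inst3 (ap_criterion (shift 3 X) (shift_under 3 s) (Var 2) (Var 1) (Var 0)) a
      b p)"
    by (rule inhabited_J[OF ap_criterion_form[OF S3 X3 s3 path_ctx_vars[OF S]] _ a b p])
      (use ap_criterion_refl[OF weakening1_type[OF S S] weakening1_type[OF S X] s1 var_zero[OF S]]
          in \<open>simp add: sub_ap_criterion sigma\<close>)
  then show ?thesis by (simp add: sub_ap_criterion sigma)
qed

lemma ap_eqI:
  assumes S: "\<Gamma> \<turnstile> S \<Colon> Univ i" and X: "\<Gamma> \<turnstile> X \<Colon> Univ k" and s: "S # \<Gamma> \<turnstile> s \<Colon> shift 1 X"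
    and a: "\<Gamma> \<turnstile> a \<Colon> S" and b: "\<Gamma> \<turnstile> b \<Colon> S" and p: "\<Gamma> \<turnstile> p \<Colon> TId S a b"
    and r: "\<Gamma> \<turnstile> r \<Colon> TId X (inst s a) (inst s b)" and "inhabited \<Gamma> (apd_theta X s a b p r)"
  shows "inhabited \<Gamma> (TId (TId X (inst s a) (inst s b)) (ap X s a b p) r)"
proof -
  obtain t u where t: "\<Gamma> \<turnstile> t \<Colon> ap_criterion X s a b p" and u: "\<Gamma> \<turnstile> u \<Colon> apd_theta X s a b p r"
    using ap_criterion_inhabited[OF S X s a b p] assms(8) unfolding inhabited_def by blast
  have "\<Gamma> \<turnstile> App t r \<Colon> arr (apd_theta X s a b p r) (TId (TId X (inst s a) (inst s b)) (ap X s a b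
      p) r)"
    using pi_elim[OF t[unfolded ap_criterion_def] r]
    by (simp add: sub_apd_theta sub_ap sub_arr sigma)
  from app_arr[OF this u] show ?thesis unfolding inhabited_def by blast
qed

text \<open>The decisive exchange: \<open>p\<close> is replaced by the canonical path, since
  \<open>cpath_unique\<close> identifies them and \<open>ap\<close> respects identifications of
  paths. Afterwards the left side no longer mentions \<open>p\<close>, so its value cannot depend on
  which path was used.\<close>

lemma cpath_ap_unique:
  assumes S: "\<Gamma> \<turnstile> S \<Colon> Univ i" and X: "\<Gamma> \<turnstile> X \<Colon> Univ k" and s: "S # \<Gamma> \<turnstile> s \<Colon> shift 1 X"
    and c: "\<Gamma> \<turnstile> c \<Colon> S" and k: "\<Gamma> \<turnstile> h \<Colon> contraction S c"
    and a: "\<Gamma> \<turnstile> a \<Colon> S" and b: "\<Gamma> \<turnstile> b \<Colon> S" and p: "\<Gamma> \<turnstile> p \<Colon> TId S a b"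
    and r: "\<Gamma> \<turnstile> r \<Colon> TId X (inst s a) (inst s b)" and "inhabited \<Gamma> (apd_theta X s a b p r)"
  shows "inhabited \<Gamma> (TId (TId X (inst s a) (inst s b)) (ap X s a b (cpath S c h a b)) r)"
proof -
  have sa: "\<Gamma> \<turnstile> inst s a \<Colon> X" and sb: "\<Gamma> \<turnstile> inst s b \<Colon> X"
    using subst1(1)[OF a s] subst1(1)[OF b s] by (simp_all add: sigma)
  let ?E = "TId S a b" and ?e = "cpath S c h a b"
  have E: "\<Gamma> \<turnstile> ?E \<Colon> Univ i" using id_form[OF S a b] .
  have I: "\<Gamma> \<turnstile> TId X (inst s a) (inst s b) \<Colon> Univ k" using id_form[OF X sa sb] .
  note e = cpath_type[OF S c k a b]
  have s1: "shift 1 S # ?E # \<Gamma> \<turnstile> shift_under 1 s \<Colon> shift 1 (shift 1 X)"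
    using weakening1_under[OF E s] by (simp add: sigma)
  note w = weakening1(1)[OF E]
  have v: "?E # \<Gamma> \<turnstile> Var 0 \<Colon> TId (shift 1 S) (shift 1 a) (shift 1 b)"
    using var_zero[OF E] by (simp add: sigma)
  \<comment> \<open>The action on paths is turned into an open term in a path variable, so that
    \<open>inhabited_ap\<close> can be applied one dimension up.\<close>
  have "?E # \<Gamma> \<turnstile> ap (shift 1 X) (shift_under 1 s) (shift 1 a) (shift 1 b) (Var 0) \<Colon>
      shift 1 (TId X (inst s a) (inst s b))"
    using ap_type[OF weakening1_type[OF E S] weakening1_type[OF E X] s1 w[OF a] w[OF b] v]
        by (simp add: sigma)
  from inhabited_ap[OF E I this e p cpath_unique[OF S c k a b p]]
  have "inhabited \<Gamma> (TId (TId X (inst s a) (inst s b)) (ap X s a b ?e) (ap X s a b p))"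
    by (simp add: sub_ap sigma)
  from inhabited_trans[OF I ap_type[OF S X s a b e] ap_type[OF S X s a b p] r this ap_eqI[OF S X s
      a b p r assms(10)]]
  show ?thesis .
qed

section \<open>Suspensions\<close>

lemma fst_type:
  assumes S: "\<Gamma> \<turnstile> S \<Colon> Univ i" and Q: "S # \<Gamma> \<turnstile> Q \<Colon> Univ i"
  shows "\<Gamma> \<turnstile> h \<Colon> Sig S Q \<Longrightarrow> \<Gamma> \<turnstile> IndSig (shift 1 S) (Var 1) h \<Colon> S"
    and "\<Gamma> \<turnstile> a \<Colon> S \<Longrightarrow> \<Gamma> \<turnstile> b \<Colon> inst Q a \<Longrightarrow> \<Gamma> \<turnstile> IndSig (shift 1 S) (Var 1) (Pr a b) \<doteq> a \<Colon> S"
proof -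
  have C: "Sig S Q # \<Gamma> \<turnstile> shift 1 S \<Colon> Univ i"
    using weakening1_type[OF sig_form[OF S Q] S] .
  have v: "Q # S # \<Gamma> \<turnstile> Var 1 \<Colon> instw 2 (shift 1 S) (Pr (Var 1) (Var 0))"
    by (rule var_typing[OF ctx_ext[OF Q]]) (simp_all add: sigma)
  show "\<Gamma> \<turnstile> h \<Colon> Sig S Q \<Longrightarrow> \<Gamma> \<turnstile> IndSig (shift 1 S) (Var 1) h \<Colon> S"
    using sig_elim[OF C v] by (simp add: sigma)
  show "\<Gamma> \<turnstile> a \<Colon> S \<Longrightarrow> \<Gamma> \<turnstile> b \<Colon> inst Q a \<Longrightarrow> \<Gamma> \<turnstile> IndSig (shift 1 S) (Var 1) (Pr a b) \<doteq> a \<Colon> S"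
    using sig_comp[OF C v] by (simp add: sigma)
qed

lemma contraction_form: "\<Gamma> \<turnstile> S \<Colon> Univ i \<Longrightarrow> \<Gamma> \<turnstile> c \<Colon> S \<Longrightarrow> \<Gamma> \<turnstile> contraction S c \<Colon> Univ i"
  unfolding contraction_def by (intro pi_form path_to_form(2))

lemma contraction_form_eq:
  assumes S: "\<Gamma> \<turnstile> S \<Colon> Univ i" and c: "\<Gamma> \<turnstile> c \<doteq> d \<Colon> S"
  shows "\<Gamma> \<turnstile> contraction S c \<doteq> contraction S d \<Colon> Univ i"
  unfolding contraction_def
  using weakening1_type[OF S S] weakening1(2)[OF S c] var_zero[OF S] S
  by (intro pi_form_eq id_form_eq eq_refl)

lemma is_contr_contraction: "is_contr S = Sig S (contraction (shift 1 S) (Var 0))"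
  by (simp add: is_contr_def contraction_def sigma)

text \<open>The center and its contraction are the two projections, written with
  \<open>IndSig\<close>; the type of the second mentions the first, which is why its motive contains
  another \<open>IndSig\<close>.\<close>

lemma contr_elim:
  assumes S: "\<Gamma> \<turnstile> S \<Colon> Univ i" and h: "\<Gamma> \<turnstile> h \<Colon> is_contr S"
  obtains c k where "\<Gamma> \<turnstile> c \<Colon> S" "\<Gamma> \<turnstile> k \<Colon> contraction S c"
proof -
  let ?Q = "contraction (shift 1 S) (Var 0)" and ?H = "is_contr S"
  note S1 = weakening1_type[OF S S]
  have Q: "S # \<Gamma> \<turnstile> ?Q \<Colon> Univ i" using contraction_form[OF S1 var_zero[OF S]] .
  have H: "\<Gamma> \<turnstile> ?H \<Colon> Univ i" unfolding is_contr_contraction using sig_form[OF S Q] .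
  have SH: "?H # \<Gamma> \<turnstile> shift 1 S \<Colon> Univ i" using weakening1_type[OF H S] .
  have QH: "shift 1 S # ?H # \<Gamma> \<turnstile> contraction (shift 2 S) (Var 0) \<Colon> Univ i"
    using weakening1_under[OF H Q] by (simp add: sub_contraction sigma)
  have "?H # \<Gamma> \<turnstile> IndSig (shift 2 S) (Var 1) (Var 0) \<Colon> shift 1 S"
    using fst_type(1)[OF SH QH] var_zero[OF H]
        by (simp add: is_contr_contraction sub_contraction sigma)
  from contraction_form[OF SH this]
  have C: "?H # \<Gamma> \<turnstile> contraction (shift 1 S) (IndSig (shift 2 S) (Var 1) (Var 0)) \<Colon> Univ i" .
  have ctx: "\<turnstile> ?Q # S # \<Gamma> ctx" using Q by (rule ctx_ext)
  have S2: "?Q # S # \<Gamma> \<turnstile> shift 2 S \<Colon> Univ i" using weakening1_type[OF Q S1] by (simp add: sigma)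
  have Q2: "shift 2 S # ?Q # S # \<Gamma> \<turnstile> contraction (shift 3 S) (Var 0) \<Colon> Univ i"
    using contraction_form[OF weakening1_type[OF S2 S2] var_zero[OF S2]] by (simp add: sigma)
  \<comment> \<open>On the generic pair the first projection computes to \<open>Var 1\<close>;
    converting along this equation gives the second component the type demanded by the
    motive.\<close>
  have "?Q # S # \<Gamma> \<turnstile> IndSig (shift 3 S) (Var 1) (Pr (Var 1) (Var 0)) \<doteq> Var 1 \<Colon> shift 2 S"
    using fst_type(2)[OF S2 Q2, of "Var 1" "Var 0"] var_typing[OF ctx, of 0] var_typing[OF ctx, of
        1]
    by (simp add: sub_contraction sigma)
  from contraction_form_eq[OF S2 eq_sym[OF this]]
  have "?Q # S # \<Gamma> \<turnstile> Var 0 \<Colon>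
      instw 2 (contraction (shift 1 S) (IndSig (shift 2 S) (Var 1) (Var 0))) (Pr (Var 1) (Var 0))"
    using conv[OF var_typing[OF ctx, of 0]] by (simp add: sub_contraction sigma)
  from sig_elim[OF C[unfolded is_contr_contraction] this h[unfolded is_contr_contraction]]
  have "\<Gamma> \<turnstile> IndSig (contraction (shift 1 S) (IndSig (shift 2 S) (Var 1) (Var 0))) (Var 0) h \<Colon>
      contraction S (IndSig (shift 1 S) (Var 1) h)"
    by (simp add: sub_contraction sigma)
  moreover have "\<Gamma> \<turnstile> IndSig (shift 1 S) (Var 1) h \<Colon> S"
    using fst_type(1)[OF S Q] h by (simp add: is_contr_contraction)
  ultimately show thesis using that by blast
qed

section \<open>Poles, glue and recursion for suspensions\<close>

lemma sub_susp: "sub \<sigma> (susp A) = susp (sub \<sigma> A)"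
  by (simp add: susp_def)

lemma const_Star:
  assumes A: "\<Gamma> \<turnstile> A \<Colon> Univ i"
  shows "\<Gamma> \<turnstile> Lam A Star \<Colon> arr A TUnit"
    and "\<Gamma> \<turnstile> a \<Colon> A \<Longrightarrow> \<Gamma> \<turnstile> App (Lam A Star) a \<doteq> Star \<Colon> TUnit"
proof -
  have "A # \<Gamma> \<turnstile> Star \<Colon> shift 1 TUnit"
    using unit_intro[OF ctx_ext[OF A]] by (simp add: sigma)
  then show "\<Gamma> \<turnstile> Lam A Star \<Colon> arr A TUnit" "\<Gamma> \<turnstile> a \<Colon> A \<Longrightarrow> \<Gamma> \<turnstile> App (Lam A Star) a \<doteq> Star \<Colon> TUnit"
    using lam_arr beta_arr[of A \<Gamma> Star TUnit a] by (simp_all add: sigma)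
qed

lemma susp_form: "\<Gamma> \<turnstile> A \<Colon> Univ i \<Longrightarrow> \<Gamma> \<turnstile> susp A \<Colon> Univ i"
  unfolding susp_def by (intro push_form const_Star(1) unit_form) (auto dest: typing_ctx)

lemma susp_poles:
  assumes A: "\<Gamma> \<turnstile> A \<Colon> Univ i"
  shows "\<Gamma> \<turnstile> u \<Colon> TUnit \<Longrightarrow> \<Gamma> \<turnstile> PInl u \<Colon> susp A" and "\<Gamma> \<turnstile> u \<Colon> TUnit \<Longrightarrow> \<Gamma> \<turnstile> PInr u \<Colon> susp A"
    and "\<Gamma> \<turnstile> u \<doteq> v \<Colon> TUnit \<Longrightarrow> \<Gamma> \<turnstile> PInl u \<doteq> PInl v \<Colon> susp A"
    and "\<Gamma> \<turnstile> u \<doteq> v \<Colon> TUnit \<Longrightarrow> \<Gamma> \<turnstile> PInr u \<doteq> PInr v \<Colon> susp A"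
  using susp_form[OF A] unfolding susp_def
  by (auto intro: push_intro1 push_intro2 push_intro1_eq push_intro2_eq)

text \<open>The ends of \<open>Glue a\<close> exactly as the pushout rules produce them. They
  contain \<open>a\<close> syntactically, although they are judgementally the poles at
  \<open>Star\<close>.\<close>

abbreviation north where "north A a \<equiv> PInl (App (Lam A Star) a)"
abbreviation south where "south A a \<equiv> PInr (App (Lam A Star) a)"

lemma susp_glue:
  assumes A: "\<Gamma> \<turnstile> A \<Colon> Univ i" and a: "\<Gamma> \<turnstile> a \<Colon> A"
  shows "\<Gamma> \<turnstile> north A a \<Colon> susp A" "\<Gamma> \<turnstile> south A a \<Colon> susp A"
    and "\<Gamma> \<turnstile> north A a \<doteq> PInl Star \<Colon> susp A" "\<Gamma> \<turnstile> south A a \<doteq> PInr Star \<Colon> susp A"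
    and "\<Gamma> \<turnstile> Glue a \<Colon> TId (susp A) (north A a) (south A a)"
    and "\<Gamma> \<turnstile> Glue a \<Colon> TId (susp A) (PInl Star) (PInr Star)"
proof -
  show 1: "\<Gamma> \<turnstile> north A a \<doteq> PInl Star \<Colon> susp A" "\<Gamma> \<turnstile> south A a \<doteq> PInr Star \<Colon> susp A"
    using susp_poles(3,4)[OF A const_Star(2)[OF A a]] .
  show "\<Gamma> \<turnstile> north A a \<Colon> susp A" "\<Gamma> \<turnstile> south A a \<Colon> susp A"
    using susp_poles(1,2)[OF A app_arr[OF const_Star(1)[OF A] a]] .
  show 2: "\<Gamma> \<turnstile> Glue a \<Colon> TId (susp A) (north A a) (south A a)"
    using push_glue[OF susp_form[OF A, unfolded susp_def] a] by (simp add: susp_def)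
  show "\<Gamma> \<turnstile> Glue a \<Colon> TId (susp A) (PInl Star) (PInr Star)"
    using conv[OF 2 id_form_eq[OF eq_refl[OF susp_form[OF A]] 1]] .
qed

text \<open>The eliminator applied to the generic point gives a section as an open term. This is the
  shape occurring in \<open>apd_glue\<close>, and ordinary substitution then yields its
  values.\<close>

lemma push_elim_var:
  assumes pu: "\<Gamma> \<turnstile> Push C A B f g \<Colon> Univ m" and P: "Push C A B f g # \<Gamma> \<turnstile> P \<Colon> Univ i"
    and l: "A # \<Gamma> \<turnstile> l \<Colon> instw 1 P (PInl (Var 0))" and r: "B # \<Gamma> \<turnstile> r \<Colon> instw 1 P (PInr (Var 0))"
    and q: "C # \<Gamma> \<turnstile> q \<Colon> glue_over (shift_under 1 P) (shift_under 1 l) (shift_under 1 r)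
                 (shift 1 f) (shift 1 g) (Var 0)"
  shows "Push C A B f g # \<Gamma> \<turnstile> IndPush (shift_under 1 P) (shift_under 1 l) (shift_under 1 r)
      (shift_under 1 q) (Var 0) \<Colon> P"
proof -
  let ?S = "Push C A B f g"
  have "?S # \<Gamma> \<turnstile> IndPush (shift_under 1 P) (shift_under 1 l) (shift_under 1 r) (shift_under 1 q)
      (Var 0) \<Colon> inst (shift_under 1 P) (Var 0)"
  proof (rule push_elim)
    show "Push (shift 1 C) (shift 1 A) (shift 1 B) (shift 1 f) (shift 1 g) # ?S #
        \<Gamma> \<turnstile> shift_under 1 P \<Colon> Univ i"
      using weakening1_under[OF pu P] by (simp add: sigma)
    show "shift 1 A # ?S # \<Gamma> \<turnstile> shift_under 1 l \<Colon> instw 1 (shift_under 1 P) (PInl (Var 0))"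
      using weakening1_under[OF pu l] by (simp add: sigma)
    show "shift 1 B # ?S # \<Gamma> \<turnstile> shift_under 1 r \<Colon> instw 1 (shift_under 1 P) (PInr (Var 0))"
      using weakening1_under[OF pu r] by (simp add: sigma)
    show "shift 1 C # ?S #
        \<Gamma> \<turnstile> shift_under 1 q \<Colon>
            glue_over (shift_under 1 (shift_under 1 P)) (shift_under 1 (shift_under 1 l))
            (shift_under 1 (shift_under 1 r)) (shift 1 (shift 1 f)) (shift 1 (shift 1 g)) (Var 0)"
      using weakening1_under[OF pu q] by (simp add: sigma sub_glue_over)
    show "?S # \<Gamma> \<turnstile> Var 0 \<Colon> Push (shift 1 C) (shift 1 A) (shift 1 B) (shift 1 f) (shift 1 g)"
      using var_zero[OF pu] by (simp add: sigma)
  qed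
  then show ?thesis by (simp add: sigma)
qed

text \<open>The eliminator asks for a path out of a transport, even when the family is constant.
  \<open>theta\<close> converts the given \<open>q\<close> into such a path.\<close>

definition rec_glue :: "tm \<Rightarrow> tm \<Rightarrow> tm \<Rightarrow> tm \<Rightarrow> tm \<Rightarrow> tm" where
  "rec_glue A X x y q = App (theta (shift 1 X) (shift 1 x) (shift 1 y)
     (north (shift 1 A) (Var 0)) (south (shift 1 A) (Var 0)) (Glue (Var 0))) q"

text \<open>The same shifted \<open>IndPush\<close> as in \<open>apd_glue\<close>, so that the
  computation rule on \<open>Glue\<close> is literally about this term.\<close>

definition susp_rec :: "tm \<Rightarrow> tm \<Rightarrow> tm \<Rightarrow> tm \<Rightarrow> tm \<Rightarrow> tm" where
  "susp_rec A X x y q = IndPush (shift_under 1 (shift 1 X)) (shift_under 1 (shift 1 x))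
      (shift_under 1 (shift 1 y))
     (shift_under 1 (rec_glue A X x y q)) (Var 0)"

lemma sub_susp_rec: "sub (up \<sigma>) (susp_rec A X x y q) = susp_rec (sub \<sigma> A) (sub \<sigma> X) (sub \<sigma> x) (sub
    \<sigma> y) (sub (up \<sigma>) q)"
  by (simp add: susp_rec_def rec_glue_def sub_theta sigma)

context
  fixes \<Gamma> A i X k x y q
  assumes A: "\<Gamma> \<turnstile> A \<Colon> Univ i" and X: "\<Gamma> \<turnstile> X \<Colon> Univ k" and x: "\<Gamma> \<turnstile> x \<Colon> X" and y: "\<Gamma> \<turnstile> y \<Colon> X"
    and q: "A # \<Gamma> \<turnstile> q \<Colon> TId (shift 1 X) (shift 1 x) (shift 1 y)"
begin

lemma rec_data:
  "susp A # \<Gamma> \<turnstile> shift 1 X \<Colon> Univ k"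
  "TUnit # \<Gamma> \<turnstile> shift 1 x \<Colon> instw 1 (shift 1 X) (PInl (Var 0))"
  "TUnit # \<Gamma> \<turnstile> shift 1 y \<Colon> instw 1 (shift 1 X) (PInr (Var 0))"
  "A # \<Gamma> \<turnstile> rec_glue A X x y q \<Colon> glue_over (shift_under 1 (shift 1 X)) (shift_under 1 (shift 1 x))
     (shift_under 1 (shift 1 y)) (shift 1 (Lam A Star)) (shift 1 (Lam A Star)) (Var 0)"
proof -
  have U: "\<Gamma> \<turnstile> TUnit \<Colon> Univ 0" using unit_form typing_ctx[OF A] .
  show "susp A # \<Gamma> \<turnstile> shift 1 X \<Colon> Univ k" using weakening1_type[OF susp_form[OF A] X] .
  show "TUnit # \<Gamma> \<turnstile> shift 1 x \<Colon> instw 1 (shift 1 X) (PInl (Var 0))"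
    "TUnit # \<Gamma> \<turnstile> shift 1 y \<Colon> instw 1 (shift 1 X) (PInr (Var 0))"
    using weakening1(1)[OF U x] weakening1(1)[OF U y] by (simp_all add: sigma)
  note A1 = weakening1_type[OF A A] and X1 = weakening1_type[OF A X] and v = var_zero[OF A]
  note x1 = weakening1(1)[OF A x] and y1 = weakening1(1)[OF A y]
  show "A # \<Gamma> \<turnstile> rec_glue A X x y q \<Colon>
      glue_over (shift_under 1 (shift 1 X)) (shift_under 1 (shift 1 x))
     (shift_under 1 (shift 1 y)) (shift 1 (Lam A Star)) (shift 1 (Lam A Star)) (Var 0)"
    unfolding rec_glue_def
    using app_arr[OF theta_type[OF susp_form[OF A1] X1 x1 y1 susp_glue(1,2,5)[OF A1 v]] q]
    by (simp add: glue_over_def sigma)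
qed

lemma susp_rec_type: "susp A # \<Gamma> \<turnstile> susp_rec A X x y q \<Colon> shift 1 X"
  using push_elim_var[OF susp_form[OF A, unfolded susp_def] rec_data[unfolded susp_def]]
  unfolding susp_rec_def susp_def .

lemma susp_rec_north: "\<Gamma> \<turnstile> u \<Colon> TUnit \<Longrightarrow> \<Gamma> \<turnstile> inst (susp_rec A X x y q) (PInl u) \<doteq> x \<Colon> X"
  using push_comp1[OF rec_data[unfolded susp_def], of u]
  by (simp add: susp_rec_def sigma)

lemma susp_rec_south: "\<Gamma> \<turnstile> u \<Colon> TUnit \<Longrightarrow> \<Gamma> \<turnstile> inst (susp_rec A X x y q) (PInr u) \<doteq> y \<Colon> X"
  using push_comp2[OF rec_data[unfolded susp_def], of u]
  by (simp add: susp_rec_def sigma)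

text \<open>The computation rule has \<open>x\<close> and \<open>y\<close> as endpoints, whereas
  \<open>apd_theta\<close> uses the values of the recursor at the poles. They agree only
  judgementally; \<open>acyclic_path_eq\<close> reconciles them.\<close>

lemma susp_rec_glue:
  assumes a: "\<Gamma> \<turnstile> a \<Colon> A"
  shows "inhabited \<Gamma> (TId (TId X (transp (shift 1 X) (north A a) (south A a) (Glue a) x) y)
     (apd (shift 1 X) (susp_rec A X x y q) (north A a) (south A a) (Glue a))
     (App (theta X x y (north A a) (south A a) (Glue a)) (inst q a)))"
  using push_comp_glue[OF rec_data[unfolded susp_def] a]
  unfolding inhabited_def apd_glue_def susp_rec_def[symmetric]
  by (auto simp: glue_over_def rec_glue_def sub_theta sigma)

end

section \<open>Acyclic types\<close>

text \<open>One endpoint is changed at a time: with a variable in its place, \<open>theta\<close> is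
  an open term to which \<open>inst_cong\<close> applies. This lets \<open>x\<close> and
  \<open>y\<close> stand for the values of the recursor at the poles.\<close>

lemma theta_cong:
  assumes S: "\<Gamma> \<turnstile> S \<Colon> Univ i" and X: "\<Gamma> \<turnstile> X \<Colon> Univ k" and u: "\<Gamma> \<turnstile> u \<Colon> X" and v: "\<Gamma> \<turnstile> v \<Colon> X"
    and u': "\<Gamma> \<turnstile> u' \<Colon> X" and v': "\<Gamma> \<turnstile> v' \<Colon> X"
    and uu: "\<Gamma> \<turnstile> u \<doteq> u' \<Colon> X" and vv: "\<Gamma> \<turnstile> v \<doteq> v' \<Colon> X"
    and a: "\<Gamma> \<turnstile> a \<Colon> S" and b: "\<Gamma> \<turnstile> b \<Colon> S" and p: "\<Gamma> \<turnstile> p \<Colon> TId S a b"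
  shows "\<Gamma> \<turnstile> theta X u v a b p \<doteq>
      theta X u' v' a b p \<Colon> arr (TId X u v) (TId X (transp (shift 1 X) a b p u) v)"
proof -
  have form: "\<Gamma> \<turnstile> arr (TId X u v) (TId X (transp (shift 1 X) a b p u) v) \<Colon> Univ k"
    if S: "\<Gamma> \<turnstile> S \<Colon> Univ i" and X: "\<Gamma> \<turnstile> X \<Colon> Univ k" and u: "\<Gamma> \<turnstile> u \<Colon> X" and v: "\<Gamma> \<turnstile> v \<Colon> X"
      and a: "\<Gamma> \<turnstile> a \<Colon> S" and b: "\<Gamma> \<turnstile> b \<Colon> S" and p: "\<Gamma> \<turnstile> p \<Colon> TId S a b" for \<Gamma> S X u v a b p
    by (intro arr_form id_form X u v transp_const_type[OF S X u a b p])
  note w = weakening1(1)[OF X] and S1 = weakening1_type[OF X S] and X1 = weakening1_type[OF X X]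
      and z = var_zero[OF X]
  have p1: "X # \<Gamma> \<turnstile> shift 1 p \<Colon> TId (shift 1 S) (shift 1 a) (shift 1 b)"
    using w[OF p] by (simp add: sigma)
  have "\<Gamma> \<turnstile> theta X u v a b p \<doteq>
      theta X u' v a b p \<Colon> arr (TId X u v) (TId X (transp (shift 1 X) a b p u) v)"
    using inst_cong[OF theta_type[OF S1 X1 z w[OF v] w[OF a] w[OF b] p1] form[OF S1 X1 z w[OF v]
        w[OF a] w[OF b] p1] u u' uu]
    by (simp add: sub_theta sub_arr sub_transp sigma)
  moreover have "\<Gamma> \<turnstile> theta X u' v a b p \<doteq>
      theta X u' v' a b p \<Colon> arr (TId X u' v) (TId X (transp (shift 1 X) a b p u') v)"
    using inst_cong[OF theta_type[OF S1 X1 w[OF u'] z w[OF a] w[OF b] p1] form[OF S1 X1 w[OF u'] z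
        w[OF a] w[OF b] p1] v v' vv]
    by (simp add: sub_theta sub_arr sub_transp sigma)
  moreover have "\<Gamma> \<turnstile> arr (TId X u' v) (TId X (transp (shift 1 X) a b p u') v) \<doteq>
      arr (TId X u v) (TId X (transp (shift 1 X) a b p u) v) \<Colon> Univ k"
    using inst_cong[OF form[OF S1 X1 z w[OF v] w[OF a] w[OF b] p1] univ_intro[OF typing_ctx[OF
        X1]] u' u eq_sym[OF uu]]
    by (simp add: sub_arr sub_transp sigma)
  ultimately show ?thesis using eq_trans eq_conv by blast
qed

text \<open>Only the center and contraction of the suspension enter, no point of \<open>A\<close>.
  The ends stay general because comparison with \<open>Glue\<close> takes place at
  \<open>north A a\<close> and \<open>south A a\<close>, while the path finally wanted joins the
  poles at \<open>Star\<close>.\<close>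

definition acyclic_path :: "tm \<Rightarrow> tm \<Rightarrow> tm \<Rightarrow> tm \<Rightarrow> tm \<Rightarrow> tm \<Rightarrow> tm \<Rightarrow> tm \<Rightarrow> tm \<Rightarrow> tm" where
  "acyclic_path A c h X x y q a b = ap X (susp_rec A X x y q) a b (cpath (susp A) c h a b)"

lemma sub_acyclic_path: "sub \<sigma> (acyclic_path A c h X x y q a b) =
  acyclic_path (sub \<sigma> A) (sub \<sigma> c) (sub \<sigma> h) (sub \<sigma> X) (sub \<sigma> x) (sub \<sigma> y) (sub (up \<sigma>) q) (sub \<sigma>
      a) (sub \<sigma> b)"
  by (simp add: acyclic_path_def sub_ap sub_susp_rec sub_cpath sub_susp)

context
  fixes \<Gamma> A i X k x y q c h
  assumes A: "\<Gamma> \<turnstile> A \<Colon> Univ i" and X: "\<Gamma> \<turnstile> X \<Colon> Univ k" and x: "\<Gamma> \<turnstile> x \<Colon> X" and y: "\<Gamma> \<turnstile> y \<Colon> X"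
    and q: "A # \<Gamma> \<turnstile> q \<Colon> TId (shift 1 X) (shift 1 x) (shift 1 y)"
    and c: "\<Gamma> \<turnstile> c \<Colon> susp A" and h: "\<Gamma> \<turnstile> h \<Colon> contraction (susp A) c"
begin

lemma acyclic_path_gen:
  assumes "\<Gamma> \<turnstile> a \<Colon> susp A" "\<Gamma> \<turnstile> b \<Colon> susp A"
  shows "\<Gamma> \<turnstile> acyclic_path A c h X x y q a b \<Colon>
      TId X (inst (susp_rec A X x y q) a) (inst (susp_rec A X x y q) b)"
  unfolding acyclic_path_def
  by (rule ap_type[OF susp_form[OF A] X susp_rec_type[OF A X x y q] assms cpath_type[OF
      susp_form[OF A] c h assms]])

lemma rec_path_eq:
  assumes u: "\<Gamma> \<turnstile> u \<Colon> TUnit" and v: "\<Gamma> \<turnstile> v \<Colon> TUnit"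
  shows "\<Gamma> \<turnstile> TId X (inst (susp_rec A X x y q) (PInl u)) (inst (susp_rec A X x y q) (PInr v)) \<doteq>
      TId X x y \<Colon> Univ k"
  by (rule id_form_eq[OF eq_refl[OF X] susp_rec_north[OF A X x y q u] susp_rec_south[OF A X x y q
      v]])

lemma acyclic_path_type:
  "\<Gamma> \<turnstile> acyclic_path A c h X x y q (PInl Star) (PInr Star) \<Colon> TId X x y"
proof -
  have st: "\<Gamma> \<turnstile> Star \<Colon> TUnit" using unit_intro typing_ctx[OF A] .
  show ?thesis
    using conv[OF acyclic_path_gen[OF susp_poles(1,2)[OF A st]] rec_path_eq[OF st st]] .
qed

end

lemma acyclic_path_cong:
  assumes A: "\<Gamma> \<turnstile> A \<Colon> Univ i" and X: "\<Gamma> \<turnstile> X \<Colon> Univ k" and x: "\<Gamma> \<turnstile> x \<Colon> X" and y: "\<Gamma> \<turnstile> y \<Colon> X"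
    and q: "A # \<Gamma> \<turnstile> q \<Colon> TId (shift 1 X) (shift 1 x) (shift 1 y)"
    and c: "\<Gamma> \<turnstile> c \<Colon> susp A" and h: "\<Gamma> \<turnstile> h \<Colon> contraction (susp A) c"
    and a: "\<Gamma> \<turnstile> a \<Colon> susp A" "\<Gamma> \<turnstile> a' \<Colon> susp A" "\<Gamma> \<turnstile> a \<doteq> a' \<Colon> susp A"
    and b: "\<Gamma> \<turnstile> b \<Colon> susp A" "\<Gamma> \<turnstile> b' \<Colon> susp A" "\<Gamma> \<turnstile> b \<doteq> b' \<Colon> susp A"
  shows "\<Gamma> \<turnstile> acyclic_path A c h X x y q a b \<doteq> acyclic_path A c h X x y q a' b' \<Colon>
    TId X (inst (susp_rec A X x y q) a) (inst (susp_rec A X x y q) b)"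
proof -
  note S = susp_form[OF A]
  note w = weakening1(1)[OF S] and A1 = weakening1_type[OF S A] and X1 = weakening1_type[OF S X]
  have z: "susp A # \<Gamma> \<turnstile> Var 0 \<Colon> susp (shift 1 A)"
      using var_zero[OF S] by (simp add: sub_susp shift_wk)
  have q1: "shift 1 A # susp A #
      \<Gamma> \<turnstile> shift_under 1 q \<Colon> TId (shift 1 (shift 1 X)) (shift 1 (shift 1 x)) (shift 1 (shift 1 y))"
    using weakening1_under[OF S q] by (simp add: sigma)
  have c1: "susp A # \<Gamma> \<turnstile> shift 1 c \<Colon> susp (shift 1 A)"
      using w[OF c] by (simp add: sub_susp shift_wk)
  have a1: "susp A # \<Gamma> \<turnstile> shift 1 a' \<Colon> susp (shift 1 A)"
      using w[OF a(2)] by (simp add: sub_susp shift_wk)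
  have b1: "susp A # \<Gamma> \<turnstile> shift 1 b \<Colon> susp (shift 1 A)"
      using w[OF b(1)] by (simp add: sub_susp shift_wk)
  have h1: "susp A # \<Gamma> \<turnstile> shift 1 h \<Colon> contraction (susp (shift 1 A)) (shift 1 c)"
    using w[OF h] by (simp add: sub_susp sub_contraction shift_wk)
  note g = acyclic_path_gen[OF A1 X1 w[OF x] w[OF y] q1 c1 h1]
  have s1: "susp (shift 1 A) # susp A #
      \<Gamma> \<turnstile> susp_rec (shift 1 A) (shift 1 X) (shift 1 x) (shift 1 y) (shift_under 1 q) \<Colon>
          shift 1 (shift 1 X)"
    by (rule susp_rec_type[OF A1 X1 w[OF x] w[OF y] q1])
  have form: "susp A # \<Gamma> \<turnstile> TId (shift 1 X) (inst (susp_rec (shift 1 A) (shift 1 X) (shift 1 x)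
      (shift 1 y) (shift_under 1 q)) a)
      (inst (susp_rec (shift 1 A) (shift 1 X) (shift 1 x) (shift 1 y) (shift_under 1 q)) b) \<Colon>
          Univ k"
    if "susp A # \<Gamma> \<turnstile> a \<Colon> susp (shift 1 A)" "susp A # \<Gamma> \<turnstile> b \<Colon> susp (shift 1 A)" for a b
    using subst1(1)[OF that(1) s1] subst1(1)[OF that(2) s1] X1 by (auto intro: id_form simp: sigma)
  \<comment> \<open>Normalisation by \<open>sigma\<close> exposes the arguments of the shifted
    recursor; this equation folds them back into one substitution instance.\<close>
  have rec: "susp_rec (sub (wk (Suc 0)) A) (sub (wk (Suc 0)) X) (sub (wk (Suc 0)) x) (sub (wk (Suc
      0)) y)
      (sub (Var 0 \<cdot> wk (Suc (Suc 0))) q) = sub (Var 0 \<cdot> wk (Suc (Suc 0))) (susp_rec A X x y q)"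
    using sub_susp_rec[of "wk 1" A X x y q] by (simp add: sigma)
  have 1: "\<Gamma> \<turnstile> acyclic_path A c h X x y q a b \<doteq> acyclic_path A c h X x y q a' b \<Colon>
    TId X (inst (susp_rec A X x y q) a) (inst (susp_rec A X x y q) b)"
    using inst_cong[OF g[OF z b1] form[OF z b1] a]
    by (simp add: sub_acyclic_path rec sigma)
  have 2: "\<Gamma> \<turnstile> acyclic_path A c h X x y q a' b \<doteq> acyclic_path A c h X x y q a' b' \<Colon>
    TId X (inst (susp_rec A X x y q) a') (inst (susp_rec A X x y q) b)"
    using inst_cong[OF g[OF a1 z] form[OF a1 z] b]
    by (simp add: sub_acyclic_path rec sigma)
  have 3: "\<Gamma> \<turnstile> TId X (inst (susp_rec A X x y q) a') (inst (susp_rec A X x y q) b) \<doteq>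
    TId X (inst (susp_rec A X x y q) a) (inst (susp_rec A X x y q) b) \<Colon> Univ k"
    using inst_cong[OF form[OF z b1] univ_intro[OF typing_ctx[OF z]] a(2,1) eq_sym[OF a(3)]]
    by (simp add: rec sigma)
  show ?thesis using eq_trans[OF 1 eq_conv[OF 2 3]] .
qed

text \<open>After conversion of the endpoints, the computation rule says that the recursor sends
  \<open>Glue a\<close> to \<open>q\<close> at \<open>a\<close>; \<open>cpath_ap_unique\<close> then
  trades \<open>Glue a\<close> for the canonical path.\<close>

lemma acyclic_path_eq:
  assumes A: "\<Gamma> \<turnstile> A \<Colon> Univ i" and X: "\<Gamma> \<turnstile> X \<Colon> Univ k" and x: "\<Gamma> \<turnstile> x \<Colon> X" and y: "\<Gamma> \<turnstile> y \<Colon> X"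
    and q: "A # \<Gamma> \<turnstile> q \<Colon> TId (shift 1 X) (shift 1 x) (shift 1 y)"
    and c: "\<Gamma> \<turnstile> c \<Colon> susp A" and h: "\<Gamma> \<turnstile> h \<Colon> contraction (susp A) c"
    and a: "\<Gamma> \<turnstile> a \<Colon> A"
  shows "inhabited \<Gamma> (TId (TId X x y) (acyclic_path A c h X x y q (PInl Star) (PInr Star)) (inst q
      a))"
proof -
  let ?s = "susp_rec A X x y q" and ?N = "north A a" and ?S = "south A a"
  note S = susp_form[OF A] and s = susp_rec_type[OF A X x y q]
  note gl = susp_glue[OF A a]
  have st: "\<Gamma> \<turnstile> Star \<Colon> TUnit" using unit_intro typing_ctx[OF A] .
  have f: "\<Gamma> \<turnstile> App (Lam A Star) a \<Colon> TUnit" using app_arr[OF const_Star(1)[OF A] a] .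
  note sN = susp_rec_north[OF A X x y q f] and sS = susp_rec_south[OF A X x y q f]
  have tN: "\<Gamma> \<turnstile> inst ?s ?N \<Colon> X" and tS: "\<Gamma> \<turnstile> inst ?s ?S \<Colon> X"
    using subst1(1)[OF gl(1) s] subst1(1)[OF gl(2) s] by (simp_all add: sigma)
  have r: "\<Gamma> \<turnstile> inst q a \<Colon> TId X x y"
    using subst1(1)[OF a q] by (simp add: sigma)
  note R = rec_path_eq[OF A X x y q c h f f]
  note r' = conv[OF r eq_sym[OF R]]
  have I: "\<Gamma> \<turnstile> TId X (transp (shift 1 X) ?N ?S (Glue a) (inst ?s ?N)) (inst ?s ?S) \<doteq>
      TId X (transp (shift 1 X) ?N ?S (Glue a) x) y \<Colon> Univ k"
    using transp_cong[OF S weakening1_type[OF S X] gl(1,2,5), of "inst ?s ?N" x] sN sS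
    by (intro id_form_eq eq_refl[OF X]) (simp_all add: sigma)
  have "\<Gamma> \<turnstile> apd_theta X ?s ?N ?S (Glue a) (inst q a) \<doteq>
      TId (TId X (transp (shift 1 X) ?N ?S (Glue a) x) y) (apd (shift 1 X) ?s ?N ?S (Glue a))
       (App (theta X x y ?N ?S (Glue a)) (inst q a)) \<Colon> Univ k"
    unfolding apd_theta_def
  proof (rule id_form_eq[OF I])
    show "\<Gamma> \<turnstile> apd (shift 1 X) ?s ?N ?S (Glue a) \<doteq> apd (shift 1 X) ?s ?N ?S (Glue a) \<Colon>
        TId X (transp (shift 1 X) ?N ?S (Glue a) (inst ?s ?N)) (inst ?s ?S)"
      using apd_type[OF S weakening1_type[OF S X] s gl(1,2,5)] by (intro eq_refl) (simp add: sigma)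
    show "\<Gamma> \<turnstile> App (theta X (inst ?s ?N) (inst ?s ?S) ?N ?S (Glue a)) (inst q a) \<doteq>
        App (theta X x y ?N ?S (Glue a)) (inst q a) \<Colon>
        TId X (transp (shift 1 X) ?N ?S (Glue a) (inst ?s ?N)) (inst ?s ?S)"
      by (rule app_arr_eq[OF theta_cong[OF S X tN tS x y sN sS gl(1,2,5)] eq_refl[OF r']])
  qed
  from inhabited_conv[OF susp_rec_glue[OF A X x y q a] eq_sym[OF this]]
  have "inhabited \<Gamma> (apd_theta X ?s ?N ?S (Glue a) (inst q a))" .
  from cpath_ap_unique[OF S X s c h gl(1,2,5) r' this]
  have 1: "inhabited \<Gamma> (TId (TId X (inst ?s ?N) (inst ?s ?S)) (acyclic_path A c h X x y q ?N ?S)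
      (inst q a))"
    unfolding acyclic_path_def .
  \<comment> \<open>Only here do the ends move from \<open>north A a\<close> and
    \<open>south A a\<close> to the poles at \<open>Star\<close>, which removes the last occurrence
    of \<open>a\<close> from the left side.\<close>
  have "\<Gamma> \<turnstile> TId (TId X (inst ?s ?N) (inst ?s ?S)) (acyclic_path A c h X x y q ?N ?S) (inst q a) \<doteq>
      TId (TId X x y) (acyclic_path A c h X x y q (PInl Star) (PInr Star)) (inst q a) \<Colon> Univ k"
    by (rule id_form_eq[OF R acyclic_path_cong[OF A X x y q c h gl(1) susp_poles(1)[OF A st] gl(3)
          gl(2) susp_poles(2)[OF A st] gl(4)] eq_refl[OF r']])
  from inhabited_conv[OF 1 this] show ?thesis .
qed

lemma acyclic_factor:
  assumes A: "\<Gamma> \<turnstile> A \<Colon> Univ i" and ac: "inhabited \<Gamma> (is_acyclic A)"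
    and X: "\<Gamma> \<turnstile> X \<Colon> Univ k" and x: "\<Gamma> \<turnstile> x \<Colon> X" and y: "\<Gamma> \<turnstile> y \<Colon> X"
    and q: "A # \<Gamma> \<turnstile> q \<Colon> TId (shift 1 X) (shift 1 x) (shift 1 y)"
  obtains p where "\<Gamma> \<turnstile> p \<Colon> TId X x y"
    and "inhabited (A # \<Gamma>) (TId (TId (shift 1 X) (shift 1 x) (shift 1 y)) (shift 1 p) q)"
proof -
  obtain c h where c: "\<Gamma> \<turnstile> c \<Colon> susp A" and h: "\<Gamma> \<turnstile> h \<Colon> contraction (susp A) c"
    using ac contr_elim[OF susp_form[OF A]] unfolding inhabited_def is_acyclic_def by blast
  note w = weakening1(1)[OF A] and A1 = weakening1_type[OF A A] and X1 = weakening1_type[OF A X]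
  have q1: "shift 1 A # A #
      \<Gamma> \<turnstile> shift_under 1 q \<Colon> TId (shift 1 (shift 1 X)) (shift 1 (shift 1 x)) (shift 1 (shift 1 y))"
    using weakening1_under[OF A q] by (simp add: sigma)
  have c1: "A # \<Gamma> \<turnstile> shift 1 c \<Colon> susp (shift 1 A)" using w[OF c] by (simp add: sub_susp shift_wk)
  have h1: "A # \<Gamma> \<turnstile> shift 1 h \<Colon> contraction (susp (shift 1 A)) (shift 1 c)"
    using w[OF h] by (simp add: sub_susp sub_contraction shift_wk)
  \<comment> \<open>\<open>acyclic_path_eq\<close> is used over \<open>A # \<Gamma>\<close> at the
    generic point \<open>Var 0\<close>. As \<open>acyclic_path\<close> commutes with substitution,
    the path found there is the shift of the one constructed over \<Gamma>.\<close>
  show thesis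
    using that[OF acyclic_path_type[OF A X x y q c h]] acyclic_path_eq[OF A1 X1 w[OF x] w[OF y] q1
        c1 h1 var_zero[OF A]]
    by (simp add: sub_acyclic_path sigma)
qed

section \<open>Contracting a suspension to its north pole\<close>

lemma transp_cong_all:
  assumes S: "\<Gamma> \<turnstile> S \<Colon> Univ i" and P: "S # \<Gamma> \<turnstile> P \<Colon> Univ k"
    and PP: "S # \<Gamma> \<turnstile> P \<doteq> P' \<Colon> Univ k"
    and a: "\<Gamma> \<turnstile> a \<doteq> a' \<Colon> S" and b: "\<Gamma> \<turnstile> b \<doteq> b' \<Colon> S" and p: "\<Gamma> \<turnstile> p \<doteq> p' \<Colon> TId S a b"
    and u: "\<Gamma> \<turnstile> u \<doteq> u' \<Colon> inst P a"
  shows "\<Gamma> \<turnstile> transp P a b p u \<doteq> transp P' a' b' p' u' \<Colon> inst P b"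
proof -
  have eq: "path_ctx S \<Gamma> \<turnstile> instw 3 P (Var m) \<doteq> instw 3 P' (Var m) \<Colon> Univ k" if "m = 1 \<or> m = 2" for m
    using substitution(2)[OF sub_wf_scons[OF sub_wf_wk[of "[TId (shift 2 S) (Var 1) (Var 0), shift
        1 S, S]" \<Gamma> 3]] PP, of "Var m"]
      path_ctx_wf[OF S] path_ctx_vars[OF S] that by (auto simp: instw_wk shift_wk[of 3])
  have C: "path_ctx S \<Gamma> \<turnstile> arr (instw 3 P (Var 2)) (instw 3 P (Var 1)) \<doteq>
      arr (instw 3 P' (Var 2)) (instw 3 P' (Var 1)) \<Colon> Univ k"
    using arr_form_eq eq[of 1] eq[of 2] path_ctx_weakening(3)[OF S P] by (auto simp: sigma)
  have c: "S # \<Gamma> \<turnstile> Lam P (Var 0) \<doteq>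
      Lam P' (Var 0) \<Colon> instw3 1 (arr (instw 3 P (Var 2)) (instw 3 P (Var 1))) (Var 0) (Var 0)
          (Refl (Var 0))"
    using pi_intro_eq[OF PP eq_refl[OF var_zero[OF P]]]
    by (simp add: sigma sub_arr) (simp add: arr_def sigma)
  show ?thesis unfolding transp_def
    using id_elim_eq[OF C c a b p] u by (auto intro!: app_arr_eq simp: sigma sub_arr)
qed

text \<open>Congruence extends the computation rule to arguments judgementally equal to
  \<open>Star\<close>, such as \<open>App (Lam A Star) a\<close>, which occur in the datum over
  \<open>Glue a\<close>.\<close>

lemma unit_rec:
  assumes C: "TUnit # \<Gamma> \<turnstile> C \<Colon> Univ i" and d: "\<Gamma> \<turnstile> d \<Colon> inst C Star"
  shows "TUnit # \<Gamma> \<turnstile> IndUnit (shift_under 1 C) (shift 1 d) (Var 0) \<Colon> C"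
    and "\<Gamma> \<turnstile> u \<doteq> Star \<Colon> TUnit \<Longrightarrow> \<Gamma> \<turnstile> u \<Colon> TUnit \<Longrightarrow> \<Gamma> \<turnstile> IndUnit C d u \<doteq> d \<Colon> inst C u"
proof -
  have ctx_wf: "\<turnstile> \<Gamma> ctx" using d by (rule typing_ctx)
  then have U: "\<Gamma> \<turnstile> TUnit \<Colon> Univ 0" by (rule unit_form)
  have C1: "TUnit # TUnit # \<Gamma> \<turnstile> shift_under 1 C \<Colon> Univ i"
    using weakening1_under[OF U C] by (simp add: sigma)
  have d1: "TUnit # \<Gamma> \<turnstile> shift 1 d \<Colon> inst (shift_under 1 C) Star"
    using weakening1(1)[OF U d] by (simp add: sigma)
  have v: "TUnit # \<Gamma> \<turnstile> Var 0 \<Colon> TUnit"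
    using var_zero[OF U] by (simp add: sigma)
  show e: "TUnit # \<Gamma> \<turnstile> IndUnit (shift_under 1 C) (shift 1 d) (Var 0) \<Colon> C"
    using unit_elim[OF C1 d1 v] by (simp add: sigma)
  assume eq: "\<Gamma> \<turnstile> u \<doteq> Star \<Colon> TUnit" and u: "\<Gamma> \<turnstile> u \<Colon> TUnit"
  have st: "\<Gamma> \<turnstile> Star \<Colon> TUnit" using ctx_wf by (rule unit_intro)
  have "\<Gamma> \<turnstile> IndUnit C d u \<doteq> IndUnit C d Star \<Colon> inst C u"
    using inst_cong[OF e C u st eq] by (simp add: sigma)
  moreover have "\<Gamma> \<turnstile> inst C Star \<doteq> inst C u \<Colon> Univ i"
    using inst_cong[OF C univ_intro[OF typing_ctx[OF C]] st u eq_sym[OF eq]] by (simp add: sigma)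
  ultimately show "\<Gamma> \<turnstile> IndUnit C d u \<doteq> d \<Colon> inst C u"
    using unit_comp[OF C d] eq_conv eq_trans by blast
qed

text \<open>The north pole is to be the center, so a section of this family of paths is the
  contraction itself.\<close>

definition north_path :: "tm \<Rightarrow> tm" where
  "north_path A = TId (shift 1 (susp A)) (PInl Star) (Var 0)"

text \<open>
  The unit type has no judgmental uniqueness rule, so the data over the poles need \<open>IndUnit\<close>.
\<close>

definition at_north :: "tm \<Rightarrow> tm" where
  "at_north A = IndUnit (TId (shift 2 (susp A)) (PInl Star) (PInl (Var 0))) (Refl (PInl Star))
      (Var 0)"

definition at_south :: "tm \<Rightarrow> tm \<Rightarrow> tm" where
  "at_south A p = IndUnit (TId (shift 2 (susp A)) (PInl Star) (PInr (Var 0))) (shift 1 p) (Var 0)"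

lemma sub_north_path: "sub (up \<sigma>) (north_path A) = north_path (sub \<sigma> A)"
  and sub_at_north: "sub (up \<sigma>) (at_north A) = at_north (sub \<sigma> A)"
  and sub_at_south: "sub (up \<sigma>) (at_south A p) = at_south (sub \<sigma> A) (sub \<sigma> p)"
  by (simp_all add: north_path_def at_north_def at_south_def sub_susp sigma)

context
  fixes \<Gamma> A i p
  assumes A: "\<Gamma> \<turnstile> A \<Colon> Univ i" and p: "\<Gamma> \<turnstile> p \<Colon> TId (susp A) (PInl Star) (PInr Star)"
begin

lemma ctx_wf: "\<turnstile> \<Gamma> ctx"
  using A by (rule typing_ctx)

lemma north_south: "\<Gamma> \<turnstile> PInl Star \<Colon> susp A" "\<Gamma> \<turnstile> PInr Star \<Colon> susp A"
  using susp_poles(1,2)[OF A unit_intro[OF ctx_wf]] .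

lemma north_path_form: "susp A # \<Gamma> \<turnstile> north_path A \<Colon> Univ i"
  using path_to_form(2)[OF susp_form[OF A] north_south(1)] by (simp add: north_path_def sigma)

lemma pole_motive:
  "TUnit # \<Gamma> \<turnstile> TId (shift 1 (susp A)) (PInl Star) (PInl (Var 0)) \<Colon> Univ i"
  "TUnit # \<Gamma> \<turnstile> TId (shift 1 (susp A)) (PInl Star) (PInr (Var 0)) \<Colon> Univ i"
proof -
  have U: "\<Gamma> \<turnstile> TUnit \<Colon> Univ 0" using ctx_wf by (rule unit_form)
  note A1 = weakening1_type[OF U A]
  have v: "TUnit # \<Gamma> \<turnstile> Var 0 \<Colon> TUnit"
    using var_zero[OF U] by (simp add: sigma)
  have e: "shift 1 (susp A) = susp (shift 1 A)" by (simp add: sub_susp shift_wk)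
  show "TUnit # \<Gamma> \<turnstile> TId (shift 1 (susp A)) (PInl Star) (PInl (Var 0)) \<Colon> Univ i"
  "TUnit # \<Gamma> \<turnstile> TId (shift 1 (susp A)) (PInl Star) (PInr (Var 0)) \<Colon> Univ i"
    unfolding e using susp_form[OF A1] susp_poles(1,2)[OF A1 v] susp_poles(1)[OF A1 unit_intro[OF
        ctx_ext[OF U]]]
    by (auto intro: id_form)
qed

lemma at_north: "TUnit # \<Gamma> \<turnstile> at_north A \<Colon> instw 1 (north_path A) (PInl (Var 0))"
  and at_north_comp: "\<Gamma> \<turnstile> u \<Colon> TUnit \<Longrightarrow> \<Gamma> \<turnstile> u \<doteq> Star \<Colon> TUnit \<Longrightarrow>
    \<Gamma> \<turnstile> inst (at_north A) u \<doteq> Refl (PInl Star) \<Colon> TId (susp A) (PInl Star) (PInl u)"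
  using unit_rec[OF pole_motive(1), of "Refl (PInl Star)"] id_intro[OF susp_form[OF A]
      north_south(1)]
  by (simp_all add: at_north_def north_path_def sigma)

lemma at_south: "TUnit # \<Gamma> \<turnstile> at_south A p \<Colon> instw 1 (north_path A) (PInr (Var 0))"
  and at_south_comp: "\<Gamma> \<turnstile> u \<Colon> TUnit \<Longrightarrow> \<Gamma> \<turnstile> u \<doteq> Star \<Colon> TUnit \<Longrightarrow>
    \<Gamma> \<turnstile> inst (at_south A p) u \<doteq> p \<Colon> TId (susp A) (PInl Star) (PInr u)"
  using unit_rec[OF pole_motive(2), of p] p
  by (simp_all add: at_south_def north_path_def sigma)

text \<open>After conversion the datum asks that reflexivity, transported along
  \<open>Glue a\<close>, be \<open>p\<close>. That transport is \<open>Glue a\<close> by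
  \<open>transp_path_refl\<close>, and \<open>pg\<close> identifies it with
  \<open>p\<close>.\<close>

lemma north_path_glue:
  assumes a: "\<Gamma> \<turnstile> a \<Colon> A"
    and pg: "inhabited \<Gamma> (TId (TId (susp A) (PInl Star) (PInr Star)) p (Glue a))"
  shows "inhabited \<Gamma> (glue_over (north_path A) (at_north A) (at_south A p) (Lam A Star) (Lam A
      Star) a)"
proof -
  note S = susp_form[OF A] and gl = susp_glue[OF A a] and N = north_south
  have f: "\<Gamma> \<turnstile> App (Lam A Star) a \<Colon> TUnit" using app_arr[OF const_Star(1)[OF A] a] .
  note fs = const_Star(2)[OF A a]
  let ?I = "TId (susp A) (PInl Star) (PInr Star)"
  have I: "\<Gamma> \<turnstile> ?I \<Colon> Univ i" using id_form[OF S N] .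
  have "\<Gamma> \<turnstile> glue_over (north_path A) (at_north A) (at_south A p) (Lam A Star) (Lam A Star) a \<doteq>
      TId ?I (transp (north_path A) (PInl Star) (PInr Star) (Glue a) (Refl (PInl Star))) p \<Colon> Univ i"
    unfolding glue_over_def
  proof (rule id_form_eq)
    have e: "inst (north_path A) b = TId (susp A) (PInl Star) b" for b
      by (simp add: north_path_def sigma)
    show "\<Gamma> \<turnstile> inst (north_path A) (south A a) \<doteq> ?I \<Colon> Univ i"
      unfolding e by (rule id_form_eq[OF eq_refl[OF S] eq_refl[OF N(1)] gl(4)])
    show "\<Gamma> \<turnstile> transp (north_path A) (north A a) (south A a) (Glue a) (inst (at_north A) (App (Lam
        A Star) a)) \<doteq>
        transp (north_path A) (PInl Star) (PInr Star) (Glue a) (Refl (PInl Star)) \<Colon>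
            inst (north_path A) (south A a)"
      by (rule transp_cong_all[OF S north_path_form eq_refl[OF north_path_form] gl(3,4) eq_refl[OF
          gl(5)]])
        (use at_north_comp[OF f fs] in \<open>simp add: e\<close>)
    show "\<Gamma> \<turnstile> inst (at_south A p) (App (Lam A Star) a) \<doteq> p \<Colon> inst (north_path A) (south A a)"
      unfolding e by (rule at_south_comp[OF f fs])
  qed
  moreover have "inhabited \<Gamma> (TId ?I (transp (north_path A) (PInl Star) (PInr Star) (Glue a) (Refl
      (PInl Star))) p)"
  proof (rule inhabited_trans[OF I _ gl(6) p])
    show "\<Gamma> \<turnstile> transp (north_path A) (PInl Star) (PInr Star) (Glue a) (Refl (PInl Star)) \<Colon> ?I"
      using transp_type[OF S north_path_form N gl(6), of "Refl (PInl Star)"] id_intro[OF S N(1)]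
      by (simp add: north_path_def sigma)
    show "inhabited \<Gamma> (TId ?I (transp (north_path A) (PInl Star) (PInr Star) (Glue a) (Refl (PInl
        Star))) (Glue a))"
      using transp_path_refl[OF S N gl(6)] by (simp add: north_path_def sigma)
    show "inhabited \<Gamma> (TId ?I (Glue a) p)"
      using inhabited_sym[OF I p gl(6) pg] .
  qed
  ultimately show ?thesis using inhabited_conv eq_sym by blast
qed

end

text \<open>The contraction is given by pushout induction: reflexivity over the north pole,
  \<open>p\<close> over the south pole, and over \<open>Glue\<close> the coherence
  \<open>north_path_glue\<close> at a generic point.\<close>

lemma is_acyclicI:
  assumes A: "\<Gamma> \<turnstile> A \<Colon> Univ i" and p: "\<Gamma> \<turnstile> p \<Colon> TId (susp A) (PInl Star) (PInr Star)"
    and pg: "inhabited (A #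
        \<Gamma>) (TId (TId (susp (shift 1 A)) (PInl Star) (PInr Star)) (shift 1 p) (Glue (Var 0)))"
  shows "inhabited \<Gamma> (is_acyclic A)"
proof -
  note S = susp_form[OF A]
  have p1: "A # \<Gamma> \<turnstile> shift 1 p \<Colon> TId (susp (shift 1 A)) (PInl Star) (PInr Star)"
    using weakening1(1)[OF A p] by (simp add: sub_susp sigma)
  obtain q where "A # \<Gamma> \<turnstile> q \<Colon> glue_over (shift_under 1 (north_path A)) (shift_under 1 (at_north A))
     (shift_under 1 (at_south A p)) (shift 1 (Lam A Star)) (shift 1 (Lam A Star)) (Var 0)"
    using north_path_glue[OF weakening1_type[OF A A] p1 var_zero[OF A] pg]
      sub_north_path[of "wk 1" A] sub_at_north[of "wk 1" A] sub_at_south[of "wk 1" A p]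
    unfolding inhabited_def by (auto simp: sigma)
  from push_elim_var[OF S[unfolded susp_def] north_path_form[OF A p, unfolded susp_def]
      at_north[OF A p] at_south[OF A p] this]
  obtain t where t: "susp A # \<Gamma> \<turnstile> t \<Colon> north_path A"
    unfolding susp_def by blast
  have "\<Gamma> \<turnstile> Pr (PInl Star) (Lam (susp A) t) \<Colon> is_contr (susp A)"
    unfolding is_contr_contraction
    by (rule sig_intro[OF contraction_form[OF weakening1_type[OF S S] var_zero[OF S]]
        north_south(1)[OF A p]])
      (use pi_intro[OF t] in \<open>simp add: contraction_def north_path_def sigma\<close>)
  then show ?thesis unfolding is_acyclic_def inhabited_def by blast
qed

section \<open>Dependent sums of acyclic types\<close>

lemma is_acyclic_Sig:
  assumes A: "\<Gamma> \<turnstile> A \<Colon> Univ i" and B: "A # \<Gamma> \<turnstile> B \<Colon> Univ i"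
    and acA: "inhabited \<Gamma> (is_acyclic A)" and acB: "inhabited (A # \<Gamma>) (is_acyclic B)"
  shows "inhabited \<Gamma> (is_acyclic (Sig A B))"
proof -
  let ?T = "Sig A B" and ?N = "PInl Star" and ?S = "PInr Star" and ?D = "B # A # \<Gamma>"
  have T: "\<Gamma> \<turnstile> ?T \<Colon> Univ i" using sig_form[OF A B] .
  note S = susp_form[OF T]
  have pole: "\<Gamma> \<turnstile> ?N \<Colon> susp ?T" "\<Gamma> \<turnstile> ?S \<Colon> susp ?T"
    using susp_poles(1,2)[OF T unit_intro[OF typing_ctx[OF T]]] .
  have ctxD: "\<turnstile> ?D ctx" using B by (rule ctx_ext)
  have T1: "A # \<Gamma> \<turnstile> shift 1 ?T \<Colon> Univ i" using weakening1_type[OF A T] .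
  have T2: "?D \<turnstile> shift 2 ?T \<Colon> Univ i" using weakening1_type[OF B T1] by (simp add: sigma)
  have S1: "A # \<Gamma> \<turnstile> shift 1 (susp ?T) \<Colon> Univ i" using weakening1_type[OF A S] .
  have pole1: "A # \<Gamma> \<turnstile> ?N \<Colon> shift 1 (susp ?T)" "A # \<Gamma> \<turnstile> ?S \<Colon> shift 1 (susp ?T)"
    using weakening1(1)[OF A] pole by (fastforce simp: shift_def)+
  have B2: "shift 2 A # ?D \<turnstile> sub (Var 0 \<cdot> wk 3) B \<Colon> Univ i"
    using weakening_under[of "[B, A]" \<Gamma> 2 A B "Univ i"] ctxD B by (simp add: sigma)
  have "?D \<turnstile> Pr (Var 1) (Var 0) \<Colon> Sig (shift 2 A) (sub (Var 0 \<cdot> wk 3) B)"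
    by (rule sig_intro[OF B2]) (rule var_typing[OF ctxD]; simp add: sigma)+
  then have pr: "?D \<turnstile> Pr (Var 1) (Var 0) \<Colon> shift 2 ?T" by (simp add: sigma)
  \<comment> \<open>The glue of the generic pair. The closed poles are written with shifts only to
    fit the form of \<open>q\<close> in \<open>acyclic_factor\<close>.\<close>
  have g: "?D \<turnstile> Glue (Pr (Var 1) (Var 0)) \<Colon>
      TId (shift 1 (shift 1 (susp ?T))) (shift 1 ?N) (shift 1 ?S)"
    using susp_glue(6)[OF T2 pr] by (simp add: sub_susp sigma)
  obtain p' where p': "A # \<Gamma> \<turnstile> p' \<Colon> TId (shift 1 (susp ?T)) ?N ?S"
    and e': "inhabited ?D (TId (TId (shift 1 (shift 1 (susp ?T))) (shift 1 ?N) (shift 1 ?S))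
        (shift 1 p') (Glue (Pr (Var 1) (Var 0))))"
    using acyclic_factor[OF B acB S1 pole1 g] by blast
  have "A # \<Gamma> \<turnstile> p' \<Colon> TId (shift 1 (susp ?T)) (shift 1 ?N) (shift 1 ?S)"
    using p' by (simp add: sigma)
  then obtain p where p: "\<Gamma> \<turnstile> p \<Colon> TId (susp ?T) ?N ?S"
    and e: "inhabited (A #
        \<Gamma>) (TId (TId (shift 1 (susp ?T)) (shift 1 ?N) (shift 1 ?S)) (shift 1 p) p')"
    using acyclic_factor[OF A acA S pole] by blast
  let ?I = "TId (shift 2 (susp ?T)) ?N ?S"
  have I: "?D \<turnstile> ?I \<Colon> Univ i"
    using weakening1_type[OF B id_form[OF S1 pole1]] by (simp add: sigma)
  have p1: "A # \<Gamma> \<turnstile> shift 1 p \<Colon> TId (shift 1 (susp ?T)) ?N ?S"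
    using weakening1(1)[OF A p] by (simp add: sigma)
  have "inhabited ?D (shift 1 (TId (TId (shift 1 (susp ?T)) (shift 1 ?N) (shift 1 ?S)) (shift 1 p)
      p'))"
    using e weakening1(1)[OF B] unfolding inhabited_def by blast
  then have e2: "inhabited ?D (TId ?I (shift 2 p) (shift 1 p'))" by (simp add: sigma)
  have "inhabited ?D (TId ?I (shift 2 p) (Glue (Pr (Var 1) (Var 0))))"
    by (rule inhabited_trans[OF I _ _ _ e2])
      (use weakening1(1)[OF B p1] weakening1(1)[OF B p'] g e' in \<open>simp_all add: sigma\<close>)
  then obtain r where r: "?D \<turnstile> r \<Colon> TId ?I (shift 2 p) (Glue (Pr (Var 1) (Var 0)))"
    unfolding inhabited_def by blast
  \<comment> \<open>The coherence \<open>r\<close> speaks of a pair of variables, while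
    \<open>is_acyclicI\<close> wants it for one variable of the sum type. To pass by
    \<open>sig_elim\<close>, \<open>r\<close> is first weakened by a variable of type
    \<open>?T\<close> placed below those of \<open>A\<close> and \<open>B\<close>.\<close>
  have wA: "sub_wf (up (wk 1)) (A # \<Gamma>) (sub (wk 1) A # ?T # \<Gamma>)"
    using sub_wf_wk[of "[?T]" \<Gamma> 1] ctx_ext[OF T] weakening1_type[OF T A, unfolded shift_wk]
    by (intro sub_wf.W_up) simp_all
  have "sub (wk 1) A # ?T # \<Gamma> \<turnstile> sub (up (wk 1)) B \<Colon> Univ i"
    using substitution(1)[OF wA B] by simp
  from substitution(1)[OF sub_wf.W_up[OF wA this] r]
  have r1: "sub (up (wk 1)) B # sub (wk 1) A # ?T # \<Gamma> \<turnstile> sub (up (up (wk 1))) r \<Colon>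
     TId (TId (shift 3 (susp ?T)) ?N ?S) (shift 3 p) (Glue (Pr (Var 1) (Var 0)))"
    by (simp add: sigma)
  let ?C = "TId (TId (shift 2 (susp ?T)) ?N ?S) (shift 2 p) (Glue (Var 0))"
  have TT: "?T # \<Gamma> \<turnstile> shift 1 ?T \<Colon> Univ i" using weakening1_type[OF T T] .
  have TT2: "shift 1 ?T # ?T # \<Gamma> \<turnstile> shift 1 (shift 1 ?T) \<Colon> Univ i" using weakening1_type[OF TT TT] .
  have "?T # \<Gamma> \<turnstile> shift 1 p \<Colon> shift 1 (TId (susp ?T) ?N ?S)" using weakening1(1)[OF T p] .
  from weakening1(1)[OF TT this]
  have p2: "shift 1 ?T # ?T # \<Gamma> \<turnstile> shift 2 p \<Colon> TId (shift 2 (susp ?T)) ?N ?S"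
    by (simp add: sigma)
  have g2: "shift 1 ?T # ?T # \<Gamma> \<turnstile> Glue (Var 0) \<Colon> TId (shift 2 (susp ?T)) ?N ?S"
    using susp_glue(6)[OF TT2 var_zero[OF TT]] by (simp add: sub_susp sigma)
  have I2: "shift 1 ?T # ?T # \<Gamma> \<turnstile> TId (shift 2 (susp ?T)) ?N ?S \<Colon> Univ i"
    using weakening1_type[OF TT weakening1_type[OF T id_form[OF S pole]]] by (simp add: sigma)
  have C: "Sig (sub (wk 1) A) (sub (up (wk 1)) B) # ?T # \<Gamma> \<turnstile> ?C \<Colon> Univ i"
    using id_form[OF I2 p2 g2] by (simp add: sigma)
  have v: "?T # \<Gamma> \<turnstile> Var 0 \<Colon> Sig (sub (wk 1) A) (sub (up (wk 1)) B)"
    using var_zero[OF T] by (simp add: sigma)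
  have "sub (up (wk 1)) B # sub (wk 1) A # ?T #
      \<Gamma> \<turnstile> sub (up (up (wk 1))) r \<Colon> instw 2 ?C (Pr (Var 1) (Var 0))"
    using r1 by (simp add: sigma)
  from sig_elim[OF C this v]
  have "inhabited (?T # \<Gamma>) (TId (TId (susp (shift 1 ?T)) ?N ?S) (shift 1 p) (Glue (Var 0)))"
    unfolding inhabited_def by (auto simp: sub_susp sigma)
  from is_acyclicI[OF T p this] show ?thesis .
qed

theorem proposition2p12:
  fixes i j :: nat
  shows "\<exists>t. [] \<turnstile> t \<Colon>
    Pi (Univ i)
      (Pi (is_acyclic (Var 0))
        (Pi (arr (Var 1) (Univ j))
          (Pi (Pi (Var 2) (is_acyclic (App (Var 1) (Var 0))))
            (is_acyclic (Sig (Var 3) (App (Var 2) (Var 0)))))))"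
proof -
  have sub_ac: "sub \<sigma> (is_acyclic A) = is_acyclic (sub \<sigma> A)" for \<sigma> A
    by (simp add: is_acyclic_def is_contr_def sub_susp sigma)
  have is_acyclic_form: "\<Gamma> \<turnstile> is_acyclic A \<Colon> Univ k" if "\<Gamma> \<turnstile> A \<Colon> Univ k" for \<Gamma> A k
    unfolding is_acyclic_def is_contr_contraction
    using sig_form[OF susp_form[OF that] contraction_form[OF weakening1_type[OF susp_form[OF that]
        susp_form[OF that]]
        var_zero[OF susp_form[OF that]]]] .
  \<comment> \<open>A single level for \<open>A\<close>, the family and the types built from them.
    The successor is due to \<open>arr (Var 1) (Univ j)\<close>, which contains the universe
    \<open>Univ j\<close> itself.\<close>
  let ?m = "max i (Suc j)"
  let ?G1 = "[Univ i]"
  let ?G2 = "is_acyclic (Var 0) # ?G1"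
  let ?G3 = "arr (Var 1) (Univ j) # ?G2"
  let ?G4 = "Pi (Var 2) (is_acyclic (App (Var 1) (Var 0))) # ?G3"
  have c1: "\<turnstile> ?G1 ctx" using ctx_ext[OF univ_intro[OF ctx_emp]] .
  have c2: "\<turnstile> ?G2 ctx"
    using ctx_ext[OF is_acyclic_form[of _ _ i]] var_typing[OF c1, of 0 "Univ i"]
        by (simp add: sigma)
  have A2: "?G2 \<turnstile> Var 1 \<Colon> Univ i" using var_typing[OF c2, of 1] by (simp add: sigma)
  have "?G2 \<turnstile> arr (Var 1) (Univ j) \<Colon> Univ ?m"
    by (rule arr_form[OF lift_level[OF A2] lift_level[OF univ_intro[OF c2]]]) simp_all
  then have c3: "\<turnstile> ?G3 ctx" by (rule ctx_ext)
  have A3: "?G3 \<turnstile> Var 2 \<Colon> Univ ?m"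
    by (rule lift_level[OF var_typing[OF c3, of 2 "Univ i"]]) (simp_all add: sigma)
  have c3': "\<turnstile> Var 2 # ?G3 ctx" using A3 by (rule ctx_ext)
  have "Var 2 # ?G3 \<turnstile> App (Var 1) (Var 0) \<Colon> Univ j"
    using app_arr[OF var_typing[OF c3', of 1 "arr (Var 3) (Univ j)"] var_typing[OF c3', of 0 "Var
        3"]]
    by (simp add: sigma sub_arr eval_nat_numeral)
  from pi_form[OF A3 is_acyclic_form[OF lift_level[OF this]]]
  have "?G3 \<turnstile> Pi (Var 2) (is_acyclic (App (Var 1) (Var 0))) \<Colon> Univ ?m"
    by simp
  then have c4: "\<turnstile> ?G4 ctx" by (rule ctx_ext)
  have A4: "?G4 \<turnstile> Var 3 \<Colon> Univ ?m"
    by (rule lift_level[OF var_typing[OF c4, of 3 "Univ i"]]) (simp_all add: sigma)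
  have c5: "\<turnstile> Var 3 # ?G4 ctx" using A4 by (rule ctx_ext)
  have "Var 3 # ?G4 \<turnstile> App (Var 2) (Var 0) \<Colon> Univ j"
    using app_arr[OF var_typing[OF c5, of 2 "arr (Var 4) (Univ j)"] var_typing[OF c5, of 0 "Var 4"]]
    by (simp add: sigma sub_arr eval_nat_numeral)
  then have B: "Var 3 # ?G4 \<turnstile> App (Var 2) (Var 0) \<Colon> Univ ?m"
    by (rule lift_level) simp
  have acA: "inhabited ?G4 (is_acyclic (Var 3))"
    using var_typing[OF c4, of 2 "is_acyclic (Var 3)"] unfolding inhabited_def
        by (auto simp: sub_ac sigma)
  have "Var 3 # ?G4 \<turnstile> Var 1 \<Colon> Pi (Var 4) (is_acyclic (App (Var 3) (Var 0)))"
    by (rule var_typing[OF c5]) (simp_all add: sub_ac sigma eval_nat_numeral)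
  from pi_elim[OF this var_typing[OF c5, of 0]]
  have "Var 3 # ?G4 \<turnstile> App (Var 1) (Var 0) \<Colon> is_acyclic (App (Var 2) (Var 0))"
    by (simp add: sub_ac sigma eval_nat_numeral)
  then have acB: "inhabited (Var 3 # ?G4) (is_acyclic (App (Var 2) (Var 0)))"
    unfolding inhabited_def by blast
  obtain t where "?G4 \<turnstile> t \<Colon> is_acyclic (Sig (Var 3) (App (Var 2) (Var 0)))"
    using is_acyclic_Sig[OF A4 B acA acB] unfolding inhabited_def by blast
  from pi_intro[OF pi_intro[OF pi_intro[OF pi_intro[OF this]]]] show ?thesis by (rule exI)
qed

end
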